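(* Let $k$ be a field of characteristic zero. The DG operad inclusion $\mathcal{C}\subset\mathcal{J}$ of the commutative operad into the Jacobi operad, given by $\mu\mapsto\mu$, is a quasi-isomorphism.
   Context: Operads are symmetric DG operads over $k$; complexes are cochain complexes. The right action of $\tau\in\mathbb{S}_n$ is normalized so that $(f\cdot\tau)(x_1,\dots,x_n)=\pm f(x_{\tau^{-1}(1)},\dots,x_{\tau^{-1}(n)})$ with Koszul sign. Products of arity $1$ elements are compositions. "DG operad generated by $X$" means generated by the elements of $X$ and their differentials, the differentials being free unless a relation says otherwise. $\mathcal{C}$ is the operad for (non-unital) commutative associative algebras, with trivial differential, generated by $\mu\in\mathcal{C}(2)^0$, $\mu\cdot(1\ 2)=\mu$, with $\mu\circ_1\mu=\mu\circ_2\mu$. $\mu^{(m)}$ denotes the iterated product of arity $m$, with $\mu^{(1)}$ the operadic unit. For an arity $1$ element $D$ and $n\geq1$, $\mathrm{DO}_n(D)$ denotes the relation $$\sum_{\substack{p+q=n+1\\ p\geq1}}(-1)^p\sum_{\sigma\in \mathrm{Sh}_{p,q}}\bigl(\mu^{(q+1)}\circ_1(D\circ_1\mu^{(p)})\bigr)\cdot\sigma^{-1}=0,$$ where $\mathrm{Sh}_{p,q}\subset\mathbb{S}_{n+1}$ is the set of $(p,q)$-shuffles ($\sigma(1)<\dots<\sigma(p)$, $\sigma(p+1)<\dots<\sigma(p+q)$). It says that $D$ is a differential operator of order $\leq n$. The Jacobi operad $\mathcal{J}$ is the DG operad generated by $\mu\in\mathcal{J}(2)^0$, $i\in\mathcal{J}(1)^{-2}$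 and $j\in\mathcal{J}(1)^{-1}$ with $\mu\cdot(1\ 2)=\mu$, subject to: $d(\mu)=0$; $\mu\circ_1\mu=\mu\circ_2\mu$; $i\,d(i)=d(i)\,i+2ji$; $ij=ji$; $d(i)j+j\,d(i)=0$; $j^2=0$; $\mathrm{DO}_1(j)$; $\mathrm{DO}_2(i)$. *)

theory Defs
  imports
    "HOL-Algebra.AbelCoset"
    "HOL-Algebra.Module"
    "HOL-Algebra.Algebraic_Closure_Type"
    "HOL-Combinatorics.Permutations"
begin

section \<open>Symmetric DG operads\<close>

definition ksign :: "int \<Rightarrow> 'k::comm_ring_1" where
  "ksign a = (if even a then 1 else - 1)"

text \<open>
  The \<open>k\<close>-vector spaces are modules (in the sense of HOL-Algebra) over the library's
  record \<open>ring_of_type_algebra\<close>, that is, over the type \<open>'k\<close> regarded as a ring.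
  The multiplicative fields of the module records play no role.
\<close>

definition linear_map :: "('k, 'a) module \<Rightarrow> ('k, 'b) module \<Rightarrow> ('a \<Rightarrow> 'b) \<Rightarrow> bool" where
  "linear_map M N f \<longleftrightarrow>
     f \<in> carrier M \<rightarrow> carrier N \<and>
     (\<forall>x\<in>carrier M. \<forall>y\<in>carrier M. f (x \<oplus>\<^bsub>M\<^esub> y) = f x \<oplus>\<^bsub>N\<^esub> f y) \<and>
     (\<forall>c. \<forall>x\<in>carrier M. f (c \<odot>\<^bsub>M\<^esub> x) = c \<odot>\<^bsub>N\<^esub> f x)"

text \<open>
  \<open>opcmp P n d\<close> is the component of arity \<open>n\<close> and cohomological degree \<open>d\<close>,
  \<open>pcomp P f i g\<close> is the partial composition of \<open>g\<close> into the \<open>i\<close>-th input of \<open>f\<close>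
  (inputs are numbered from 1), and \<open>act P f \<tau>\<close> is the right action of \<open>\<tau>\<close> on \<open>f\<close>.
\<close>

record ('k, 'a) dg_operad_data =
  opcmp :: "nat \<Rightarrow> int \<Rightarrow> ('k, 'a) module"
  odiff :: "'a \<Rightarrow> 'a"
  ounit :: "'a"
  pcomp :: "'a \<Rightarrow> nat \<Rightarrow> 'a \<Rightarrow> 'a"
  act :: "'a \<Rightarrow> (nat \<Rightarrow> nat) \<Rightarrow> 'a"

text \<open>
  The right action is normalized by
  \<open>(f \<cdot> \<tau>)(x\<^sub>1, \<dots>, x\<^sub>n) = \<plusminus> f(x\<^bsub>\<tau>\<inverse>(1)\<^esub>, \<dots>, x\<^bsub>\<tau>\<inverse>(n)\<^esub>)\<close>, so the \<open>p\<close>-th input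
  of \<open>f \<cdot> \<tau>\<close> enters the input \<open>\<tau> p\<close> of \<open>f\<close>. Hence the \<open>i\<close>-th input of \<open>f \<cdot> \<sigma>\<close> is the
  input \<open>\<sigma> i\<close> of \<open>f\<close>, and \<open>block_perm n \<sigma> i \<tau>\<close>, for \<open>\<tau>\<close> a permutation of \<open>{1..n}\<close>, is the
  permutation with \<open>(f \<cdot> \<sigma>) \<circ>\<^sub>i (g \<cdot> \<tau>) = (f \<circ>\<^bsub>\<sigma> i\<^esub> g) \<cdot> block_perm n \<sigma> i \<tau>\<close>.
\<close>

definition block_perm :: "nat \<Rightarrow> (nat \<Rightarrow> nat) \<Rightarrow> nat \<Rightarrow> (nat \<Rightarrow> nat) \<Rightarrow> nat \<Rightarrow> nat" where
  "block_perm n \<sigma> i \<tau> p =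
     (let shift = (\<lambda>s. if s < \<sigma> i then s else s + n - 1) in
      if p < i then shift (\<sigma> p)
      else if p < i + n then \<sigma> i + \<tau> (p - i + 1) - 1
      else shift (\<sigma> (p - n + 1)))"

locale dg_operad =
  fixes P :: "('k::field, 'a) dg_operad_data"
  assumes module_opcmp: "module ring_of_type_algebra (opcmp P n d)"
    and odiff_linear: "linear_map (opcmp P n d) (opcmp P n (d + 1)) (odiff P)"
    and odiff_odiff:
      "x \<in> carrier (opcmp P n d) \<Longrightarrow> odiff P (odiff P x) = \<zero>\<^bsub>opcmp P n (d + 2)\<^esub>"
    and ounit_closed: "ounit P \<in> carrier (opcmp P 1 0)"
    and act_linear:
      "\<tau> permutes {1..n} \<Longrightarrow> linear_map (opcmp P n d) (opcmp P n d) (\<lambda>f. act P f \<tau>)"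
    and act_id: "f \<in> carrier (opcmp P n d) \<Longrightarrow> act P f id = f"
    and act_comp:
      "\<lbrakk>f \<in> carrier (opcmp P n d); \<tau> permutes {1..n}; \<rho> permutes {1..n}\<rbrakk>
       \<Longrightarrow> act P (act P f \<tau>) \<rho> = act P f (\<tau> \<circ> \<rho>)"
    and odiff_act:
      "\<lbrakk>f \<in> carrier (opcmp P n d); \<tau> permutes {1..n}\<rbrakk>
       \<Longrightarrow> odiff P (act P f \<tau>) = act P (odiff P f) \<tau>"
    and pcomp_linear_left:
      "\<lbrakk>g \<in> carrier (opcmp P n b); 1 \<le> i; i \<le> m\<rbrakk>
       \<Longrightarrow> linear_map (opcmp P m a) (opcmp P (m + n - 1) (a + b)) (\<lambda>f. pcomp P f i g)"
    and pcomp_linear_right: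
      "\<lbrakk>f \<in> carrier (opcmp P m a); 1 \<le> i; i \<le> m\<rbrakk>
       \<Longrightarrow> linear_map (opcmp P n b) (opcmp P (m + n - 1) (a + b)) (\<lambda>g. pcomp P f i g)"
    and pcomp_unit_left: "f \<in> carrier (opcmp P n d) \<Longrightarrow> pcomp P (ounit P) 1 f = f"
    and pcomp_unit_right:
      "\<lbrakk>f \<in> carrier (opcmp P n d); 1 \<le> i; i \<le> n\<rbrakk> \<Longrightarrow> pcomp P f i (ounit P) = f"
    and pcomp_sequential:
      "\<lbrakk>f \<in> carrier (opcmp P m a); g \<in> carrier (opcmp P n b); h \<in> carrier (opcmp P l c);
        1 \<le> i; i \<le> m; 1 \<le> j; j \<le> n\<rbrakk>
       \<Longrightarrow> pcomp P (pcomp P f i g) (i + j - 1) h = pcomp P f i (pcomp P g j h)"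
    and pcomp_parallel:
      "\<lbrakk>f \<in> carrier (opcmp P m a); g \<in> carrier (opcmp P n b); h \<in> carrier (opcmp P l c);
        1 \<le> i; i < k; k \<le> m\<rbrakk>
       \<Longrightarrow> pcomp P (pcomp P f i g) (k + n - 1) h
         = ksign (b * c) \<odot>\<^bsub>opcmp P (m + n - 1 + l - 1) (a + b + c)\<^esub> pcomp P (pcomp P f k h) i g"
    and pcomp_act:
      "\<lbrakk>f \<in> carrier (opcmp P m a); g \<in> carrier (opcmp P n b); 1 \<le> i; i \<le> m;
        \<sigma> permutes {1..m}; \<tau> permutes {1..n}\<rbrakk>
       \<Longrightarrow> pcomp P (act P f \<sigma>) i (act P g \<tau>) = act P (pcomp P f (\<sigma> i) g) (block_perm n \<sigma> i \<tau>)"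
    and odiff_pcomp:
      "\<lbrakk>f \<in> carrier (opcmp P m a); g \<in> carrier (opcmp P n b); 1 \<le> i; i \<le> m\<rbrakk>
       \<Longrightarrow> odiff P (pcomp P f i g)
         = pcomp P (odiff P f) i g
           \<oplus>\<^bsub>opcmp P (m + n - 1) (a + b + 1)\<^esub>
           ksign a \<odot>\<^bsub>opcmp P (m + n - 1) (a + b + 1)\<^esub> pcomp P f i (odiff P g)"

locale dg_operad_hom = P: dg_operad P + Q: dg_operad Q
  for P :: "('k::field, 'a) dg_operad_data" and Q :: "('k, 'b) dg_operad_data" +
  fixes \<phi> :: "'a \<Rightarrow> 'b"
  assumes hom_linear: "linear_map (opcmp P n d) (opcmp Q n d) \<phi>"
    and hom_odiff: "x \<in> carrier (opcmp P n d) \<Longrightarrow> \<phi> (odiff P x) = odiff Q (\<phi> x)"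
    and hom_ounit: "\<phi> (ounit P) = ounit Q"
    and hom_pcomp:
      "\<lbrakk>f \<in> carrier (opcmp P m a); g \<in> carrier (opcmp P n b); 1 \<le> i; i \<le> m\<rbrakk>
       \<Longrightarrow> \<phi> (pcomp P f i g) = pcomp Q (\<phi> f) i (\<phi> g)"
    and hom_act:
      "\<lbrakk>f \<in> carrier (opcmp P n d); \<tau> permutes {1..n}\<rbrakk> \<Longrightarrow> \<phi> (act P f \<tau>) = act Q (\<phi> f) \<tau>"

definition cocycles :: "('k, 'a) dg_operad_data \<Rightarrow> nat \<Rightarrow> int \<Rightarrow> 'a set" where
  "cocycles P n d = {x \<in> carrier (opcmp P n d). odiff P x = \<zero>\<^bsub>opcmp P n (d + 1)\<^esub>}"

definition coboundaries :: "('k, 'a) dg_operad_data \<Rightarrow> nat \<Rightarrow> int \<Rightarrow> 'a set" where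
  "coboundaries P n d = odiff P ` carrier (opcmp P n (d - 1))"

definition cohomology :: "('k, 'a) dg_operad_data \<Rightarrow> nat \<Rightarrow> int \<Rightarrow> 'a set monoid" where
  "cohomology P n d = (opcmp P n d\<lparr>carrier := cocycles P n d\<rparr>) A_Mod (coboundaries P n d)"

text \<open>The map \<open>[x] \<mapsto> [\<phi> x]\<close> from \<open>H\<^sup>d(P(n))\<close> to \<open>H\<^sup>d(Q(n))\<close>.\<close>

definition cohomology_map ::
  "('k, 'b) dg_operad_data \<Rightarrow> nat \<Rightarrow> int \<Rightarrow> ('a \<Rightarrow> 'b) \<Rightarrow> 'a set \<Rightarrow> 'b set" where
  "cohomology_map Q n d \<phi> A = (\<Union>x\<in>A. a_r_coset (opcmp Q n d) (coboundaries Q n d) (\<phi> x))"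

definition operad_quasi_iso ::
  "('k::field, 'a) dg_operad_data \<Rightarrow> ('k, 'b) dg_operad_data \<Rightarrow> ('a \<Rightarrow> 'b) \<Rightarrow> bool" where
  "operad_quasi_iso P Q \<phi> \<longleftrightarrow>
     dg_operad_hom P Q \<phi> \<and>
     (\<forall>n d. cohomology_map Q n d \<phi> \<in> iso (cohomology P n d) (cohomology Q n d))"


section \<open>DG operads given by generators and relations\<close>

text \<open>
  The operad presented by generators and relations consists of the formal expressions built
  from the generators by the operations of a DG operad, modulo the least congruence
  containing the axioms of DG operads and the given relations. The differential of a
  generator \<open>x\<close> is the expression \<open>TDiff (TGen x)\<close>, so it is free unless a relation
  constrains it. A zero carries its arity and degree, so every expression has one type.
\<close>

datatype (dead 'k, 'g) dgterm =
    TZero nat int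
  | TUnit
  | TGen 'g
  | TDiff "('k, 'g) dgterm"
  | TAdd "('k, 'g) dgterm" "('k, 'g) dgterm"
  | TScale 'k "('k, 'g) dgterm"
  | TComp "('k, 'g) dgterm" nat "('k, 'g) dgterm"
  | TAct "('k, 'g) dgterm" "nat \<Rightarrow> nat"

record ('k, 'g) dg_presentation =
  gen_arity :: "'g \<Rightarrow> nat"
  gen_degree :: "'g \<Rightarrow> int"
  relations :: "(('k, 'g) dgterm \<times> ('k, 'g) dgterm) set"

primrec tarity :: "('k, 'g) dg_presentation \<Rightarrow> ('k, 'g) dgterm \<Rightarrow> nat" where
  "tarity \<Gamma> (TZero n d) = n"
| "tarity \<Gamma> TUnit = 1"
| "tarity \<Gamma> (TGen x) = gen_arity \<Gamma> x"
| "tarity \<Gamma> (TDiff t) = tarity \<Gamma> t"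
| "tarity \<Gamma> (TAdd t u) = tarity \<Gamma> t"
| "tarity \<Gamma> (TScale c t) = tarity \<Gamma> t"
| "tarity \<Gamma> (TComp t i u) = tarity \<Gamma> t + tarity \<Gamma> u - 1"
| "tarity \<Gamma> (TAct t \<tau>) = tarity \<Gamma> t"

primrec tdegree :: "('k, 'g) dg_presentation \<Rightarrow> ('k, 'g) dgterm \<Rightarrow> int" where
  "tdegree \<Gamma> (TZero n d) = d"
| "tdegree \<Gamma> TUnit = 0"
| "tdegree \<Gamma> (TGen x) = gen_degree \<Gamma> x"
| "tdegree \<Gamma> (TDiff t) = tdegree \<Gamma> t + 1"
| "tdegree \<Gamma> (TAdd t u) = tdegree \<Gamma> t"
| "tdegree \<Gamma> (TScale c t) = tdegree \<Gamma> t"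
| "tdegree \<Gamma> (TComp t i u) = tdegree \<Gamma> t + tdegree \<Gamma> u"
| "tdegree \<Gamma> (TAct t \<tau>) = tdegree \<Gamma> t"

definition same_type ::
  "('k, 'g) dg_presentation \<Rightarrow> ('k, 'g) dgterm \<Rightarrow> ('k, 'g) dgterm \<Rightarrow> bool" where
  "same_type \<Gamma> t u \<longleftrightarrow> tarity \<Gamma> t = tarity \<Gamma> u \<and> tdegree \<Gamma> t = tdegree \<Gamma> u"

primrec twf :: "('k, 'g) dg_presentation \<Rightarrow> ('k, 'g) dgterm \<Rightarrow> bool" where
  "twf \<Gamma> (TZero n d) \<longleftrightarrow> True"
| "twf \<Gamma> TUnit \<longleftrightarrow> True"
| "twf \<Gamma> (TGen x) \<longleftrightarrow> True"
| "twf \<Gamma> (TDiff t) \<longleftrightarrow> twf \<Gamma> t"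
| "twf \<Gamma> (TAdd t u) \<longleftrightarrow> twf \<Gamma> t \<and> twf \<Gamma> u \<and> same_type \<Gamma> t u"
| "twf \<Gamma> (TScale c t) \<longleftrightarrow> twf \<Gamma> t"
| "twf \<Gamma> (TComp t i u) \<longleftrightarrow> twf \<Gamma> t \<and> twf \<Gamma> u \<and> 1 \<le> i \<and> i \<le> tarity \<Gamma> t"
| "twf \<Gamma> (TAct t \<tau>) \<longleftrightarrow> twf \<Gamma> t \<and> \<tau> permutes {1..tarity \<Gamma> t}"

definition wf_presentation :: "('k, 'g) dg_presentation \<Rightarrow> bool" where
  "wf_presentation \<Gamma> \<longleftrightarrow> (\<forall>(t, u) \<in> relations \<Gamma>. twf \<Gamma> t \<and> twf \<Gamma> u \<and> same_type \<Gamma> t u)"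

inductive tcong ::
  "('k::field, 'g) dg_presentation \<Rightarrow> ('k, 'g) dgterm \<Rightarrow> ('k, 'g) dgterm \<Rightarrow> bool"
  for \<Gamma> :: "('k, 'g) dg_presentation"
where
  rel: "(t, u) \<in> relations \<Gamma> \<Longrightarrow> tcong \<Gamma> t u"
| refl: "twf \<Gamma> t \<Longrightarrow> tcong \<Gamma> t t"
| sym: "tcong \<Gamma> t u \<Longrightarrow> tcong \<Gamma> u t"
| trans: "tcong \<Gamma> t u \<Longrightarrow> tcong \<Gamma> u v \<Longrightarrow> tcong \<Gamma> t v"
\<comment> \<open>compatibility with the operations\<close>
| cong_diff: "tcong \<Gamma> t t' \<Longrightarrow> tcong \<Gamma> (TDiff t) (TDiff t')"
| cong_add: "\<lbrakk>tcong \<Gamma> t t'; tcong \<Gamma> u u'; same_type \<Gamma> t u\<rbrakk>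
    \<Longrightarrow> tcong \<Gamma> (TAdd t u) (TAdd t' u')"
| cong_scale: "tcong \<Gamma> t t' \<Longrightarrow> tcong \<Gamma> (TScale c t) (TScale c t')"
| cong_comp: "\<lbrakk>tcong \<Gamma> f f'; tcong \<Gamma> g g'; 1 \<le> i; i \<le> tarity \<Gamma> f\<rbrakk>
    \<Longrightarrow> tcong \<Gamma> (TComp f i g) (TComp f' i g')"
| cong_act: "\<lbrakk>tcong \<Gamma> f f'; \<tau> permutes {1..tarity \<Gamma> f}\<rbrakk>
    \<Longrightarrow> tcong \<Gamma> (TAct f \<tau>) (TAct f' \<tau>)"
\<comment> \<open>vector spaces\<close>
| add_assoc: "\<lbrakk>twf \<Gamma> t; twf \<Gamma> u; twf \<Gamma> v; same_type \<Gamma> t u; same_type \<Gamma> u v\<rbrakk>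
    \<Longrightarrow> tcong \<Gamma> (TAdd (TAdd t u) v) (TAdd t (TAdd u v))"
| add_comm: "\<lbrakk>twf \<Gamma> t; twf \<Gamma> u; same_type \<Gamma> t u\<rbrakk> \<Longrightarrow> tcong \<Gamma> (TAdd t u) (TAdd u t)"
| add_zero: "twf \<Gamma> t \<Longrightarrow> tcong \<Gamma> (TAdd t (TZero (tarity \<Gamma> t) (tdegree \<Gamma> t))) t"
| add_neg: "twf \<Gamma> t
    \<Longrightarrow> tcong \<Gamma> (TAdd t (TScale (- 1) t)) (TZero (tarity \<Gamma> t) (tdegree \<Gamma> t))"
| scale_add_right: "\<lbrakk>twf \<Gamma> t; twf \<Gamma> u; same_type \<Gamma> t u\<rbrakk>
    \<Longrightarrow> tcong \<Gamma> (TScale c (TAdd t u)) (TAdd (TScale c t) (TScale c u))"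
| scale_add_left: "twf \<Gamma> t \<Longrightarrow> tcong \<Gamma> (TScale (c + c') t) (TAdd (TScale c t) (TScale c' t))"
| scale_scale: "twf \<Gamma> t \<Longrightarrow> tcong \<Gamma> (TScale (c * c') t) (TScale c (TScale c' t))"
| scale_one: "twf \<Gamma> t \<Longrightarrow> tcong \<Gamma> (TScale 1 t) t"
\<comment> \<open>differential\<close>
| diff_add: "\<lbrakk>twf \<Gamma> t; twf \<Gamma> u; same_type \<Gamma> t u\<rbrakk>
    \<Longrightarrow> tcong \<Gamma> (TDiff (TAdd t u)) (TAdd (TDiff t) (TDiff u))"
| diff_scale: "twf \<Gamma> t \<Longrightarrow> tcong \<Gamma> (TDiff (TScale c t)) (TScale c (TDiff t))"
| diff_diff: "twf \<Gamma> t \<Longrightarrow> tcong \<Gamma> (TDiff (TDiff t)) (TZero (tarity \<Gamma> t) (tdegree \<Gamma> t + 2))"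
\<comment> \<open>symmetric group actions\<close>
| act_add: "\<lbrakk>twf \<Gamma> t; twf \<Gamma> u; same_type \<Gamma> t u; \<tau> permutes {1..tarity \<Gamma> t}\<rbrakk>
    \<Longrightarrow> tcong \<Gamma> (TAct (TAdd t u) \<tau>) (TAdd (TAct t \<tau>) (TAct u \<tau>))"
| act_scale: "\<lbrakk>twf \<Gamma> t; \<tau> permutes {1..tarity \<Gamma> t}\<rbrakk>
    \<Longrightarrow> tcong \<Gamma> (TAct (TScale c t) \<tau>) (TScale c (TAct t \<tau>))"
| act_id: "twf \<Gamma> t \<Longrightarrow> tcong \<Gamma> (TAct t id) t"
| act_comp: "\<lbrakk>twf \<Gamma> t; \<tau> permutes {1..tarity \<Gamma> t}; \<rho> permutes {1..tarity \<Gamma> t}\<rbrakk>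
    \<Longrightarrow> tcong \<Gamma> (TAct (TAct t \<tau>) \<rho>) (TAct t (\<tau> \<circ> \<rho>))"
| diff_act: "\<lbrakk>twf \<Gamma> t; \<tau> permutes {1..tarity \<Gamma> t}\<rbrakk>
    \<Longrightarrow> tcong \<Gamma> (TDiff (TAct t \<tau>)) (TAct (TDiff t) \<tau>)"
\<comment> \<open>partial compositions\<close>
| comp_add_left: "\<lbrakk>twf \<Gamma> f; twf \<Gamma> f'; same_type \<Gamma> f f'; twf \<Gamma> g; 1 \<le> i; i \<le> tarity \<Gamma> f\<rbrakk>
    \<Longrightarrow> tcong \<Gamma> (TComp (TAdd f f') i g) (TAdd (TComp f i g) (TComp f' i g))"
| comp_scale_left: "\<lbrakk>twf \<Gamma> f; twf \<Gamma> g; 1 \<le> i; i \<le> tarity \<Gamma> f\<rbrakk>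
    \<Longrightarrow> tcong \<Gamma> (TComp (TScale c f) i g) (TScale c (TComp f i g))"
| comp_add_right: "\<lbrakk>twf \<Gamma> f; twf \<Gamma> g; twf \<Gamma> g'; same_type \<Gamma> g g'; 1 \<le> i; i \<le> tarity \<Gamma> f\<rbrakk>
    \<Longrightarrow> tcong \<Gamma> (TComp f i (TAdd g g')) (TAdd (TComp f i g) (TComp f i g'))"
| comp_scale_right: "\<lbrakk>twf \<Gamma> f; twf \<Gamma> g; 1 \<le> i; i \<le> tarity \<Gamma> f\<rbrakk>
    \<Longrightarrow> tcong \<Gamma> (TComp f i (TScale c g)) (TScale c (TComp f i g))"
| comp_unit_left: "twf \<Gamma> f \<Longrightarrow> tcong \<Gamma> (TComp TUnit 1 f) f"
| comp_unit_right: "\<lbrakk>twf \<Gamma> f; 1 \<le> i; i \<le> tarity \<Gamma> f\<rbrakk> \<Longrightarrow> tcong \<Gamma> (TComp f i TUnit) f"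
| comp_sequential:
    "\<lbrakk>twf \<Gamma> f; twf \<Gamma> g; twf \<Gamma> h; 1 \<le> i; i \<le> tarity \<Gamma> f; 1 \<le> j; j \<le> tarity \<Gamma> g\<rbrakk>
    \<Longrightarrow> tcong \<Gamma> (TComp (TComp f i g) (i + j - 1) h) (TComp f i (TComp g j h))"
| comp_parallel: "\<lbrakk>twf \<Gamma> f; twf \<Gamma> g; twf \<Gamma> h; 1 \<le> i; i < k; k \<le> tarity \<Gamma> f\<rbrakk>
    \<Longrightarrow> tcong \<Gamma> (TComp (TComp f i g) (k + tarity \<Gamma> g - 1) h)
         (TScale (ksign (tdegree \<Gamma> g * tdegree \<Gamma> h)) (TComp (TComp f k h) i g))"
| comp_act: "\<lbrakk>twf \<Gamma> f; twf \<Gamma> g; 1 \<le> i; i \<le> tarity \<Gamma> f;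
      \<sigma> permutes {1..tarity \<Gamma> f}; \<tau> permutes {1..tarity \<Gamma> g}\<rbrakk>
    \<Longrightarrow> tcong \<Gamma> (TComp (TAct f \<sigma>) i (TAct g \<tau>))
         (TAct (TComp f (\<sigma> i) g) (block_perm (tarity \<Gamma> g) \<sigma> i \<tau>))"
| diff_comp: "\<lbrakk>twf \<Gamma> f; twf \<Gamma> g; 1 \<le> i; i \<le> tarity \<Gamma> f\<rbrakk>
    \<Longrightarrow> tcong \<Gamma> (TDiff (TComp f i g))
         (TAdd (TComp (TDiff f) i g) (TScale (ksign (tdegree \<Gamma> f)) (TComp f i (TDiff g))))"

definition trel :: "('k::field, 'g) dg_presentation \<Rightarrow> (('k, 'g) dgterm \<times> ('k, 'g) dgterm) set" where
  "trel \<Gamma> = {(t, u). tcong \<Gamma> t u}"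

abbreviation tclass :: "('k::field, 'g) dg_presentation \<Rightarrow> ('k, 'g) dgterm \<Rightarrow> ('k, 'g) dgterm set" where
  "tclass \<Gamma> t \<equiv> trel \<Gamma> `` {t}"

definition terms :: "('k, 'g) dg_presentation \<Rightarrow> nat \<Rightarrow> int \<Rightarrow> ('k, 'g) dgterm set" where
  "terms \<Gamma> n d = {t. twf \<Gamma> t \<and> tarity \<Gamma> t = n \<and> tdegree \<Gamma> t = d}"

definition presented_operad ::
  "('k::field, 'g) dg_presentation \<Rightarrow> ('k, ('k, 'g) dgterm set) dg_operad_data" where
  "presented_operad \<Gamma> = \<lparr>
     opcmp = (\<lambda>n d. \<lparr>
       carrier = terms \<Gamma> n d // trel \<Gamma>,
       monoid.mult = undefined,
       one = undefined,
       ring.zero = tclass \<Gamma> (TZero n d),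
       add = (\<lambda>A B. \<Union>t\<in>A. \<Union>u\<in>B. tclass \<Gamma> (TAdd t u)),
       module.smult = (\<lambda>c A. \<Union>t\<in>A. tclass \<Gamma> (TScale c t))\<rparr>),
     odiff = (\<lambda>A. \<Union>t\<in>A. tclass \<Gamma> (TDiff t)),
     ounit = tclass \<Gamma> TUnit,
     pcomp = (\<lambda>A i B. \<Union>t\<in>A. \<Union>u\<in>B. tclass \<Gamma> (TComp t i u)),
     act = (\<lambda>A \<tau>. \<Union>t\<in>A. tclass \<Gamma> (TAct t \<tau>))\<rparr>"


section \<open>Differential operators\<close>

text \<open>\<open>mu_iter M m\<close> is the iterated product of arity \<open>m \<ge> 1\<close>; the value at 0 is never used.\<close>

fun mu_iter :: "('k, 'g) dgterm \<Rightarrow> nat \<Rightarrow> ('k, 'g) dgterm" where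
  "mu_iter M 0 = TZero 0 0"
| "mu_iter M (Suc 0) = TUnit"
| "mu_iter M (Suc (Suc m)) = TComp M 1 (mu_iter M (Suc m))"

definition shuffle_perms :: "nat \<Rightarrow> nat \<Rightarrow> (nat \<Rightarrow> nat) set" where
  "shuffle_perms p q =
     {\<sigma>. \<sigma> permutes {1..p + q} \<and> strict_mono_on {1..p} \<sigma> \<and> strict_mono_on {p + 1..p + q} \<sigma>}"

definition tsum :: "nat \<Rightarrow> int \<Rightarrow> ('k, 'g) dgterm list \<Rightarrow> ('k, 'g) dgterm" where
  "tsum n d ts = foldr TAdd ts (TZero n d)"

text \<open>
  The relation \<open>DO\<^sub>n(D)\<close> for \<open>D\<close> of degree \<open>d\<close>. Sums of expressions are ordered, so for each
  \<open>p\<close> the \<open>(p, n + 1 - p)\<close>-shuffles are listed without repetition as \<open>e p\<close>; all the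
  listings are admitted, and they give the same relation modulo the vector space axioms.
  (HOL-Algebra uses the notation for inverses, whence \<open>inv_into UNIV \<sigma>\<close> for the inverse of \<open>\<sigma>\<close>.)
\<close>

definition do_relation ::
  "('k::field, 'g) dgterm \<Rightarrow> ('k, 'g) dgterm \<Rightarrow> int \<Rightarrow> nat \<Rightarrow> (('k, 'g) dgterm \<times> ('k, 'g) dgterm) set" where
  "do_relation M D d n =
     {(tsum (n + 1) d
         (concat (map (\<lambda>p. map (\<lambda>\<sigma>. TScale ((- 1) ^ p)
              (TAct (TComp (mu_iter M (n + 1 - p + 1)) 1 (TComp D 1 (mu_iter M p))) (inv_into UNIV \<sigma>)))
            (e p)) [1..<n + 2])),
       TZero (n + 1) d) |
      e. \<forall>p\<in>{1..n + 1}. distinct (e p) \<and> set (e p) = shuffle_perms p (n + 1 - p)}"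


section \<open>The commutative operad and the Jacobi operad\<close>

datatype comm_gen = CMu

definition comm_presentation :: "('k::field, comm_gen) dg_presentation" where
  "comm_presentation = \<lparr>
     gen_arity = (\<lambda>_. 2),
     gen_degree = (\<lambda>_. 0),
     relations =
       (let \<mu> = TGen CMu in
        {(TDiff \<mu>, TZero 2 1),
         (TAct \<mu> (transpose 1 2), \<mu>),
         (TComp \<mu> 1 \<mu>, TComp \<mu> 2 \<mu>)})\<rparr>"

definition comm_operad :: "('k::field, ('k, comm_gen) dgterm set) dg_operad_data" where
  "comm_operad = presented_operad comm_presentation"

datatype jacobi_gen = JMu | JI | JJ

definition jacobi_presentation :: "('k::field, jacobi_gen) dg_presentation" where
  "jacobi_presentation = \<lparr>
     gen_arity = (\<lambda>x. case x of JMu \<Rightarrow> 2 | JI \<Rightarrow> 1 | JJ \<Rightarrow> 1),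
     gen_degree = (\<lambda>x. case x of JMu \<Rightarrow> 0 | JI \<Rightarrow> - 2 | JJ \<Rightarrow> - 1),
     relations =
       (let \<mu> = TGen JMu; i = TGen JI; j = TGen JJ; prod = (\<lambda>t u. TComp t 1 u) in
        {(TDiff \<mu>, TZero 2 1),
         (TAct \<mu> (transpose 1 2), \<mu>),
         (TComp \<mu> 1 \<mu>, TComp \<mu> 2 \<mu>),
         (prod i (TDiff i), TAdd (prod (TDiff i) i) (TScale 2 (prod j i))),
         (prod i j, prod j i),
         (TAdd (prod (TDiff i) j) (prod j (TDiff i)), TZero 1 (- 2)),
         (prod j j, TZero 1 (- 2))}
        \<union> do_relation \<mu> j (- 1) 1
        \<union> do_relation \<mu> i (- 2) 2)\<rparr>"

definition jacobi_operad :: "('k::field, ('k, jacobi_gen) dgterm set) dg_operad_data" where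
  "jacobi_operad = presented_operad jacobi_presentation"

definition comm_mu :: "('k::field, comm_gen) dgterm set" where
  "comm_mu = tclass comm_presentation (TGen CMu)"

definition jacobi_mu :: "('k::field, jacobi_gen) dgterm set" where
  "jacobi_mu = tclass jacobi_presentation (TGen JMu)"

text \<open>The map given by \<open>\<mu> \<mapsto> \<mu>\<close>: rename the generator in an expression.\<close>

definition comm_to_jacobi ::
  "('k::field, comm_gen) dgterm set \<Rightarrow> ('k, jacobi_gen) dgterm set" where
  "comm_to_jacobi A = (\<Union>t\<in>A. tclass jacobi_presentation (map_dgterm (\<lambda>_. JMu) t))"


section \<open>The presented operads are DG operads with the expected universal property\<close>


lemma block_perm_permutes:
  assumes \<sigma>: "\<sigma> permutes {1..m}" and \<tau>: "\<tau> permutes {1..n}" and i: "1 \<le> i" "i \<le> m"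
  shows "block_perm n \<sigma> i \<tau> permutes {1..m + n - 1}"
proof -
  have s: "1 \<le> \<sigma> p \<and> \<sigma> p \<le> m \<longleftrightarrow> 1 \<le> p \<and> p \<le> m" for p
    using permutes_in_image[OF \<sigma>, of p] by simp
  have t: "1 \<le> \<tau> p \<and> \<tau> p \<le> n \<longleftrightarrow> 1 \<le> p \<and> p \<le> n" for p
    using permutes_in_image[OF \<tau>, of p] by simp
  have inj_s: "\<sigma> p = \<sigma> q \<longleftrightarrow> p = q" for p q
    using permutes_inj[OF \<sigma>] by (auto dest: injD)
  have inj_t: "\<tau> p = \<tau> q \<longleftrightarrow> p = q" for p q
    using permutes_inj[OF \<tau>] by (auto dest: injD)
  have out: "\<sigma> p = p" if "\<not> (1 \<le> p \<and> p \<le> m)" for p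
    using permutes_not_in[OF \<sigma>, of p] that by auto
  have si: "1 \<le> \<sigma> i" "\<sigma> i \<le> m" using s i by blast+
  let ?f = "block_perm n \<sigma> i \<tau>"
  have cases: "?f p = (if p < i then if \<sigma> p < \<sigma> i then \<sigma> p else \<sigma> p + n - 1
      else if p < i + n then \<sigma> i + \<tau> (p - i + 1) - 1
      else if \<sigma> (p - n + 1) < \<sigma> i then \<sigma> (p - n + 1) else \<sigma> (p - n + 1) + n - 1)" for p
    by (simp add: block_perm_def Let_def)
  have into: "?f p \<in> {1..m + n - 1}" if "p \<in> {1..m + n - 1}" for p
  proof -
    consider "p < i" | "i \<le> p" "p < i + n" | "i + n \<le> p" by linarith
    then show ?thesis
    proof cases
      case 1
      then show ?thesis using s[of p] i that si inj_s[of p i] by (auto simp: cases)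
    next
      case 2
      then show ?thesis using t[of "p - i + 1"] si by (auto simp: cases)
    next
      case 3
      then show ?thesis using s[of "p - n + 1"] i that si inj_s[of "p - n + 1" i]
        by (auto simp: cases)
    qed
  qed
  have inj: "inj_on ?f {1..m + n - 1}"
  proof (rule inj_onI)
    fix p q assume p: "p \<in> {1..m + n - 1}" and q: "q \<in> {1..m + n - 1}" and eq: "?f p = ?f q"
    let ?a = "\<lambda>p. if p < i then p else p - n + 1"
    let ?sh = "\<lambda>s. if s < \<sigma> i then s else s + n - 1"
    have outer: "?f p = ?sh (\<sigma> (?a p)) \<and> \<sigma> (?a p) \<noteq> \<sigma> i" if "\<not> (i \<le> p \<and> p < i + n)" for p
      using that i unfolding cases inj_s by auto
    have inner: "?f p = \<sigma> i + \<tau> (p - i + 1) - 1 \<and> 1 \<le> \<tau> (p - i + 1) \<and> \<tau> (p - i + 1) \<le> n"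
      if "i \<le> p \<and> p < i + n" for p
      using that t[of "p - i + 1"] unfolding cases by auto
    have sh_inj: "s = s'" if "?sh s = ?sh s'" "s \<noteq> \<sigma> i" "s' \<noteq> \<sigma> i" for s s'
      using that si by (auto split: if_splits)
    have sh_out: "?sh s \<noteq> \<sigma> i + r - 1" if "s \<noteq> \<sigma> i" "1 \<le> r" "r \<le> n" for s r
      using that si by auto
    consider "i \<le> p \<and> p < i + n" "i \<le> q \<and> q < i + n"
      | "\<not> (i \<le> p \<and> p < i + n)" "\<not> (i \<le> q \<and> q < i + n)"
      | "i \<le> p \<and> p < i + n" "\<not> (i \<le> q \<and> q < i + n)"
      | "\<not> (i \<le> p \<and> p < i + n)" "i \<le> q \<and> q < i + n" by blast
    then show "p = q"
    proof cases
      case 1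
      then have "\<tau> (p - i + 1) = \<tau> (q - i + 1)" using inner[of p] inner[of q] eq by linarith
      then show ?thesis using 1 unfolding inj_t by auto
    next
      case 2
      then have "\<sigma> (?a p) = \<sigma> (?a q)" using outer[OF 2(1)] outer[OF 2(2)] eq sh_inj by metis
      then have "?a p = ?a q" unfolding inj_s .
      then show ?thesis using 2 by (auto split: if_splits)
    next
      case 3
      then show ?thesis using inner[OF 3(1)] outer[OF 3(2)] sh_out eq by metis
    next
      case 4
      then show ?thesis using inner[OF 4(2)] outer[OF 4(1)] sh_out eq by metis
    qed
  qed
  have id_out: "?f p = p" if "p \<notin> {1..m + n - 1}" for p
  proof (cases "p = 0")
    case True
    then show ?thesis using i si out[of 0] by (simp add: cases)
  next
    case False
    then have p: "m + n \<le> p" using that i by simp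
    then have "\<sigma> (p - n + 1) = p - n + 1" by (intro out) simp
    moreover have "\<not> p - n + 1 < \<sigma> i" "\<not> p < i" "\<not> p < i + n" "p - n + 1 + n - 1 = p"
      using p i si by linarith+
    ultimately show ?thesis unfolding cases by presburger
  qed
  have "?f ` {1..m + n - 1} = {1..m + n - 1}"
    using into inj by (intro endo_inj_surj) auto
  then have "bij_betw ?f {1..m + n - 1} {1..m + n - 1}"
    using inj by (simp add: bij_betw_def)
  then show ?thesis
    using id_out by (rule bij_imp_permutes)
qed

lemma tcong_typed:
  assumes "wf_presentation \<Gamma>" and "tcong \<Gamma> t u"
  shows "twf \<Gamma> t \<and> twf \<Gamma> u \<and> same_type \<Gamma> t u"
  using assms(2)
proof (induction rule: tcong.induct)
  case (rel t u)
  then show ?case using assms(1) by (auto simp: wf_presentation_def)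
next
  case (comp_act f g i \<sigma> \<tau>)
  then have "1 \<le> \<sigma> i \<and> \<sigma> i \<le> tarity \<Gamma> f"
    using permutes_in_image[of \<sigma> "{1..tarity \<Gamma> f}" i] by simp
  then show ?case using comp_act block_perm_permutes[of \<sigma> _ \<tau> _ i] by (simp add: same_type_def)
next
  case (act_comp t \<tau> \<rho>)
  then show ?case by (simp add: same_type_def permutes_compose)
qed (auto simp: same_type_def permutes_id)

lemma shuffle_perms_finite: "finite (shuffle_perms p q)"
  unfolding shuffle_perms_def
  by (rule finite_subset[OF _ finite_permutations[of "{1..p + q}"]]) auto

lemma do_relation_nonempty: "do_relation M D d n \<noteq> {}"
proof -
  have "\<forall>p. \<exists>xs. distinct xs \<and> set xs = shuffle_perms p (n + 1 - p)"
    using finite_distinct_list[OF shuffle_perms_finite] by metis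
  then obtain e where "\<And>p. distinct (e p) \<and> set (e p) = shuffle_perms p (n + 1 - p)" by metis
  then show ?thesis unfolding do_relation_def by blast
qed

lemma tsum_typed:
  assumes "\<And>t. t \<in> set ts \<Longrightarrow> t \<in> terms \<Gamma> n d"
  shows "tsum n d ts \<in> terms \<Gamma> n d"
  using assms by (induction ts) (auto simp: tsum_def terms_def same_type_def)

lemma mu_iter_typed:
  assumes "M \<in> terms \<Gamma> 2 0"
  shows "mu_iter M (Suc m) \<in> terms \<Gamma> (Suc m) 0"
  using assms by (induction m) (auto simp: terms_def)

lemma do_relation_typed:
  assumes M: "M \<in> terms \<Gamma> 2 0" and D: "D \<in> terms \<Gamma> 1 d" and tu: "(t, u) \<in> do_relation M D d n"
  shows "t \<in> terms \<Gamma> (n + 1) d \<and> u \<in> terms \<Gamma> (n + 1) d"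
proof -
  define g where "g = (\<lambda>p \<sigma>. TScale ((- 1) ^ p)
     (TAct (TComp (mu_iter M (n + 1 - p + 1)) 1 (TComp D 1 (mu_iter M p))) (inv_into UNIV \<sigma>)))"
  have g: "g p \<sigma> \<in> terms \<Gamma> (n + 1) d"
    if "p \<in> {1..n + 1}" "\<sigma> \<in> shuffle_perms p (n + 1 - p)" for p \<sigma>
  proof -
    have "\<sigma> permutes {1..n + 1}" using that by (simp add: shuffle_perms_def)
    then have "inv_into UNIV \<sigma> permutes {1..Suc n}" by (simp add: permutes_inv)
    moreover have "mu_iter M p \<in> terms \<Gamma> p 0"
      using mu_iter_typed[OF M, of "p - 1"] that(1) by simp
    moreover have "mu_iter M (n + 1 - p + 1) \<in> terms \<Gamma> (n + 1 - p + 1) 0"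
      using mu_iter_typed[OF M, of "n + 1 - p"] by simp
    ultimately show ?thesis using D that(1) by (auto simp: terms_def g_def)
  qed
  obtain e where t: "t = tsum (n + 1) d (concat (map (\<lambda>p. map (g p) (e p)) [1..<n + 2]))"
    and u: "u = TZero (n + 1) d"
    and e: "\<And>p. p \<in> {1..n + 1} \<Longrightarrow> set (e p) = shuffle_perms p (n + 1 - p)"
    using tu unfolding do_relation_def g_def by blast
  have "t \<in> terms \<Gamma> (n + 1) d"
    unfolding t
  proof (rule tsum_typed)
    fix x assume "x \<in> set (concat (map (\<lambda>p. map (g p) (e p)) [1..<n + 2]))"
    then obtain p \<sigma> where "p \<in> {1..n + 1}" "\<sigma> \<in> set (e p)" "x = g p \<sigma>" by fastforce
    then show "x \<in> terms \<Gamma> (n + 1) d" using e g by simp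
  qed
  then show ?thesis by (simp add: u terms_def)
qed

lemma wf_comm_presentation: "wf_presentation comm_presentation"
  by (auto simp: wf_presentation_def comm_presentation_def same_type_def Let_def
      intro!: permutes_swap_id)

lemma wf_jacobi_presentation: "wf_presentation (jacobi_presentation :: ('k::field, jacobi_gen) dg_presentation)"
proof -
  let ?P = "jacobi_presentation :: ('k, jacobi_gen) dg_presentation"
  have [simp]: "gen_arity ?P JMu = 2" "gen_arity ?P JI = 1" "gen_arity ?P JJ = 1"
    "gen_degree ?P JMu = 0" "gen_degree ?P JI = - 2" "gen_degree ?P JJ = - 1"
    by (simp_all add: jacobi_presentation_def)
  have gens: "TGen JMu \<in> terms ?P 2 0" "TGen JI \<in> terms ?P 1 (- 2)" "TGen JJ \<in> terms ?P 1 (- 1)"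
    by (auto simp: terms_def)
  have "twf ?P t \<and> twf ?P u \<and> same_type ?P t u" if "(t, u) \<in> relations ?P" for t u
  proof (cases "(t, u) \<in> do_relation (TGen JMu) (TGen JJ) (- 1) 1 \<union> do_relation (TGen JMu) (TGen JI) (- 2) 2")
    case True
    then show ?thesis
      using do_relation_typed[OF gens(1) gens(2)] do_relation_typed[OF gens(1) gens(3)]
      by (fastforce simp: terms_def same_type_def)
  next
    case False
    have "transpose 1 2 permutes {1..2::nat}" by (auto intro!: permutes_swap_id)
    with that False show ?thesis
      by (subst (asm) jacobi_presentation_def) (auto simp: same_type_def Let_def)
  qed
  then show ?thesis by (auto simp: wf_presentation_def)
qed


locale wf_dg_presentation =
  fixes \<Gamma> :: "('k::field, 'g) dg_presentation"
  assumes wf: "wf_presentation \<Gamma>"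
begin

abbreviation cong (infix "\<approx>" 50) where "t \<approx> u \<equiv> tcong \<Gamma> t u"
abbreviation cl where "cl t \<equiv> tclass \<Gamma> t"
abbreviation "Op \<equiv> presented_operad \<Gamma>"

lemma typed: "t \<approx> u \<Longrightarrow> twf \<Gamma> t \<and> twf \<Gamma> u \<and> same_type \<Gamma> t u"
  using tcong_typed[OF wf] .

lemma equiv_trel: "equiv {t. twf \<Gamma> t} (trel \<Gamma>)"
  by (rule equivI)
    (auto simp: refl_on_def sym_def trans_def trel_def dest: typed
      intro: tcong.refl tcong.sym tcong.trans)

lemma mem_cl: "u \<in> cl t \<longleftrightarrow> t \<approx> u"
  by (simp add: trel_def)

lemma cl_eq: "t \<approx> u \<Longrightarrow> cl t = cl u"
  unfolding trel_def by (auto intro: tcong.sym tcong.trans)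

lemma cl_eq_iff: "twf \<Gamma> u \<Longrightarrow> cl t = cl u \<longleftrightarrow> t \<approx> u"
  using cl_eq mem_cl tcong.refl by blast

lemma cl_UN: "(\<And>u. t \<approx> u \<Longrightarrow> f t = f u) \<Longrightarrow> twf \<Gamma> t \<Longrightarrow> (\<Union>u\<in>cl t. f u) = f t"
  using mem_cl tcong.refl by blast

lemma carrier_iff: "A \<in> carrier (opcmp Op n d) \<longleftrightarrow> (\<exists>t \<in> terms \<Gamma> n d. A = cl t)"
  by (auto simp: presented_operad_def quotient_def)

lemma carrierI: "t \<in> terms \<Gamma> n d \<Longrightarrow> cl t \<in> carrier (opcmp Op n d)"
  using carrier_iff by blast

lemma carrierE: "A \<in> carrier (opcmp Op n d) \<Longrightarrow> (\<And>t. t \<in> terms \<Gamma> n d \<Longrightarrow> A = cl t \<Longrightarrow> thesis) \<Longrightarrow> thesis"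
  using carrier_iff by blast

lemma zero_cl: "\<zero>\<^bsub>opcmp Op n d\<^esub> = cl (TZero n d)"
  by (simp add: presented_operad_def)

lemma unit_cl: "ounit Op = cl TUnit"
  by (simp add: presented_operad_def)

lemma add_cl:
  assumes "t \<in> terms \<Gamma> n d" "u \<in> terms \<Gamma> n d"
  shows "cl t \<oplus>\<^bsub>opcmp Op n' d'\<^esub> cl u = cl (TAdd t u)"
proof -
  have "(\<Union>t'\<in>cl t. \<Union>u'\<in>cl u. cl (TAdd t' u')) = cl (TAdd t u)"
  proof (subst cl_UN)
    fix t' assume t': "t \<approx> t'"
    show "(\<Union>u'\<in>cl u. cl (TAdd t u')) = (\<Union>u'\<in>cl u. cl (TAdd t' u'))"
      using t' typed[OF t'] assms
      by (intro SUP_cong HOL.refl cl_eq tcong.cong_add)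
        (auto simp: mem_cl terms_def same_type_def simp del: Image_singleton_iff dest: typed intro: tcong.refl)
  next
    show "(\<Union>u'\<in>cl u. cl (TAdd t u')) = cl (TAdd t u)"
      using assms by (intro cl_UN cl_eq tcong.cong_add) (auto simp: terms_def same_type_def intro: tcong.refl)
  qed (use assms in \<open>auto simp: terms_def\<close>)
  then show ?thesis by (simp add: presented_operad_def)
qed

lemma smult_cl: "t \<in> terms \<Gamma> n d \<Longrightarrow> c \<odot>\<^bsub>opcmp Op n' d'\<^esub> cl t = cl (TScale c t)"
  by (auto simp add: presented_operad_def terms_def intro!: cl_UN cl_eq tcong.cong_scale)

lemma odiff_cl: "t \<in> terms \<Gamma> n d \<Longrightarrow> odiff Op (cl t) = cl (TDiff t)"
  by (auto simp add: presented_operad_def terms_def intro!: cl_UN cl_eq tcong.cong_diff)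

lemma act_cl: "t \<in> terms \<Gamma> n d \<Longrightarrow> \<tau> permutes {1..n} \<Longrightarrow> act Op (cl t) \<tau> = cl (TAct t \<tau>)"
  by (auto simp add: presented_operad_def terms_def intro!: cl_UN cl_eq tcong.cong_act)

lemma pcomp_cl:
  assumes "t \<in> terms \<Gamma> n d" "u \<in> terms \<Gamma> n' d'" "1 \<le> i" "i \<le> n"
  shows "pcomp Op (cl t) i (cl u) = cl (TComp t i u)"
proof -
  have "(\<Union>t'\<in>cl t. \<Union>u'\<in>cl u. cl (TComp t' i u')) = cl (TComp t i u)"
  proof (subst cl_UN)
    fix t' assume t': "t \<approx> t'"
    show "(\<Union>u'\<in>cl u. cl (TComp t i u')) = (\<Union>u'\<in>cl u. cl (TComp t' i u'))"
      using t' typed[OF t'] assms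
      by (intro SUP_cong HOL.refl cl_eq tcong.cong_comp)
        (auto simp: mem_cl terms_def same_type_def simp del: Image_singleton_iff dest: typed intro: tcong.refl)
  next
    show "(\<Union>u'\<in>cl u. cl (TComp t i u')) = cl (TComp t i u)"
      using assms by (intro cl_UN cl_eq tcong.cong_comp) (auto simp: terms_def same_type_def intro: tcong.refl)
  qed (use assms in \<open>auto simp: terms_def\<close>)
  then show ?thesis by (simp add: presented_operad_def)
qed

lemma terms_intros:
  "TZero n d \<in> terms \<Gamma> n d"
  "TUnit \<in> terms \<Gamma> 1 0"
  "t \<in> terms \<Gamma> n d \<Longrightarrow> u \<in> terms \<Gamma> n d \<Longrightarrow> TAdd t u \<in> terms \<Gamma> n d"
  "t \<in> terms \<Gamma> n d \<Longrightarrow> TScale c t \<in> terms \<Gamma> n d"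
  "t \<in> terms \<Gamma> n d \<Longrightarrow> TDiff t \<in> terms \<Gamma> n (d + 1)"
  "t \<in> terms \<Gamma> n d \<Longrightarrow> \<tau> permutes {1..n} \<Longrightarrow> TAct t \<tau> \<in> terms \<Gamma> n d"
  "t \<in> terms \<Gamma> m a \<Longrightarrow> u \<in> terms \<Gamma> n b \<Longrightarrow> 1 \<le> i \<Longrightarrow> i \<le> m \<Longrightarrow> TComp t i u \<in> terms \<Gamma> (m + n - 1) (a + b)"
  by (auto simp: terms_def same_type_def)

lemma module_Op: "module ring_of_type_algebra (opcmp Op n d)"
proof (rule moduleI)
  show "cring (ring_of_type_algebra :: 'k ring)" by (rule cring_from_type_algebra)
  show "abelian_group (opcmp Op n d)"
  proof (rule abelian_groupI)
    fix A assume A: "A \<in> carrier (opcmp Op n d)"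
    then obtain t where t: "t \<in> terms \<Gamma> n d" "A = cl t" by (rule carrierE)
    show "\<zero>\<^bsub>opcmp Op n d\<^esub> \<oplus>\<^bsub>opcmp Op n d\<^esub> A = A"
      unfolding t zero_cl add_cl[OF terms_intros(1) t(1)]
      using t(1) tcong.add_comm[of \<Gamma> "TZero n d" t] tcong.add_zero[of \<Gamma> t]
      by (intro cl_eq) (auto simp: terms_def same_type_def intro: tcong.trans)
    have "TAdd (TScale (- 1) t) t \<approx> TAdd t (TScale (- 1) t)"
      using t(1) by (intro tcong.add_comm) (auto simp: terms_def same_type_def)
    moreover have "TAdd t (TScale (- 1) t) \<approx> TZero n d"
      using t(1) tcong.add_neg[of \<Gamma> t] by (auto simp: terms_def)
    ultimately have "TAdd (TScale (- 1) t) t \<approx> TZero n d" by (rule tcong.trans)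
    then show "\<exists>B\<in>carrier (opcmp Op n d). B \<oplus>\<^bsub>opcmp Op n d\<^esub> A = \<zero>\<^bsub>opcmp Op n d\<^esub>"
      using t carrierI add_cl[OF terms_intros(4)[OF t(1)] t(1)] zero_cl cl_eq terms_intros(4)[OF t(1)]
      by metis
    fix B assume "B \<in> carrier (opcmp Op n d)"
    then obtain u where u: "u \<in> terms \<Gamma> n d" "B = cl u" by (rule carrierE)
    show "A \<oplus>\<^bsub>opcmp Op n d\<^esub> B \<in> carrier (opcmp Op n d)"
      unfolding t u add_cl[OF t(1) u(1)] by (intro carrierI terms_intros t u)
    show "A \<oplus>\<^bsub>opcmp Op n d\<^esub> B = B \<oplus>\<^bsub>opcmp Op n d\<^esub> A"
      unfolding t u add_cl[OF t(1) u(1)] add_cl[OF u(1) t(1)]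
      using t(1) u(1) by (intro cl_eq tcong.add_comm) (auto simp: terms_def same_type_def)
    fix C assume "C \<in> carrier (opcmp Op n d)"
    then obtain v where v: "v \<in> terms \<Gamma> n d" "C = cl v" by (rule carrierE)
    show "(A \<oplus>\<^bsub>opcmp Op n d\<^esub> B) \<oplus>\<^bsub>opcmp Op n d\<^esub> C = A \<oplus>\<^bsub>opcmp Op n d\<^esub> (B \<oplus>\<^bsub>opcmp Op n d\<^esub> C)"
      unfolding t u v add_cl[OF t(1) u(1)] add_cl[OF u(1) v(1)]
        add_cl[OF terms_intros(3)[OF t(1) u(1)] v(1)] add_cl[OF t(1) terms_intros(3)[OF u(1) v(1)]]
      using t(1) u(1) v(1) by (intro cl_eq tcong.add_assoc) (auto simp: terms_def same_type_def)
  next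
    show "\<zero>\<^bsub>opcmp Op n d\<^esub> \<in> carrier (opcmp Op n d)"
      unfolding zero_cl by (intro carrierI terms_intros)
  qed
next
  fix c :: 'k and A assume A: "A \<in> carrier (opcmp Op n d)"
  then obtain t where t: "t \<in> terms \<Gamma> n d" "A = cl t" by (rule carrierE)
  note sc = terms_intros(4)[OF t(1)]
  show "c \<odot>\<^bsub>opcmp Op n d\<^esub> A \<in> carrier (opcmp Op n d)"
    unfolding t smult_cl[OF t(1)] by (intro carrierI sc)
  show "\<one>\<^bsub>ring_of_type_algebra\<^esub> \<odot>\<^bsub>opcmp Op n d\<^esub> A = A"
    unfolding t smult_cl[OF t(1)] using t(1)
    by (intro cl_eq) (auto simp: ring_of_type_algebra_def terms_def intro: tcong.scale_one)
  fix c' :: 'k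
  show "(c \<oplus>\<^bsub>ring_of_type_algebra\<^esub> c') \<odot>\<^bsub>opcmp Op n d\<^esub> A
      = c \<odot>\<^bsub>opcmp Op n d\<^esub> A \<oplus>\<^bsub>opcmp Op n d\<^esub> c' \<odot>\<^bsub>opcmp Op n d\<^esub> A"
    unfolding t smult_cl[OF t(1)] add_cl[OF sc sc] using t(1)
    by (intro cl_eq) (auto simp: ring_of_type_algebra_def terms_def intro: tcong.scale_add_left)
  show "(c \<otimes>\<^bsub>ring_of_type_algebra\<^esub> c') \<odot>\<^bsub>opcmp Op n d\<^esub> A
      = c \<odot>\<^bsub>opcmp Op n d\<^esub> (c' \<odot>\<^bsub>opcmp Op n d\<^esub> A)"
    unfolding t smult_cl[OF t(1)] smult_cl[OF sc] using t(1)
    by (intro cl_eq) (auto simp: ring_of_type_algebra_def terms_def intro: tcong.scale_scale)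
  fix B assume "B \<in> carrier (opcmp Op n d)"
  then obtain u where u: "u \<in> terms \<Gamma> n d" "B = cl u" by (rule carrierE)
  show "c \<odot>\<^bsub>opcmp Op n d\<^esub> (A \<oplus>\<^bsub>opcmp Op n d\<^esub> B)
      = c \<odot>\<^bsub>opcmp Op n d\<^esub> A \<oplus>\<^bsub>opcmp Op n d\<^esub> c \<odot>\<^bsub>opcmp Op n d\<^esub> B"
    unfolding t u smult_cl[OF t(1)] smult_cl[OF u(1)] add_cl[OF t(1) u(1)]
      smult_cl[OF terms_intros(3)[OF t(1) u(1)]] add_cl[OF sc terms_intros(4)[OF u(1)]]
    using t(1) u(1) by (intro cl_eq tcong.scale_add_right) (auto simp: terms_def same_type_def)
qed

lemma linear_mapI:
  assumes "\<And>t. t \<in> terms \<Gamma> n d \<Longrightarrow> f (cl t) = cl (F t)"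
    and F: "\<And>t. t \<in> terms \<Gamma> n d \<Longrightarrow> F t \<in> terms \<Gamma> n' d'"
    and add: "\<And>t u. t \<in> terms \<Gamma> n d \<Longrightarrow> u \<in> terms \<Gamma> n d \<Longrightarrow> F (TAdd t u) \<approx> TAdd (F t) (F u)"
    and scale: "\<And>c t. t \<in> terms \<Gamma> n d \<Longrightarrow> F (TScale c t) \<approx> TScale c (F t)"
  shows "linear_map (opcmp Op n d) (opcmp Op n' d') f"
  unfolding linear_map_def
proof (intro conjI ballI allI Pi_I)
  fix A assume "A \<in> carrier (opcmp Op n d)"
  then obtain t where t: "t \<in> terms \<Gamma> n d" "A = cl t" by (rule carrierE)
  show "f A \<in> carrier (opcmp Op n' d')"
    unfolding t(2) assms(1)[OF t(1)] by (intro carrierI F t)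
  fix B assume "B \<in> carrier (opcmp Op n d)"
  then obtain u where u: "u \<in> terms \<Gamma> n d" "B = cl u" by (rule carrierE)
  show "f (A \<oplus>\<^bsub>opcmp Op n d\<^esub> B) = f A \<oplus>\<^bsub>opcmp Op n' d'\<^esub> f B"
    unfolding t(2) u(2) add_cl[OF t(1) u(1)] assms(1)[OF t(1)] assms(1)[OF u(1)]
      assms(1)[OF terms_intros(3)[OF t(1) u(1)]] add_cl[OF F[OF t(1)] F[OF u(1)]]
    by (intro cl_eq add t u)
next
  fix A c assume "A \<in> carrier (opcmp Op n d)"
  then obtain t where t: "t \<in> terms \<Gamma> n d" "A = cl t" by (rule carrierE)
  show "f (c \<odot>\<^bsub>opcmp Op n d\<^esub> A) = c \<odot>\<^bsub>opcmp Op n' d'\<^esub> f A"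
    unfolding t(2) smult_cl[OF t(1)] assms(1)[OF t(1)] assms(1)[OF terms_intros(4)[OF t(1)]]
      smult_cl[OF F[OF t(1)]]
    by (intro cl_eq scale t)
qed

theorem dg_operad_Op: "dg_operad Op"
proof (rule dg_operad.intro, goal_cases)
  case (1 n d) show ?case by (rule module_Op)
next
  case (2 n d)
  show ?case
    by (rule linear_mapI[where F = TDiff])
      (auto simp: odiff_cl terms_def same_type_def intro: tcong.diff_add tcong.diff_scale)
next
  case (3 x n d)
  then obtain t where t: "t \<in> terms \<Gamma> n d" "x = cl t" by (rule carrierE)
  show ?case
    unfolding t(2) odiff_cl[OF t(1)] odiff_cl[OF terms_intros(5)[OF t(1)]] zero_cl
    using t(1) tcong.diff_diff[of \<Gamma> t] by (intro cl_eq) (auto simp: terms_def)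
next
  case 4 show ?case unfolding unit_cl by (intro carrierI terms_intros)
next
  case (5 \<tau> n d)
  then show ?case
    by (intro linear_mapI[where F = "\<lambda>t. TAct t \<tau>"])
      (auto simp: act_cl terms_def same_type_def intro: tcong.act_add tcong.act_scale)
next
  case (6 f n d)
  then obtain t where t: "t \<in> terms \<Gamma> n d" "f = cl t" by (rule carrierE)
  show ?case
    unfolding t(2) act_cl[OF t(1) permutes_id] using t(1)
    by (intro cl_eq tcong.act_id) (auto simp: terms_def)
next
  case (7 f n d \<tau> \<rho>)
  from 7(1) obtain t where t: "t \<in> terms \<Gamma> n d" "f = cl t" by (rule carrierE)
  show ?case
    unfolding t(2) act_cl[OF t(1) 7(2)] act_cl[OF terms_intros(6)[OF t(1) 7(2)] 7(3)]
      act_cl[OF t(1) permutes_compose[OF 7(3,2)]]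
    using t(1) 7(2,3) by (intro cl_eq tcong.act_comp) (auto simp: terms_def)
next
  case (8 f n d \<tau>)
  from 8(1) obtain t where t: "t \<in> terms \<Gamma> n d" "f = cl t" by (rule carrierE)
  show ?case
    unfolding t(2) act_cl[OF t(1) 8(2)] odiff_cl[OF terms_intros(6)[OF t(1) 8(2)]]
      odiff_cl[OF t(1)] act_cl[OF terms_intros(5)[OF t(1)] 8(2)]
    using t(1) 8(2) by (intro cl_eq tcong.diff_act) (auto simp: terms_def)
next
  case (9 g n b i m a)
  from 9(1) obtain u where u: "u \<in> terms \<Gamma> n b" "g = cl u" by (rule carrierE)
  show ?case
    by (rule linear_mapI[where F = "\<lambda>t. TComp t i u"])
      (use u 9 in \<open>auto simp: pcomp_cl terms_def same_type_def intro: tcong.comp_add_left tcong.comp_scale_left\<close>)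
next
  case (10 f m a i n b)
  from 10(1) obtain u where u: "u \<in> terms \<Gamma> m a" "f = cl u" by (rule carrierE)
  show ?case
    by (rule linear_mapI[where F = "\<lambda>t. TComp u i t"])
      (use u 10 in \<open>auto simp: pcomp_cl terms_def same_type_def intro: tcong.comp_add_right tcong.comp_scale_right\<close>)
next
  case (11 f n d)
  then obtain t where t: "t \<in> terms \<Gamma> n d" "f = cl t" by (rule carrierE)
  show ?case
    unfolding t(2) unit_cl pcomp_cl[OF terms_intros(2) t(1) order.refl order.refl] using t(1)
    by (intro cl_eq tcong.comp_unit_left) (auto simp: terms_def)
next
  case (12 f n d i)
  from 12(1) obtain t where t: "t \<in> terms \<Gamma> n d" "f = cl t" by (rule carrierE)
  show ?case
    unfolding t(2) unit_cl pcomp_cl[OF t(1) terms_intros(2) 12(2,3)] using t(1) 12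
    by (intro cl_eq tcong.comp_unit_right) (auto simp: terms_def)
next
  case (13 f m a g n b h l c i j)
  from 13(1) obtain t where t: "t \<in> terms \<Gamma> m a" "f = cl t" by (rule carrierE)
  from 13(2) obtain u where u: "u \<in> terms \<Gamma> n b" "g = cl u" by (rule carrierE)
  from 13(3) obtain v where v: "v \<in> terms \<Gamma> l c" "h = cl v" by (rule carrierE)
  have k: "1 \<le> i + j - 1" "i + j - 1 \<le> m + n - 1" using 13(4-7) by linarith+
  show ?case
    unfolding t(2) u(2) v(2) pcomp_cl[OF t(1) u(1) 13(4,5)] pcomp_cl[OF u(1) v(1) 13(6,7)]
      pcomp_cl[OF terms_intros(7)[OF t(1) u(1) 13(4,5)] v(1) k]
      pcomp_cl[OF t(1) terms_intros(7)[OF u(1) v(1) 13(6,7)] 13(4,5)]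
    using t(1) u(1) v(1) 13 by (intro cl_eq tcong.comp_sequential) (auto simp: terms_def)
next
  case (14 f m a g n b h l c i k)
  from 14(1) obtain t where t: "t \<in> terms \<Gamma> m a" "f = cl t" by (rule carrierE)
  from 14(2) obtain u where u: "u \<in> terms \<Gamma> n b" "g = cl u" by (rule carrierE)
  from 14(3) obtain v where v: "v \<in> terms \<Gamma> l c" "h = cl v" by (rule carrierE)
  have i: "1 \<le> i" "i \<le> m" "1 \<le> k" "k \<le> m" "1 \<le> k + n - 1" "k + n - 1 \<le> m + n - 1" "i \<le> m + l - 1"
    using 14(4-6) by linarith+
  show ?case
    unfolding t(2) u(2) v(2) pcomp_cl[OF t(1) u(1) i(1,2)] pcomp_cl[OF t(1) v(1) i(3,4)]
      pcomp_cl[OF terms_intros(7)[OF t(1) u(1) i(1,2)] v(1) i(5,6)]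
      pcomp_cl[OF terms_intros(7)[OF t(1) v(1) i(3,4)] u(1) i(1,7)]
      smult_cl[OF terms_intros(7)[OF terms_intros(7)[OF t(1) v(1) i(3,4)] u(1) i(1,7)]]
    using t(1) u(1) v(1) 14(4-6) tcong.comp_parallel[of \<Gamma> t u v i k] by (intro cl_eq) (auto simp: terms_def)
next
  case (15 f m a g n b i \<sigma> \<tau>)
  from 15(1) obtain t where t: "t \<in> terms \<Gamma> m a" "f = cl t" by (rule carrierE)
  from 15(2) obtain u where u: "u \<in> terms \<Gamma> n b" "g = cl u" by (rule carrierE)
  have s: "1 \<le> \<sigma> i" "\<sigma> i \<le> m" using permutes_in_image[OF 15(5), of i] 15(3,4) by auto
  show ?case
    unfolding t(2) u(2) act_cl[OF t(1) 15(5)] act_cl[OF u(1) 15(6)] pcomp_cl[OF t(1) u(1) s]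
      pcomp_cl[OF terms_intros(6)[OF t(1) 15(5)] terms_intros(6)[OF u(1) 15(6)] 15(3,4)]
      act_cl[OF terms_intros(7)[OF t(1) u(1) s] block_perm_permutes[OF 15(5,6,3,4)]]
    using t(1) u(1) 15 tcong.comp_act[of \<Gamma> t u i \<sigma> \<tau>] by (intro cl_eq) (auto simp: terms_def)
next
  case (16 f m a g n b i)
  from 16(1) obtain t where t: "t \<in> terms \<Gamma> m a" "f = cl t" by (rule carrierE)
  from 16(2) obtain u where u: "u \<in> terms \<Gamma> n b" "g = cl u" by (rule carrierE)
  note dt = terms_intros(5)[OF t(1)] and du = terms_intros(5)[OF u(1)]
  have ty: "TComp (TDiff t) i u \<in> terms \<Gamma> (m + n - 1) (a + b + 1)"
     "TComp t i (TDiff u) \<in> terms \<Gamma> (m + n - 1) (a + b + 1)"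
    using terms_intros(7)[OF dt u(1) 16(3,4)] terms_intros(7)[OF t(1) du 16(3,4)]
    by (simp_all add: algebra_simps)
  show ?case
    unfolding t(2) u(2) odiff_cl[OF t(1)] odiff_cl[OF u(1)] pcomp_cl[OF t(1) u(1) 16(3,4)]
      pcomp_cl[OF dt u(1) 16(3,4)] pcomp_cl[OF t(1) du 16(3,4)]
      odiff_cl[OF terms_intros(7)[OF t(1) u(1) 16(3,4)]] smult_cl[OF ty(2)]
      add_cl[OF ty(1) terms_intros(4)[OF ty(2)]]
    using t(1) u(1) 16 tcong.diff_comp[of \<Gamma> t u i] by (intro cl_eq) (auto simp: terms_def)
qed

end


primrec teval ::
  "('k, 'a) dg_operad_data \<Rightarrow> ('k, 'g) dg_presentation \<Rightarrow> ('g \<Rightarrow> 'a) \<Rightarrow> ('k, 'g) dgterm \<Rightarrow> 'a" where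
  "teval Q \<Gamma> v (TZero n d) = \<zero>\<^bsub>opcmp Q n d\<^esub>"
| "teval Q \<Gamma> v TUnit = ounit Q"
| "teval Q \<Gamma> v (TGen x) = v x"
| "teval Q \<Gamma> v (TDiff t) = odiff Q (teval Q \<Gamma> v t)"
| "teval Q \<Gamma> v (TAdd t u) =
     teval Q \<Gamma> v t \<oplus>\<^bsub>opcmp Q (tarity \<Gamma> t) (tdegree \<Gamma> t)\<^esub> teval Q \<Gamma> v u"
| "teval Q \<Gamma> v (TScale c t) = c \<odot>\<^bsub>opcmp Q (tarity \<Gamma> t) (tdegree \<Gamma> t)\<^esub> teval Q \<Gamma> v t"
| "teval Q \<Gamma> v (TComp t i u) = pcomp Q (teval Q \<Gamma> v t) i (teval Q \<Gamma> v u)"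
| "teval Q \<Gamma> v (TAct t \<tau>) = act Q (teval Q \<Gamma> v t) \<tau>"

context dg_operad
begin

lemma abelian_group_opcmp: "abelian_group (opcmp P n d)"
  using module_opcmp[of n d] by (simp add: module_def)

lemma smult_simps:
  assumes "x \<in> carrier (opcmp P n d)"
  shows "c \<odot>\<^bsub>opcmp P n d\<^esub> x \<in> carrier (opcmp P n d)"
    "(c + c') \<odot>\<^bsub>opcmp P n d\<^esub> x = c \<odot>\<^bsub>opcmp P n d\<^esub> x \<oplus>\<^bsub>opcmp P n d\<^esub> c' \<odot>\<^bsub>opcmp P n d\<^esub> x"
    "(c * c') \<odot>\<^bsub>opcmp P n d\<^esub> x = c \<odot>\<^bsub>opcmp P n d\<^esub> (c' \<odot>\<^bsub>opcmp P n d\<^esub> x)"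
    "1 \<odot>\<^bsub>opcmp P n d\<^esub> x = x" "0 \<odot>\<^bsub>opcmp P n d\<^esub> x = \<zero>\<^bsub>opcmp P n d\<^esub>"
    "y \<in> carrier (opcmp P n d) \<Longrightarrow>
      c \<odot>\<^bsub>opcmp P n d\<^esub> (x \<oplus>\<^bsub>opcmp P n d\<^esub> y) = c \<odot>\<^bsub>opcmp P n d\<^esub> x \<oplus>\<^bsub>opcmp P n d\<^esub> c \<odot>\<^bsub>opcmp P n d\<^esub> y"
  using module.smult_closed[OF module_opcmp[of n d], of c x]
    module.smult_l_distr[OF module_opcmp[of n d], of c c' x]
    module.smult_assoc1[OF module_opcmp[of n d], of c c' x]
    module.smult_one[OF module_opcmp[of n d], of x]
    module.smult_l_null[OF module_opcmp[of n d], of x]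
    module.smult_r_distr[OF module_opcmp[of n d], of c x y] assms
  by (simp_all add: ring_of_type_algebra_def)

lemma teval_closed:
  assumes "\<And>x. v x \<in> carrier (opcmp P (gen_arity \<Gamma> x) (gen_degree \<Gamma> x))"
  shows "twf \<Gamma> t \<Longrightarrow> teval P \<Gamma> v t \<in> carrier (opcmp P (tarity \<Gamma> t) (tdegree \<Gamma> t))"
proof (induction t)
  case (TZero n d)
  then show ?case using abelian_group.axioms(1)[OF abelian_group_opcmp]
    by (simp add: abelian_monoid.zero_closed)
next
  case (TDiff t)
  then show ?case using odiff_linear[of "tarity \<Gamma> t" "tdegree \<Gamma> t"] by (auto simp: linear_map_def)
next
  case (TAdd t u)
  then show ?case using abelian_group.axioms(1)[OF abelian_group_opcmp]
    by (simp add: abelian_monoid.a_closed same_type_def)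
next
  case (TComp t i u)
  then show ?case
    using pcomp_linear_left[of "teval P \<Gamma> v u" "tarity \<Gamma> u" "tdegree \<Gamma> u" i "tarity \<Gamma> t" "tdegree \<Gamma> t"]
    by (auto simp: linear_map_def)
next
  case (TAct t \<tau>)
  then show ?case using act_linear[of \<tau> "tarity \<Gamma> t" "tdegree \<Gamma> t"] by (auto simp: linear_map_def)
next
  case TUnit
  then show ?case using ounit_closed by simp
qed (simp_all add: assms smult_simps)

lemma teval_tcong:
  assumes wf: "wf_presentation \<Gamma>"
    and v: "\<And>x. v x \<in> carrier (opcmp P (gen_arity \<Gamma> x) (gen_degree \<Gamma> x))"
    and rels: "\<And>t u. (t, u) \<in> relations \<Gamma> \<Longrightarrow> teval P \<Gamma> v t = teval P \<Gamma> v u"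
  shows "tcong \<Gamma> t u \<Longrightarrow> teval P \<Gamma> v t = teval P \<Gamma> v u"
proof (induction rule: tcong.induct)
  case (rel t u) then show ?case by (rule rels)
next
  case (cong_add t t' u u')
  then show ?case using tcong_typed[OF wf cong_add.hyps(1)] by (simp add: same_type_def)
next
  case (cong_scale t t')
  then show ?case using tcong_typed[OF wf cong_scale.hyps(1)] by (simp add: same_type_def)
next
  case (add_assoc t u w)
  then show ?case
    using teval_closed[OF v, where t=t] teval_closed[OF v, where t=u] teval_closed[OF v, where t=w]
      abelian_group.axioms(1)[OF abelian_group_opcmp]
    by (simp add: same_type_def abelian_monoid.a_assoc)
next
  case (add_comm t u)
  then show ?case
    using teval_closed[OF v, where t=t] teval_closed[OF v, where t=u]
      abelian_group.axioms(1)[OF abelian_group_opcmp]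
    by (simp add: same_type_def abelian_monoid.a_comm)
next
  case (add_zero t)
  then show ?case
    using teval_closed[OF v, where t=t] abelian_group.axioms(1)[OF abelian_group_opcmp]
    by (simp add: abelian_monoid.r_zero)
next
  case (add_neg t)
  then show ?case
    using teval_closed[OF v, where t=t] smult_simps(2,4,5)
    by (metis add.right_inverse dgterm.distinct teval.simps(1,5,6))
next
  case (scale_add_right t u c)
  then show ?case
    using teval_closed[OF v, where t=t] teval_closed[OF v, where t=u]
    by (simp add: same_type_def smult_simps(6))
next
  case (scale_add_left t c c')
  then show ?case using teval_closed[OF v, where t=t] by (simp add: smult_simps(2))
next
  case (scale_scale t c c')
  then show ?case using teval_closed[OF v, where t=t] by (simp add: smult_simps(3))
next
  case (scale_one t)
  then show ?case using teval_closed[OF v, where t=t] by (simp add: smult_simps(4))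
next
  case (diff_add t u)
  then show ?case
    using teval_closed[OF v, where t=t] teval_closed[OF v, where t=u] odiff_linear
    by (simp add: same_type_def linear_map_def)
next
  case (diff_scale t c)
  then show ?case using teval_closed[OF v, where t=t] odiff_linear by (simp add: linear_map_def)
next
  case (diff_diff t)
  then show ?case using teval_closed[OF v, where t=t] odiff_odiff by simp
next
  case (act_add t u \<tau>)
  then show ?case
    using teval_closed[OF v, where t=t] teval_closed[OF v, where t=u] act_linear
    by (simp add: same_type_def linear_map_def)
next
  case (act_scale t \<tau> c)
  then show ?case using teval_closed[OF v, where t=t] act_linear by (simp add: linear_map_def)
next
  case (act_id t)
  then show ?case using teval_closed[OF v, where t=t] dg_operad.act_id[OF dg_operad_axioms] by simp
next
  case (act_comp t \<tau> \<rho>)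
  then show ?case using teval_closed[OF v, where t=t] dg_operad.act_comp[OF dg_operad_axioms] by simp
next
  case (diff_act t \<tau>)
  then show ?case using teval_closed[OF v, where t=t] odiff_act by simp
next
  case (comp_add_left f f' g i)
  then show ?case
    using teval_closed[OF v, where t=f] teval_closed[OF v, where t=f'] teval_closed[OF v, where t=g]
      pcomp_linear_left by (simp add: same_type_def linear_map_def)
next
  case (comp_scale_left f g i c)
  then show ?case
    using teval_closed[OF v, where t=f] teval_closed[OF v, where t=g]
      pcomp_linear_left by (simp add: linear_map_def)
next
  case (comp_add_right f g g' i)
  then show ?case
    using teval_closed[OF v, where t=f] teval_closed[OF v, where t=g] teval_closed[OF v, where t=g']
      pcomp_linear_right by (simp add: same_type_def linear_map_def)
next
  case (comp_scale_right f g i c)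
  then show ?case
    using teval_closed[OF v, where t=f] teval_closed[OF v, where t=g]
      pcomp_linear_right by (simp add: linear_map_def)
next
  case (comp_unit_left f)
  then show ?case using teval_closed[OF v, where t=f] pcomp_unit_left by simp
next
  case (comp_unit_right f i)
  then show ?case using teval_closed[OF v, where t=f] pcomp_unit_right by simp
next
  case (comp_sequential f g h i j)
  then show ?case
    using teval_closed[OF v, where t=f] teval_closed[OF v, where t=g] teval_closed[OF v, where t=h]
      pcomp_sequential by simp
next
  case (comp_parallel f g h i k)
  have eqs: "tarity \<Gamma> f + tarity \<Gamma> h - 1 + tarity \<Gamma> g - 1 = tarity \<Gamma> f + tarity \<Gamma> g - 1 + tarity \<Gamma> h - 1"
    "tdegree \<Gamma> f + tdegree \<Gamma> h + tdegree \<Gamma> g = tdegree \<Gamma> f + tdegree \<Gamma> g + tdegree \<Gamma> h"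
    using comp_parallel by linarith+
  show ?case
    unfolding teval.simps tarity.simps tdegree.simps eqs
    by (intro pcomp_parallel teval_closed v comp_parallel)
next
  case (comp_act f g i \<sigma> \<tau>)
  then show ?case
    using pcomp_act[OF teval_closed[OF v, where t=f] teval_closed[OF v, where t=g]] by simp
next
  case (diff_comp f g i)
  have eqs: "tdegree \<Gamma> f + (tdegree \<Gamma> g + 1) = tdegree \<Gamma> f + tdegree \<Gamma> g + 1"
    "tdegree \<Gamma> f + 1 + tdegree \<Gamma> g = tdegree \<Gamma> f + tdegree \<Gamma> g + 1" by simp_all
  show ?case
    unfolding teval.simps tarity.simps tdegree.simps eqs
    by (intro odiff_pcomp teval_closed v diff_comp)
qed simp_all

end

text \<open>The universal property of \<open>presented_operad\<close>.\<close>

theorem (in wf_dg_presentation) presented_operad_universal: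
  assumes Q: "dg_operad Q"
    and v: "\<And>x. v x \<in> carrier (opcmp Q (gen_arity \<Gamma> x) (gen_degree \<Gamma> x))"
    and rels: "\<And>t u. (t, u) \<in> relations \<Gamma> \<Longrightarrow> teval Q \<Gamma> v t = teval Q \<Gamma> v u"
  obtains \<phi> where "dg_operad_hom Op Q \<phi>" and "\<And>x. \<phi> (cl (TGen x)) = v x"
    and "\<And>\<psi> n d A. \<lbrakk>dg_operad_hom Op Q \<psi>; \<And>x. \<psi> (cl (TGen x)) = v x; A \<in> carrier (opcmp Op n d)\<rbrakk>
          \<Longrightarrow> \<psi> A = \<phi> A"
proof -
  interpret Q: dg_operad Q by (rule Q)
  define \<phi> where "\<phi> A = (THE y. \<exists>t\<in>A. y = teval Q \<Gamma> v t)" for A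
  have \<phi>: "\<phi> (cl t) = teval Q \<Gamma> v t" if "t \<in> terms \<Gamma> n d" for t n d
    unfolding \<phi>_def
  proof (rule the_equality)
    show "\<exists>u\<in>cl t. teval Q \<Gamma> v t = teval Q \<Gamma> v u"
      using that mem_cl[of t t] by (auto simp: terms_def intro: tcong.refl)
  next
    fix y assume "\<exists>u\<in>cl t. y = teval Q \<Gamma> v u"
    then show "y = teval Q \<Gamma> v t" using Q.teval_tcong[OF wf v rels] mem_cl by metis
  qed
  have closed: "teval Q \<Gamma> v t \<in> carrier (opcmp Q n d)" if "t \<in> terms \<Gamma> n d" for t n d
    using that Q.teval_closed[OF v, where t = t] by (auto simp: terms_def)
  have hom: "dg_operad_hom Op Q \<phi>"
  proof (intro dg_operad_hom.intro dg_operad_Op Q dg_operad_hom_axioms.intro, goal_cases)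
    case (1 n d)
    show ?case
      unfolding linear_map_def
    proof (intro conjI Pi_I ballI allI)
      fix A assume "A \<in> carrier (opcmp Op n d)"
      then obtain t where t: "t \<in> terms \<Gamma> n d" "A = cl t" by (rule carrierE)
      show "\<phi> A \<in> carrier (opcmp Q n d)" using \<phi> t closed by simp
      fix B assume "B \<in> carrier (opcmp Op n d)"
      then obtain u where u: "u \<in> terms \<Gamma> n d" "B = cl u" by (rule carrierE)
      show "\<phi> (A \<oplus>\<^bsub>opcmp Op n d\<^esub> B) = \<phi> A \<oplus>\<^bsub>opcmp Q n d\<^esub> \<phi> B"
        unfolding t(2) u(2) add_cl[OF t(1) u(1)] \<phi>[OF t(1)] \<phi>[OF u(1)] \<phi>[OF terms_intros(3)[OF t(1) u(1)]]
        using t(1) by (simp add: terms_def)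
    next
      fix A c assume "A \<in> carrier (opcmp Op n d)"
      then obtain t where t: "t \<in> terms \<Gamma> n d" "A = cl t" by (rule carrierE)
      show "\<phi> (c \<odot>\<^bsub>opcmp Op n d\<^esub> A) = c \<odot>\<^bsub>opcmp Q n d\<^esub> \<phi> A"
        unfolding t(2) smult_cl[OF t(1)] \<phi>[OF t(1)] \<phi>[OF terms_intros(4)[OF t(1)]]
        using t(1) by (simp add: terms_def)
    qed
  next
    case (2 x n d)
    then obtain t where t: "t \<in> terms \<Gamma> n d" "x = cl t" by (rule carrierE)
    show ?case unfolding t(2) odiff_cl[OF t(1)] \<phi>[OF t(1)] \<phi>[OF terms_intros(5)[OF t(1)]] by simp
  next
    case 3
    show ?case unfolding unit_cl \<phi>[OF terms_intros(2)] by simp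
  next
    case (4 f m a g n b i)
    from 4(1) obtain t where t: "t \<in> terms \<Gamma> m a" "f = cl t" by (rule carrierE)
    from 4(2) obtain u where u: "u \<in> terms \<Gamma> n b" "g = cl u" by (rule carrierE)
    show ?case
      unfolding t(2) u(2) pcomp_cl[OF t(1) u(1) 4(3,4)] \<phi>[OF t(1)] \<phi>[OF u(1)]
        \<phi>[OF terms_intros(7)[OF t(1) u(1) 4(3,4)]] by simp
  next
    case (5 f n d \<tau>)
    from 5(1) obtain t where t: "t \<in> terms \<Gamma> n d" "f = cl t" by (rule carrierE)
    show ?case
      unfolding t(2) act_cl[OF t(1) 5(2)] \<phi>[OF t(1)] \<phi>[OF terms_intros(6)[OF t(1) 5(2)]] by simp
  qed
  have gen: "\<phi> (cl (TGen x)) = v x" for x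
    using \<phi>[of "TGen x"] by (simp add: terms_def)
  have unique: "\<psi> A = \<phi> A"
    if \<psi>: "dg_operad_hom Op Q \<psi>" and \<psi>_gen: "\<And>x. \<psi> (cl (TGen x)) = v x"
      and A: "A \<in> carrier (opcmp Op n d)" for \<psi> n d A
  proof -
    interpret \<psi>: dg_operad_hom Op Q \<psi> by (rule \<psi>)
    have "\<psi> (cl t) = teval Q \<Gamma> v t" if "twf \<Gamma> t" for t
      using that
    proof (induction t)
      case (TZero n d)
      have t: "TZero n d \<in> terms \<Gamma> n d" by (rule terms_intros)
      then have "cl (TZero n d) = 0 \<odot>\<^bsub>opcmp Op n d\<^esub> cl (TZero n d)"
        using \<psi>.P.smult_simps(5)[OF carrierI[OF t]] zero_cl by simp
      then have "\<psi> (cl (TZero n d)) = 0 \<odot>\<^bsub>opcmp Q n d\<^esub> \<psi> (cl (TZero n d))"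
        using \<psi>.hom_linear[of n d] carrierI[OF t] unfolding linear_map_def by metis
      also have "\<dots> = \<zero>\<^bsub>opcmp Q n d\<^esub>"
        using \<psi>.hom_linear[of n d] carrierI[OF t] unfolding linear_map_def
        by (intro Q.smult_simps(5)) auto
      finally show ?case by simp
    next
      case TUnit
      then show ?case using \<psi>.hom_ounit by (simp add: unit_cl)
    next
      case (TGen x)
      then show ?case by (simp add: \<psi>_gen)
    next
      case (TDiff t)
      then have t: "t \<in> terms \<Gamma> (tarity \<Gamma> t) (tdegree \<Gamma> t)" by (simp add: terms_def)
      show ?case using \<psi>.hom_odiff[OF carrierI[OF t]] odiff_cl[OF t] TDiff by simp
    next
      case (TAdd t u)
      then have t: "t \<in> terms \<Gamma> (tarity \<Gamma> t) (tdegree \<Gamma> t)" and u: "u \<in> terms \<Gamma> (tarity \<Gamma> t) (tdegree \<Gamma> t)"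
        by (simp_all add: terms_def same_type_def)
      show ?case
        using \<psi>.hom_linear carrierI[OF t] carrierI[OF u] TAdd unfolding linear_map_def
        by (simp flip: add_cl[OF t u, of "tarity \<Gamma> t" "tdegree \<Gamma> t"])
    next
      case (TScale c t)
      then have t: "t \<in> terms \<Gamma> (tarity \<Gamma> t) (tdegree \<Gamma> t)" by (simp add: terms_def)
      show ?case
        using \<psi>.hom_linear carrierI[OF t] TScale unfolding linear_map_def
        by (simp flip: smult_cl[OF t, where n' = "tarity \<Gamma> t" and d' = "tdegree \<Gamma> t"])
    next
      case (TComp t i u)
      then have t: "t \<in> terms \<Gamma> (tarity \<Gamma> t) (tdegree \<Gamma> t)" and u: "u \<in> terms \<Gamma> (tarity \<Gamma> u) (tdegree \<Gamma> u)"
        by (simp_all add: terms_def)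
      show ?case
        using \<psi>.hom_pcomp[OF carrierI[OF t] carrierI[OF u]] pcomp_cl[OF t u] TComp by simp
    next
      case (TAct t \<tau>)
      then have t: "t \<in> terms \<Gamma> (tarity \<Gamma> t) (tdegree \<Gamma> t)" by (simp add: terms_def)
      show ?case
        using \<psi>.hom_act[OF carrierI[OF t]] act_cl[OF t] TAct by simp
    qed
    then show ?thesis using A \<phi> by (auto elim!: carrierE simp: terms_def)
  qed
  show thesis using that hom gen unique by blast
qed

lemma dg_operad_comm: "dg_operad comm_operad"
  unfolding comm_operad_def
  by (intro wf_dg_presentation.dg_operad_Op wf_dg_presentation.intro wf_comm_presentation)

lemma dg_operad_jacobi: "dg_operad jacobi_operad"
  unfolding jacobi_operad_def
  by (intro wf_dg_presentation.dg_operad_Op wf_dg_presentation.intro wf_jacobi_presentation)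

end

theory Submission
  imports Defs
begin

text \<open>
  Give \<open>\<mu>\<close> weight 0 and \<open>i\<close>, \<open>j\<close> weight 1. The relations of the Jacobi operad are homogeneous,
  so there is a derivation \<open>W\<close> of degree 0, commuting with the differential, that multiplies an element
  of weight \<open>w\<close> by \<open>w\<close>. The key point is that there is also a derivation \<open>h\<close> of degree \<open>-1\<close> with
  \<open>h(\<mu>) = h(i) = h(j) = 0\<close>, \<open>h(di) = i\<close> and \<open>h(dj) = j\<close>: it is compatible with the relations,
  because those without a differential are killed termwise, while \<open>i di - di i - 2 j i\<close> is sent to
  \<open>i i - i i = 0\<close> and \<open>di j + j di\<close> to \<open>i j - j i = 0\<close>. Then \<open>d h + h d\<close> is a derivation
  that agrees with \<open>W\<close> on the generators, so \<open>d h + h d = W\<close>. On the part of weight \<open>w > 0\<close> this makes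
  multiplication by \<open>w\<close> null-homotopic, and in characteristic zero that part is acyclic.
  The weight 0 part is the image of the commutative operad, which embeds into the Jacobi operad because
  \<open>\<mu> \<mapsto> \<mu>\<close>, \<open>i \<mapsto> 0\<close>, \<open>j \<mapsto> 0\<close> defines a retraction.

  Derivations of a presented operad \<open>P\<close> are obtained from the universal property. A derivation \<open>\<delta>\<close>
  is the same as a section \<open>x \<mapsto> (x, \<delta> x)\<close> of the projection of a square-zero extension
  of \<open>P\<close> by a shifted copy of itself (\<open>extension\<close>). The first extension has the evident differential and
  yields \<open>W\<close>; the second has its differential twisted by \<open>W\<close> and yields \<open>h\<close>
  (\<open>derivation_exists\<close>, \<open>weight_operator_exists\<close>, \<open>jacobi_contraction\<close>). The passage from \<open>h\<close>
  to cohomology is \<open>cocycle_cohomologous_to_weight_0_part\<close>: a cocycle minus its projection to weight 0 is a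
  sum of eigenvectors of \<open>W\<close> with nonzero eigenvalues, and these are eliminated one after the other
  by applying \<open>W - c\<close> (\<open>eigensum_cocycle\<close>), so that components of different
  weights need not be shown to be independent.
\<close>


section \<open>Linear algebra in the components of a DG operad\<close>

lemma linear_mapD:
  assumes "linear_map M N f" and "x \<in> carrier M"
  shows "f x \<in> carrier N"
    and "y \<in> carrier M \<Longrightarrow> f (x \<oplus>\<^bsub>M\<^esub> y) = f x \<oplus>\<^bsub>N\<^esub> f y"
    and "f (c \<odot>\<^bsub>M\<^esub> x) = c \<odot>\<^bsub>N\<^esub> f x"
  using assms by (auto simp: linear_map_def)

lemma ksign_simps:
  "ksign (- a) = ksign a" "ksign (a + b) = ksign a * ksign b" "ksign (a - b) = ksign a * ksign b"
  "ksign 0 = 1" "ksign 1 = - 1" "ksign a * ksign a = 1" "ksign a * (ksign a * c) = c"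
  by (auto simp: ksign_def)

context dg_operad
begin

abbreviation cmps where "cmps n d \<equiv> carrier (opcmp P n d)"

lemma zero_closed: "\<zero>\<^bsub>opcmp P n d\<^esub> \<in> cmps n d"
  by (intro abelian_monoid.zero_closed abelian_group.axioms(1)[OF abelian_group_opcmp])

lemma add_closed: "\<lbrakk>x \<in> cmps n d; y \<in> cmps n d\<rbrakk> \<Longrightarrow> x \<oplus>\<^bsub>opcmp P n d\<^esub> y \<in> cmps n d"
  by (intro abelian_monoid.a_closed abelian_group.axioms(1)[OF abelian_group_opcmp])

lemma odiff_closed: "\<lbrakk>x \<in> cmps n d; d' = d + 1\<rbrakk> \<Longrightarrow> odiff P x \<in> cmps n d'"
  using odiff_linear linear_mapD(1) by metis

lemma act_closed: "\<lbrakk>x \<in> cmps n d; \<tau> permutes {1..n}\<rbrakk> \<Longrightarrow> act P x \<tau> \<in> cmps n d"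
  using linear_mapD(1)[OF act_linear] by simp

lemma pcomp_closed:
  "\<lbrakk>f \<in> cmps m a; g \<in> cmps n b; 1 \<le> i; i \<le> m; N = m + n - 1; D = a + b\<rbrakk> \<Longrightarrow> pcomp P f i g \<in> cmps N D"
  using linear_mapD(1)[OF pcomp_linear_left] by simp

lemmas closed = zero_closed add_closed smult_simps(1) act_closed

lemma add_ac:
  assumes "x \<in> cmps n d" "y \<in> cmps n d"
  shows "x \<oplus>\<^bsub>opcmp P n d\<^esub> y = y \<oplus>\<^bsub>opcmp P n d\<^esub> x"
    and "w \<in> cmps n d \<Longrightarrow> x \<oplus>\<^bsub>opcmp P n d\<^esub> y \<oplus>\<^bsub>opcmp P n d\<^esub> w = x \<oplus>\<^bsub>opcmp P n d\<^esub> (y \<oplus>\<^bsub>opcmp P n d\<^esub> w)"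
    and "w \<in> cmps n d \<Longrightarrow> y \<oplus>\<^bsub>opcmp P n d\<^esub> (x \<oplus>\<^bsub>opcmp P n d\<^esub> w) = x \<oplus>\<^bsub>opcmp P n d\<^esub> (y \<oplus>\<^bsub>opcmp P n d\<^esub> w)"
proof -
  interpret abelian_group "opcmp P n d" by (rule abelian_group_opcmp)
  show "x \<oplus>\<^bsub>opcmp P n d\<^esub> y = y \<oplus>\<^bsub>opcmp P n d\<^esub> x"
    and "w \<in> cmps n d \<Longrightarrow> x \<oplus>\<^bsub>opcmp P n d\<^esub> y \<oplus>\<^bsub>opcmp P n d\<^esub> w = x \<oplus>\<^bsub>opcmp P n d\<^esub> (y \<oplus>\<^bsub>opcmp P n d\<^esub> w)"
    and "w \<in> cmps n d \<Longrightarrow> y \<oplus>\<^bsub>opcmp P n d\<^esub> (x \<oplus>\<^bsub>opcmp P n d\<^esub> w) = x \<oplus>\<^bsub>opcmp P n d\<^esub> (y \<oplus>\<^bsub>opcmp P n d\<^esub> w)"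
    using assms by (simp_all add: a_ac)
qed

lemma add_zero_simps:
  assumes "x \<in> cmps n d"
  shows "x \<oplus>\<^bsub>opcmp P n d\<^esub> \<zero>\<^bsub>opcmp P n d\<^esub> = x" "\<zero>\<^bsub>opcmp P n d\<^esub> \<oplus>\<^bsub>opcmp P n d\<^esub> x = x"
    "x \<oplus>\<^bsub>opcmp P n d\<^esub> (- 1) \<odot>\<^bsub>opcmp P n d\<^esub> x = \<zero>\<^bsub>opcmp P n d\<^esub>"
    "(- 1) \<odot>\<^bsub>opcmp P n d\<^esub> x \<oplus>\<^bsub>opcmp P n d\<^esub> x = \<zero>\<^bsub>opcmp P n d\<^esub>"
proof -
  interpret abelian_group "opcmp P n d" by (rule abelian_group_opcmp)
  show "x \<oplus>\<^bsub>opcmp P n d\<^esub> \<zero>\<^bsub>opcmp P n d\<^esub> = x" "\<zero>\<^bsub>opcmp P n d\<^esub> \<oplus>\<^bsub>opcmp P n d\<^esub> x = x"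
    using assms by simp_all
  have "(1 + (- 1)) \<odot>\<^bsub>opcmp P n d\<^esub> x = \<zero>\<^bsub>opcmp P n d\<^esub>"
    using smult_simps(5)[OF assms] by simp
  then show *: "x \<oplus>\<^bsub>opcmp P n d\<^esub> (- 1) \<odot>\<^bsub>opcmp P n d\<^esub> x = \<zero>\<^bsub>opcmp P n d\<^esub>"
    using smult_simps(2)[OF assms, of 1 "- 1"] smult_simps(4)[OF assms] by simp
  show "(- 1) \<odot>\<^bsub>opcmp P n d\<^esub> x \<oplus>\<^bsub>opcmp P n d\<^esub> x = \<zero>\<^bsub>opcmp P n d\<^esub>"
    using * add_ac(1)[OF assms smult_simps(1)[OF assms]] by simp
qed

lemma smult_smult:
  "x \<in> cmps n d \<Longrightarrow> c \<odot>\<^bsub>opcmp P n d\<^esub> (c' \<odot>\<^bsub>opcmp P n d\<^esub> x) = (c * c') \<odot>\<^bsub>opcmp P n d\<^esub> x"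
  by (simp add: smult_simps(3))

lemma smult_zero: "c \<odot>\<^bsub>opcmp P n d\<^esub> \<zero>\<^bsub>opcmp P n d\<^esub> = \<zero>\<^bsub>opcmp P n d\<^esub>"
proof -
  have "c \<odot>\<^bsub>opcmp P n d\<^esub> \<zero>\<^bsub>opcmp P n d\<^esub> = c \<odot>\<^bsub>opcmp P n d\<^esub> (0 \<odot>\<^bsub>opcmp P n d\<^esub> \<zero>\<^bsub>opcmp P n d\<^esub>)"
    by (simp add: smult_simps(5) zero_closed)
  also have "\<dots> = (c * 0) \<odot>\<^bsub>opcmp P n d\<^esub> \<zero>\<^bsub>opcmp P n d\<^esub>"
    by (intro smult_smult zero_closed)
  finally show ?thesis by (simp add: smult_simps(5) zero_closed)
qed

lemmas linear_simps = smult_simps(4-6) smult_smult smult_zero add_zero_simps add_ac closed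

lemma linear_map_zero:
  assumes "linear_map (opcmp P n d) (opcmp P n' d') f"
  shows "f \<zero>\<^bsub>opcmp P n d\<^esub> = \<zero>\<^bsub>opcmp P n' d'\<^esub>"
proof -
  have "f (0 \<odot>\<^bsub>opcmp P n d\<^esub> \<zero>\<^bsub>opcmp P n d\<^esub>) = 0 \<odot>\<^bsub>opcmp P n' d'\<^esub> f \<zero>\<^bsub>opcmp P n d\<^esub>"
    by (rule linear_mapD(3)[OF assms zero_closed])
  then show ?thesis
    using linear_mapD(1)[OF assms zero_closed] by (simp add: smult_simps(5) zero_closed)
qed


text \<open>Linearity of the operations, with the degree of the result left free: degrees that are
  equal as integers need not be the same expression.\<close>

lemma pcomp_lin_left:
  assumes "g \<in> cmps n b" "1 \<le> i" "i \<le> m" "N = m + n - 1" "D = a + b"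
  shows "\<lbrakk>u \<in> cmps m a; v \<in> cmps m a\<rbrakk>
      \<Longrightarrow> pcomp P (u \<oplus>\<^bsub>opcmp P m a\<^esub> v) i g = pcomp P u i g \<oplus>\<^bsub>opcmp P N D\<^esub> pcomp P v i g"
    and "u \<in> cmps m a \<Longrightarrow> pcomp P (c \<odot>\<^bsub>opcmp P m a\<^esub> u) i g = c \<odot>\<^bsub>opcmp P N D\<^esub> pcomp P u i g"
    and "\<lbrakk>u \<in> cmps m a; v \<in> cmps m a\<rbrakk> \<Longrightarrow> pcomp P (u \<oplus>\<^bsub>opcmp P m a\<^esub> c \<odot>\<^bsub>opcmp P m a\<^esub> v) i g
        = pcomp P u i g \<oplus>\<^bsub>opcmp P N D\<^esub> c \<odot>\<^bsub>opcmp P N D\<^esub> pcomp P v i g"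
    and "pcomp P \<zero>\<^bsub>opcmp P m a\<^esub> i g = \<zero>\<^bsub>opcmp P N D\<^esub>"
  using linear_mapD[OF pcomp_linear_left[OF assms(1-3)]] linear_map_zero[OF pcomp_linear_left[OF assms(1-3)]]
    assms by (simp_all add: smult_simps(1))

lemma pcomp_lin_right:
  assumes "f \<in> cmps m a" "1 \<le> i" "i \<le> m" "N = m + n - 1" "D = a + b"
  shows "\<lbrakk>u \<in> cmps n b; v \<in> cmps n b\<rbrakk>
      \<Longrightarrow> pcomp P f i (u \<oplus>\<^bsub>opcmp P n b\<^esub> v) = pcomp P f i u \<oplus>\<^bsub>opcmp P N D\<^esub> pcomp P f i v"
    and "u \<in> cmps n b \<Longrightarrow> pcomp P f i (c \<odot>\<^bsub>opcmp P n b\<^esub> u) = c \<odot>\<^bsub>opcmp P N D\<^esub> pcomp P f i u"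
    and "\<lbrakk>u \<in> cmps n b; v \<in> cmps n b\<rbrakk> \<Longrightarrow> pcomp P f i (u \<oplus>\<^bsub>opcmp P n b\<^esub> c \<odot>\<^bsub>opcmp P n b\<^esub> v)
        = pcomp P f i u \<oplus>\<^bsub>opcmp P N D\<^esub> c \<odot>\<^bsub>opcmp P N D\<^esub> pcomp P f i v"
    and "pcomp P f i \<zero>\<^bsub>opcmp P n b\<^esub> = \<zero>\<^bsub>opcmp P N D\<^esub>"
  using linear_mapD[OF pcomp_linear_right[OF assms(1-3)]] linear_map_zero[OF pcomp_linear_right[OF assms(1-3)]]
    assms by (simp_all add: smult_simps(1))

lemma act_lin:
  assumes "\<tau> permutes {1..n}"
  shows "\<lbrakk>u \<in> cmps n d; v \<in> cmps n d\<rbrakk>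
      \<Longrightarrow> act P (u \<oplus>\<^bsub>opcmp P n d\<^esub> v) \<tau> = act P u \<tau> \<oplus>\<^bsub>opcmp P n d\<^esub> act P v \<tau>"
    and "u \<in> cmps n d \<Longrightarrow> act P (c \<odot>\<^bsub>opcmp P n d\<^esub> u) \<tau> = c \<odot>\<^bsub>opcmp P n d\<^esub> act P u \<tau>"
    and "act P \<zero>\<^bsub>opcmp P n d\<^esub> \<tau> = \<zero>\<^bsub>opcmp P n d\<^esub>"
  using linear_mapD[OF act_linear[OF assms]] linear_map_zero[OF act_linear[OF assms]] assms by simp_all

lemma odiff_lin:
  assumes "d' = d + 1"
  shows "\<lbrakk>u \<in> cmps n d; v \<in> cmps n d\<rbrakk>
      \<Longrightarrow> odiff P (u \<oplus>\<^bsub>opcmp P n d\<^esub> v) = odiff P u \<oplus>\<^bsub>opcmp P n d'\<^esub> odiff P v"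
    and "u \<in> cmps n d \<Longrightarrow> odiff P (c \<odot>\<^bsub>opcmp P n d\<^esub> u) = c \<odot>\<^bsub>opcmp P n d'\<^esub> odiff P u"
    and "odiff P \<zero>\<^bsub>opcmp P n d\<^esub> = \<zero>\<^bsub>opcmp P n d'\<^esub>"
  using linear_mapD[OF odiff_linear] linear_map_zero[OF odiff_linear] assms by simp_all

end

section \<open>Morphisms of DG operads and their effect on cohomology\<close>

lemma dg_operad_hom_id: "dg_operad P \<Longrightarrow> dg_operad_hom P P (\<lambda>A. A)"
  by (intro dg_operad_hom.intro dg_operad_hom_axioms.intro) (auto simp: linear_map_def)

lemma dg_operad_hom_comp:
  assumes "dg_operad_hom P Q \<phi>" "dg_operad_hom Q R \<psi>"
  shows "dg_operad_hom P R (\<lambda>A. \<psi> (\<phi> A))"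
proof -
  interpret \<phi>: dg_operad_hom P Q \<phi> by fact
  interpret \<psi>: dg_operad_hom Q R \<psi> by fact
  note cl = linear_mapD(1)[OF \<phi>.hom_linear]
  show ?thesis
  proof (intro dg_operad_hom.intro dg_operad_hom_axioms.intro \<phi>.P.dg_operad_axioms \<psi>.Q.dg_operad_axioms)
    fix n d
    show "linear_map (opcmp P n d) (opcmp R n d) (\<lambda>A. \<psi> (\<phi> A))"
      using \<phi>.hom_linear[of n d] \<psi>.hom_linear[of n d] by (auto simp: linear_map_def Pi_iff)
    show "\<psi> (\<phi> (odiff P x)) = odiff R (\<psi> (\<phi> x))" if "x \<in> carrier (opcmp P n d)" for x
      using \<phi>.hom_odiff[OF that] \<psi>.hom_odiff[OF cl[OF that]] by simp
    show "\<psi> (\<phi> (act P f \<tau>)) = act R (\<psi> (\<phi> f)) \<tau>"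
      if "f \<in> carrier (opcmp P n d)" "\<tau> permutes {1..n}" for f \<tau>
      using \<phi>.hom_act[OF that] \<psi>.hom_act[OF cl[OF that(1)] that(2)] by simp
  next
    show "\<psi> (\<phi> (ounit P)) = ounit R" by (simp add: \<phi>.hom_ounit \<psi>.hom_ounit)
  next
    fix f m a g n b i
    assume f: "f \<in> carrier (opcmp P m a)" and g: "g \<in> carrier (opcmp P n b)" and i: "1 \<le> i" "i \<le> m"
    show "\<psi> (\<phi> (pcomp P f i g)) = pcomp R (\<psi> (\<phi> f)) i (\<psi> (\<phi> g))"
      using \<phi>.hom_pcomp[OF f g i] \<psi>.hom_pcomp[OF cl[OF f] cl[OF g] i] by simp
  qed
qed

lemma dg_operad_hom_cong:
  assumes "dg_operad_hom P Q \<phi>" and eq: "\<And>n d A. A \<in> carrier (opcmp P n d) \<Longrightarrow> \<psi> A = \<phi> A"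
  shows "dg_operad_hom P Q \<psi>"
proof -
  interpret \<phi>: dg_operad_hom P Q \<phi> by fact
  show ?thesis
  proof (intro dg_operad_hom.intro dg_operad_hom_axioms.intro \<phi>.P.dg_operad_axioms \<phi>.Q.dg_operad_axioms)
    fix n d
    show "linear_map (opcmp P n d) (opcmp Q n d) \<psi>"
      using \<phi>.hom_linear[of n d] by (auto simp: linear_map_def Pi_iff eq[of _ n d] \<phi>.P.closed)
    show "\<psi> (odiff P x) = odiff Q (\<psi> x)" if "x \<in> carrier (opcmp P n d)" for x
      using that by (simp add: eq[OF that] eq[OF \<phi>.P.odiff_closed[OF that HOL.refl]] \<phi>.hom_odiff)
    show "\<psi> (act P f \<tau>) = act Q (\<psi> f) \<tau>" if "f \<in> carrier (opcmp P n d)" "\<tau> permutes {1..n}" for f \<tau>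
      using that by (simp add: eq[OF that(1)] eq[OF \<phi>.P.act_closed[OF that]] \<phi>.hom_act)
  next
    show "\<psi> (ounit P) = ounit Q" using eq[OF \<phi>.P.ounit_closed] \<phi>.hom_ounit by simp
  next
    fix f m a g n b i
    assume f: "f \<in> carrier (opcmp P m a)" and g: "g \<in> carrier (opcmp P n b)" and i: "1 \<le> i" "i \<le> m"
    show "\<psi> (pcomp P f i g) = pcomp Q (\<psi> f) i (\<psi> g)"
      using eq[OF \<phi>.P.pcomp_closed[OF f g i HOL.refl HOL.refl]] eq[OF f] eq[OF g] \<phi>.hom_pcomp[OF f g i] by simp
  qed
qed

lemma (in dg_operad_hom) hom_zero: "\<phi> \<zero>\<^bsub>opcmp P n d\<^esub> = \<zero>\<^bsub>opcmp Q n d\<^esub>"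
  using linear_mapD(1)[OF hom_linear P.zero_closed[of n d]]
    linear_mapD(3)[OF hom_linear P.zero_closed[of n d], of 0]
  by (simp add: P.smult_simps(5) P.zero_closed Q.smult_simps(5))

context dg_operad
begin

lemma coboundaries_closed: "coboundaries P n d \<subseteq> cmps n d"
  by (auto simp: coboundaries_def intro: odiff_closed)

lemma coboundaries_subgroup: "subgroup (coboundaries P n d) (add_monoid (opcmp P n d))"
proof -
  interpret G: comm_group "add_monoid (opcmp P n d)"
    by (rule abelian_group.a_comm_group[OF abelian_group_opcmp])
  note lin = odiff_lin[where d' = d and d = "d - 1" and n = n, simplified]
  show ?thesis
  proof (rule G.subgroupI)
    show "coboundaries P n d \<subseteq> carrier (add_monoid (opcmp P n d))" using coboundaries_closed by simp
    show "coboundaries P n d \<noteq> {}" using zero_closed[of n "d - 1"] by (auto simp: coboundaries_def)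
  next
    fix a assume "a \<in> coboundaries P n d"
    then obtain x where x: "x \<in> cmps n (d - 1)" and a: "a = odiff P x" by (auto simp: coboundaries_def)
    have ac: "a \<in> cmps n d" using odiff_closed[OF x, of d] a by simp
    have "inv\<^bsub>add_monoid (opcmp P n d)\<^esub> a = (- 1) \<odot>\<^bsub>opcmp P n d\<^esub> a"
      using ac by (intro G.inv_equality) (simp_all add: linear_simps)
    also have "\<dots> = odiff P ((- 1) \<odot>\<^bsub>opcmp P n (d - 1)\<^esub> x)" using x by (simp add: a lin)
    finally show "inv\<^bsub>add_monoid (opcmp P n d)\<^esub> a \<in> coboundaries P n d"
      using x smult_simps(1) by (auto simp: coboundaries_def)
  next
    fix a b assume "a \<in> coboundaries P n d" "b \<in> coboundaries P n d"
    then obtain x y where "x \<in> cmps n (d - 1)" "a = odiff P x" "y \<in> cmps n (d - 1)" "b = odiff P y"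
      by (auto simp: coboundaries_def)
    then show "a \<otimes>\<^bsub>add_monoid (opcmp P n d)\<^esub> b \<in> coboundaries P n d"
      using add_closed[of x n "d - 1" y] by (simp add: coboundaries_def flip: lin(1))
  qed
qed

abbreviation cocls where "cocls n d x \<equiv> a_r_coset (opcmp P n d) (coboundaries P n d) x"

lemma mem_cocls: "y \<in> cocls n d x \<longleftrightarrow> (\<exists>b\<in>coboundaries P n d. y = b \<oplus>\<^bsub>opcmp P n d\<^esub> x)"
  by (auto simp: a_r_coset_def')

lemma cocls_eq_iff:
  assumes x: "x \<in> cmps n d" and y: "y \<in> cmps n d"
  shows "cocls n d x = cocls n d y \<longleftrightarrow> y \<oplus>\<^bsub>opcmp P n d\<^esub> (- 1) \<odot>\<^bsub>opcmp P n d\<^esub> x \<in> coboundaries P n d"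
proof -
  interpret G: comm_group "add_monoid (opcmp P n d)"
    by (rule abelian_group.a_comm_group[OF abelian_group_opcmp])
  have "cocls n d x = cocls n d y \<longleftrightarrow> y \<in> cocls n d x"
    using G.repr_independence[OF _ _ coboundaries_subgroup] G.repr_independenceD[OF coboundaries_subgroup] x y
    unfolding a_r_coset_def by auto
  also have "\<dots> \<longleftrightarrow> y \<oplus>\<^bsub>opcmp P n d\<^esub> (- 1) \<odot>\<^bsub>opcmp P n d\<^esub> x \<in> coboundaries P n d"
  proof
    assume "y \<in> cocls n d x"
    then obtain b where b: "b \<in> coboundaries P n d" "y = b \<oplus>\<^bsub>opcmp P n d\<^esub> x" by (auto simp: mem_cocls)
    then have "b \<in> cmps n d" using coboundaries_closed by blast
    then have "y \<oplus>\<^bsub>opcmp P n d\<^esub> (- 1) \<odot>\<^bsub>opcmp P n d\<^esub> x = b"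
      using x unfolding b(2) by (subst add_ac(2)) (auto simp: add_zero_simps smult_simps(1))
    then show "y \<oplus>\<^bsub>opcmp P n d\<^esub> (- 1) \<odot>\<^bsub>opcmp P n d\<^esub> x \<in> coboundaries P n d" using b by simp
  next
    assume "y \<oplus>\<^bsub>opcmp P n d\<^esub> (- 1) \<odot>\<^bsub>opcmp P n d\<^esub> x \<in> coboundaries P n d"
    moreover have "y = (y \<oplus>\<^bsub>opcmp P n d\<^esub> (- 1) \<odot>\<^bsub>opcmp P n d\<^esub> x) \<oplus>\<^bsub>opcmp P n d\<^esub> x"
      using x y by (subst add_ac(2)) (auto simp: add_zero_simps smult_simps(1))
    ultimately show "y \<in> cocls n d x" by (auto simp: mem_cocls)
  qed
  finally show ?thesis .
qed

text \<open>The quotient group \<open>H\<^sup>d(P(n))\<close> is formed inside the group of cocycles. Its cosets and their products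
  are the same as in the whole component, where the coboundaries are also a normal subgroup.\<close>

lemma cohomology_simps:
  "carrier (cohomology P n d) = cocls n d ` cocycles P n d"
  "\<lbrakk>x \<in> cocycles P n d; y \<in> cocycles P n d\<rbrakk>
    \<Longrightarrow> cocls n d x \<otimes>\<^bsub>cohomology P n d\<^esub> cocls n d y = cocls n d (x \<oplus>\<^bsub>opcmp P n d\<^esub> y)"
proof -
  show "carrier (cohomology P n d) = cocls n d ` cocycles P n d"
    by (auto simp: cohomology_def A_FactGroup_def FactGroup_def RCOSETS_def a_r_coset_def r_coset_def)
  assume xy: "x \<in> cocycles P n d" "y \<in> cocycles P n d"
  interpret G: comm_group "add_monoid (opcmp P n d)"
    by (rule abelian_group.a_comm_group[OF abelian_group_opcmp])
  interpret N: normal "coboundaries P n d" "add_monoid (opcmp P n d)"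
    unfolding G.normal_iff_subgroup by (rule coboundaries_subgroup)
  show "cocls n d x \<otimes>\<^bsub>cohomology P n d\<^esub> cocls n d y = cocls n d (x \<oplus>\<^bsub>opcmp P n d\<^esub> y)"
    using N.rcos_sum[of x y] xy
    by (simp add: cohomology_def A_FactGroup_def FactGroup_def a_r_coset_def set_mult_def cocycles_def)
qed

lemma cocycles_add: "\<lbrakk>x \<in> cocycles P n d; y \<in> cocycles P n d\<rbrakk> \<Longrightarrow> x \<oplus>\<^bsub>opcmp P n d\<^esub> y \<in> cocycles P n d"
  by (auto simp: cocycles_def odiff_lin linear_simps)

end

context dg_operad_hom
begin

lemma hom_coboundaries: "b \<in> coboundaries P n d \<Longrightarrow> \<phi> b \<in> coboundaries Q n d"
  using linear_mapD(1)[OF hom_linear] hom_odiff by (auto simp: coboundaries_def)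

lemma hom_cocycles: "x \<in> cocycles P n d \<Longrightarrow> \<phi> x \<in> cocycles Q n d"
  using linear_mapD(1)[OF hom_linear] by (auto simp: cocycles_def hom_zero simp flip: hom_odiff)

lemma cohomology_map_cocls:
  assumes x: "x \<in> cocycles P n d"
  shows "cohomology_map Q n d \<phi> (P.cocls n d x) = Q.cocls n d (\<phi> x)"
proof -
  have xc: "x \<in> carrier (opcmp P n d)" using x by (simp add: cocycles_def)
  have "Q.cocls n d (\<phi> x') = Q.cocls n d (\<phi> x)" if x': "x' \<in> P.cocls n d x" for x'
  proof -
    obtain b where b: "b \<in> coboundaries P n d" and x'_eq: "x' = b \<oplus>\<^bsub>opcmp P n d\<^esub> x"
      using x' by (auto simp: P.mem_cocls)
    have bc: "b \<in> carrier (opcmp P n d)" using b P.coboundaries_closed by blast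
    have x'c: "x' \<in> carrier (opcmp P n d)" using bc xc by (simp add: x'_eq P.closed)
    have "\<phi> x' = \<phi> b \<oplus>\<^bsub>opcmp Q n d\<^esub> \<phi> x"
      unfolding x'_eq by (rule linear_mapD(2)[OF hom_linear bc xc])
    then have "\<phi> x' \<oplus>\<^bsub>opcmp Q n d\<^esub> (- 1) \<odot>\<^bsub>opcmp Q n d\<^esub> \<phi> x = \<phi> b"
      using linear_mapD(1)[OF hom_linear bc] linear_mapD(1)[OF hom_linear xc]
      by (simp add: Q.add_ac(2) Q.add_zero_simps Q.smult_simps(1))
    then show ?thesis
      using Q.cocls_eq_iff[OF linear_mapD(1)[OF hom_linear xc] linear_mapD(1)[OF hom_linear x'c]]
        hom_coboundaries[OF b] by simp
  qed
  moreover have "x \<in> P.cocls n d x"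
    using subgroup.one_closed[OF P.coboundaries_subgroup[of n d]] P.add_zero_simps(2)[OF xc]
    by (force simp: P.mem_cocls)
  ultimately show ?thesis unfolding cohomology_map_def by blast
qed

text \<open>In this form a retraction of \<open>\<phi>\<close> gives the injectivity, and a homotopy the surjectivity, without further
  reference to quotient groups.\<close>

lemma operad_quasi_isoI:
  assumes inj: "\<And>n d x. \<lbrakk>x \<in> cocycles P n d; \<phi> x \<in> coboundaries Q n d\<rbrakk> \<Longrightarrow> x \<in> coboundaries P n d"
    and surj: "\<And>n d y. y \<in> cocycles Q n d
      \<Longrightarrow> \<exists>x\<in>cocycles P n d. y \<oplus>\<^bsub>opcmp Q n d\<^esub> (- 1) \<odot>\<^bsub>opcmp Q n d\<^esub> \<phi> x \<in> coboundaries Q n d"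
  shows "operad_quasi_iso P Q \<phi>"
  unfolding operad_quasi_iso_def
proof (intro conjI allI)
  show "dg_operad_hom P Q \<phi>" by (rule dg_operad_hom_axioms)
  fix n d
  let ?f = "cohomology_map Q n d \<phi>"
  have hom: "?f \<in> hom (cohomology P n d) (cohomology Q n d)"
  proof (rule homI)
    fix A assume "A \<in> carrier (cohomology P n d)"
    then obtain x where x: "x \<in> cocycles P n d" and A: "A = P.cocls n d x" by (auto simp: P.cohomology_simps)
    show "?f A \<in> carrier (cohomology Q n d)"
      using hom_cocycles[OF x] by (auto simp: A cohomology_map_cocls[OF x] Q.cohomology_simps)
    fix B assume "B \<in> carrier (cohomology P n d)"
    then obtain y where y: "y \<in> cocycles P n d" and B: "B = P.cocls n d y" by (auto simp: P.cohomology_simps)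
    have "\<phi> (x \<oplus>\<^bsub>opcmp P n d\<^esub> y) = \<phi> x \<oplus>\<^bsub>opcmp Q n d\<^esub> \<phi> y"
      using x y linear_mapD(2)[OF hom_linear] by (auto simp: cocycles_def)
    then show "?f (A \<otimes>\<^bsub>cohomology P n d\<^esub> B) = ?f A \<otimes>\<^bsub>cohomology Q n d\<^esub> ?f B"
      unfolding A B P.cohomology_simps(2)[OF x y] cohomology_map_cocls[OF x] cohomology_map_cocls[OF y]
        cohomology_map_cocls[OF P.cocycles_add[OF x y]] Q.cohomology_simps(2)[OF hom_cocycles[OF x] hom_cocycles[OF y]]
      by simp
  qed
  have "inj_on ?f (carrier (cohomology P n d))"
  proof (rule inj_onI)
    fix A B assume "A \<in> carrier (cohomology P n d)" "B \<in> carrier (cohomology P n d)" and eq: "?f A = ?f B"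
    then obtain x y where x: "x \<in> cocycles P n d" and A: "A = P.cocls n d x"
      and y: "y \<in> cocycles P n d" and B: "B = P.cocls n d y" by (auto simp: P.cohomology_simps)
    have c: "x \<in> carrier (opcmp P n d)" "y \<in> carrier (opcmp P n d)" using x y by (auto simp: cocycles_def)
    let ?z = "y \<oplus>\<^bsub>opcmp P n d\<^esub> (- 1) \<odot>\<^bsub>opcmp P n d\<^esub> x"
    have z: "?z \<in> cocycles P n d"
      using x y by (auto simp: cocycles_def P.odiff_lin P.linear_simps)
    have "\<phi> ?z = \<phi> y \<oplus>\<^bsub>opcmp Q n d\<^esub> (- 1) \<odot>\<^bsub>opcmp Q n d\<^esub> \<phi> x"
      using linear_mapD(2)[OF hom_linear c(2) P.smult_simps(1)[OF c(1)]] linear_mapD(3)[OF hom_linear c(1)] by simp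
    also have "\<dots> \<in> coboundaries Q n d"
      using eq unfolding A B cohomology_map_cocls[OF x] cohomology_map_cocls[OF y]
      using Q.cocls_eq_iff linear_mapD(1)[OF hom_linear] c by blast
    finally have "?z \<in> coboundaries P n d" by (rule inj[OF z])
    then show "A = B" unfolding A B using P.cocls_eq_iff[OF c] by simp
  qed
  moreover have "?f ` carrier (cohomology P n d) = carrier (cohomology Q n d)"
  proof
    show "?f ` carrier (cohomology P n d) \<subseteq> carrier (cohomology Q n d)" using hom by (auto simp: hom_def)
    show "carrier (cohomology Q n d) \<subseteq> ?f ` carrier (cohomology P n d)"
    proof
      fix B assume "B \<in> carrier (cohomology Q n d)"
      then obtain y where y: "y \<in> cocycles Q n d" and B: "B = Q.cocls n d y" by (auto simp: Q.cohomology_simps)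
      obtain x where x: "x \<in> cocycles P n d"
        and yx: "y \<oplus>\<^bsub>opcmp Q n d\<^esub> (- 1) \<odot>\<^bsub>opcmp Q n d\<^esub> \<phi> x \<in> coboundaries Q n d"
        using surj[OF y] by blast
      have "Q.cocls n d (\<phi> x) = B"
        unfolding B using Q.cocls_eq_iff[of "\<phi> x" n d y] yx y hom_cocycles[OF x] by (simp add: cocycles_def)
      then show "B \<in> ?f ` carrier (cohomology P n d)"
        using x by (auto simp: P.cohomology_simps cohomology_map_cocls intro!: image_eqI[of _ _ "P.cocls n d x"])
    qed
  qed
  ultimately show "?f \<in> iso (cohomology P n d) (cohomology Q n d)"
    using hom by (simp add: iso_iff)
qed

end

section \<open>Square-zero extensions of DG operads\<close>

text \<open>The square-zero extension of \<open>P\<close> by a copy of itself shifted by \<open>e\<close>: an element is a formal sum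
  \<open>x + \<epsilon> z\<close>, where \<open>\<epsilon>\<close> has degree \<open>e\<close>, \<open>\<epsilon> \<epsilon> = 0\<close> and \<open>z\<close> has degree \<open>d - e\<close>; moving \<open>\<epsilon>\<close> to the front
  of \<open>x \<circ>\<^sub>i \<epsilon> z'\<close> produces the sign \<open>(-1)\<^bsup>e |x|\<^esup>\<close>. The differential is twisted by \<open>\<theta>\<close>:
  \<open>d (x + \<epsilon> z) = d x + \<epsilon> (\<theta> x + (-1)\<^sup>e d z)\<close>. The element carries its arity and degree, because
  the signs and the additions in the operations depend on them. A section \<open>x \<mapsto> x + \<epsilon> \<delta> x\<close> of the
  projection to \<open>P\<close> is a morphism of DG operads exactly if \<open>\<delta>\<close> is a derivation of degree \<open>-e\<close> with
  \<open>\<delta> d = \<theta> + (-1)\<^sup>e d \<delta>\<close>.\<close>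

definition extension :: "('k::field, 'a) dg_operad_data \<Rightarrow> int \<Rightarrow> (nat \<Rightarrow> int \<Rightarrow> 'a \<Rightarrow> 'a)
    \<Rightarrow> ('k, nat \<times> int \<times> 'a \<times> 'a) dg_operad_data" where
  "extension P e \<theta> = \<lparr>
     opcmp = (\<lambda>n d. \<lparr>
       carrier = {(n, d, x, z) | x z. x \<in> carrier (opcmp P n d) \<and> z \<in> carrier (opcmp P n (d - e))},
       monoid.mult = undefined,
       one = undefined,
       ring.zero = (n, d, \<zero>\<^bsub>opcmp P n d\<^esub>, \<zero>\<^bsub>opcmp P n (d - e)\<^esub>),
       add = (\<lambda>(_, _, x, z) (_, _, x', z'). (n, d, x \<oplus>\<^bsub>opcmp P n d\<^esub> x', z \<oplus>\<^bsub>opcmp P n (d - e)\<^esub> z')),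
       module.smult = (\<lambda>c (_, _, x, z). (n, d, c \<odot>\<^bsub>opcmp P n d\<^esub> x, c \<odot>\<^bsub>opcmp P n (d - e)\<^esub> z))\<rparr>),
     odiff = (\<lambda>(n, d, x, z). (n, d + 1, odiff P x,
       \<theta> n d x \<oplus>\<^bsub>opcmp P n (d + 1 - e)\<^esub> ksign e \<odot>\<^bsub>opcmp P n (d + 1 - e)\<^esub> odiff P z)),
     ounit = (1, 0, ounit P, \<zero>\<^bsub>opcmp P 1 (- e)\<^esub>),
     pcomp = (\<lambda>(m, a, x, z) i (n, b, x', z'). (m + n - 1, a + b, pcomp P x i x',
       pcomp P z i x' \<oplus>\<^bsub>opcmp P (m + n - 1) (a + b - e)\<^esub>
         ksign (e * a) \<odot>\<^bsub>opcmp P (m + n - 1) (a + b - e)\<^esub> pcomp P x i z')),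
     act = (\<lambda>(n, d, x, z) \<tau>. (n, d, act P x \<tau>, act P z \<tau>))\<rparr>"

text \<open>The conditions on \<open>\<theta>\<close> under which the twisted differential squares to zero and is a derivation:
  \<open>\<theta>\<close> is a derivation of degree \<open>1 - e\<close> that commutes with \<open>d\<close> in the graded sense.\<close>

locale twisting_derivation = dg_operad P for P :: "('k::field, 'a) dg_operad_data" +
  fixes e :: int and \<theta> :: "nat \<Rightarrow> int \<Rightarrow> 'a \<Rightarrow> 'a"
  assumes \<theta>_linear: "linear_map (opcmp P n d) (opcmp P n (d + 1 - e)) (\<theta> n d)"
    and \<theta>_act: "\<lbrakk>f \<in> carrier (opcmp P n d); \<tau> permutes {1..n}\<rbrakk> \<Longrightarrow> \<theta> n d (act P f \<tau>) = act P (\<theta> n d f) \<tau>"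
    and \<theta>_odiff: "f \<in> carrier (opcmp P n d) \<Longrightarrow>
       \<theta> n (d + 1) (odiff P f) \<oplus>\<^bsub>opcmp P n (d + 2 - e)\<^esub> ksign e \<odot>\<^bsub>opcmp P n (d + 2 - e)\<^esub> odiff P (\<theta> n d f)
         = \<zero>\<^bsub>opcmp P n (d + 2 - e)\<^esub>"
    and \<theta>_pcomp: "\<lbrakk>f \<in> carrier (opcmp P m a); g \<in> carrier (opcmp P n b); 1 \<le> i; i \<le> m\<rbrakk> \<Longrightarrow>
       \<theta> (m + n - 1) (a + b) (pcomp P f i g) = pcomp P (\<theta> m a f) i g
         \<oplus>\<^bsub>opcmp P (m + n - 1) (a + b + 1 - e)\<^esub>
           ksign (a * (1 + e)) \<odot>\<^bsub>opcmp P (m + n - 1) (a + b + 1 - e)\<^esub> pcomp P f i (\<theta> n b g)"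
begin

abbreviation "E \<equiv> extension P e \<theta>"

lemma E_carrier: "A \<in> carrier (opcmp E n d) \<longleftrightarrow>
    (\<exists>x z. A = (n, d, x, z) \<and> x \<in> cmps n d \<and> z \<in> cmps n (d - e))"
  by (auto simp: extension_def)

lemma E_ops:
  "\<zero>\<^bsub>opcmp E n d\<^esub> = (n, d, \<zero>\<^bsub>opcmp P n d\<^esub>, \<zero>\<^bsub>opcmp P n (d - e)\<^esub>)"
  "(n1, d1, x, z) \<oplus>\<^bsub>opcmp E n d\<^esub> (n2, d2, x', z') = (n, d, x \<oplus>\<^bsub>opcmp P n d\<^esub> x', z \<oplus>\<^bsub>opcmp P n (d - e)\<^esub> z')"
  "c \<odot>\<^bsub>opcmp E n d\<^esub> (n1, d1, x, z) = (n, d, c \<odot>\<^bsub>opcmp P n d\<^esub> x, c \<odot>\<^bsub>opcmp P n (d - e)\<^esub> z)"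
  "odiff E (n, d, x, z) = (n, d + 1, odiff P x,
       \<theta> n d x \<oplus>\<^bsub>opcmp P n (d + 1 - e)\<^esub> ksign e \<odot>\<^bsub>opcmp P n (d + 1 - e)\<^esub> odiff P z)"
  "ounit E = (1, 0, ounit P, \<zero>\<^bsub>opcmp P 1 (- e)\<^esub>)"
  "pcomp E (m, a, x, z) i (n, b, x', z') = (m + n - 1, a + b, pcomp P x i x',
       pcomp P z i x' \<oplus>\<^bsub>opcmp P (m + n - 1) (a + b - e)\<^esub>
         ksign (e * a) \<odot>\<^bsub>opcmp P (m + n - 1) (a + b - e)\<^esub> pcomp P x i z')"
  "act E (n, d, x, z) \<tau> = (n, d, act P x \<tau>, act P z \<tau>)"
  by (simp_all add: extension_def)

lemma E_module: "module ring_of_type_algebra (opcmp E n d)"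
proof (rule moduleI)
  show "cring (ring_of_type_algebra :: 'k ring)" by (rule cring_from_type_algebra)
  show "abelian_group (opcmp E n d)"
  proof (rule abelian_groupI)
    fix A assume "A \<in> carrier (opcmp E n d)"
    then obtain x z where A: "A = (n, d, x, z)" "x \<in> cmps n d" "z \<in> cmps n (d - e)" by (auto simp: E_carrier)
    have "(n, d, (- 1) \<odot>\<^bsub>opcmp P n d\<^esub> x, (- 1) \<odot>\<^bsub>opcmp P n (d - e)\<^esub> z) \<in> carrier (opcmp E n d)"
      using A by (simp add: E_carrier linear_simps)
    then show "\<exists>B\<in>carrier (opcmp E n d). B \<oplus>\<^bsub>opcmp E n d\<^esub> A = \<zero>\<^bsub>opcmp E n d\<^esub>"
      using A by (intro bexI) (auto simp: E_ops linear_simps)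
  qed (auto simp: E_ops E_carrier linear_simps)
qed (auto simp: E_ops E_carrier linear_simps ring_of_type_algebra_def smult_simps(2))


lemma E_odiff_linear: "linear_map (opcmp E n d) (opcmp E n (d + 1)) (odiff E)"
proof -
  note th = linear_mapD[OF \<theta>_linear[of n d]]
  have [simp]: "odiff P z \<in> cmps n (d + 1 - e)" if "z \<in> cmps n (d - e)" for z
    using that by (rule odiff_closed) simp
  note od = odiff_lin[where d' = "d + 1" and d = d and n = n, OF HOL.refl]
    odiff_lin[where d' = "d + 1 - e" and d = "d - e" and n = n, simplified]
  show ?thesis
    unfolding linear_map_def
    by (auto simp: E_carrier E_ops th od odiff_closed linear_simps mult.commute)
qed

lemma E_odiff_odiff:
  assumes "A \<in> carrier (opcmp E n d)"
  shows "odiff E (odiff E A) = \<zero>\<^bsub>opcmp E n (d + 2)\<^esub>"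
proof -
  from assms obtain x z where A: "A = (n, d, x, z)" and x: "x \<in> cmps n d" and z: "z \<in> cmps n (d - e)"
    by (auto simp: E_carrier)
  have dz: "odiff P z \<in> cmps n (d + 1 - e)" by (rule odiff_closed[OF z]) simp
  have th: "\<theta> n d x \<in> cmps n (d + 1 - e)" by (rule linear_mapD(1)[OF \<theta>_linear x])
  have dth: "odiff P (\<theta> n d x) \<in> cmps n (d + 2 - e)" by (rule odiff_closed[OF th]) simp
  have thd: "\<theta> n (d + 1) (odiff P x) \<in> cmps n (d + 2 - e)"
    using linear_mapD(1)[OF \<theta>_linear odiff_closed[OF x HOL.refl]] by (simp add: algebra_simps)
  have ddz: "odiff P (odiff P z) = \<zero>\<^bsub>opcmp P n (d + 2 - e)\<^esub>" "odiff P (odiff P x) = \<zero>\<^bsub>opcmp P n (d + 2)\<^esub>"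
    using odiff_odiff[OF z] odiff_odiff[OF x] by (simp_all add: algebra_simps)
  have "odiff P (\<theta> n d x \<oplus>\<^bsub>opcmp P n (d + 1 - e)\<^esub> ksign e \<odot>\<^bsub>opcmp P n (d + 1 - e)\<^esub> odiff P z)
      = odiff P (\<theta> n d x)"
    using th dz by (simp add: odiff_lin[of "d + 2 - e"] linear_simps ddz dth)
  then show ?thesis
    using \<theta>_odiff[OF x] by (simp add: A E_ops ddz algebra_simps)
qed

lemma E_act:
  assumes t: "\<tau> permutes {1..n}"
  shows "linear_map (opcmp E n d) (opcmp E n d) (\<lambda>A. act E A \<tau>)"
    and "A \<in> carrier (opcmp E n d) \<Longrightarrow> act E A id = A"
    and "A \<in> carrier (opcmp E n d) \<Longrightarrow> \<rho> permutes {1..n} \<Longrightarrow> act E (act E A \<tau>) \<rho> = act E A (\<tau> \<circ> \<rho>)"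
    and "A \<in> carrier (opcmp E n d) \<Longrightarrow> odiff E (act E A \<tau>) = act E (odiff E A) \<tau>"
proof -
  show "linear_map (opcmp E n d) (opcmp E n d) (\<lambda>A. act E A \<tau>)"
    unfolding linear_map_def by (auto simp: E_carrier E_ops act_lin[OF t] act_closed[OF _ t])
  show "act E A id = A" if "A \<in> carrier (opcmp E n d)"
    using that by (auto simp: E_carrier E_ops act_id)
  show "act E (act E A \<tau>) \<rho> = act E A (\<tau> \<circ> \<rho>)" if "A \<in> carrier (opcmp E n d)" "\<rho> permutes {1..n}"
    using that t by (auto simp: E_carrier E_ops act_comp)
  show "odiff E (act E A \<tau>) = act E (odiff E A) \<tau>" if A: "A \<in> carrier (opcmp E n d)"
  proof -
    from A obtain x z where A: "A = (n, d, x, z)" and x: "x \<in> cmps n d" and z: "z \<in> cmps n (d - e)"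
      by (auto simp: E_carrier)
    have dz: "odiff P z \<in> cmps n (d + 1 - e)" by (rule odiff_closed[OF z]) simp
    have th: "\<theta> n d x \<in> cmps n (d + 1 - e)" by (rule linear_mapD(1)[OF \<theta>_linear x])
    show ?thesis
      using x z t th dz by (simp add: A E_ops odiff_act \<theta>_act act_lin[OF t] smult_simps(1))
  qed
qed

lemma E_pcomp_linear_left:
  assumes B: "B \<in> carrier (opcmp E n b)" and i: "1 \<le> i" "i \<le> m"
  shows "linear_map (opcmp E m a) (opcmp E (m + n - 1) (a + b)) (\<lambda>A. pcomp E A i B)"
proof -
  from B obtain x' z' where B: "B = (n, b, x', z')" and x': "x' \<in> cmps n b" and z': "z' \<in> cmps n (b - e)"
    by (auto simp: E_carrier)
  let ?N = "m + n - 1" and ?D = "a + b - e"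
  have c: "pcomp P x i x' \<in> cmps ?N (a + b)" "pcomp P x i z' \<in> cmps ?N ?D" if "x \<in> cmps m a" for x
    by (rule pcomp_closed[OF that x' i] pcomp_closed[OF that z' i]; simp)+
  have c': "pcomp P z i x' \<in> cmps ?N ?D" if "z \<in> cmps m (a - e)" for z
    by (rule pcomp_closed[OF that x' i]; simp)
  note l = pcomp_lin_left[where N = ?N and D = "a + b" and a = a, OF x' i HOL.refl HOL.refl]
    pcomp_lin_left[where N = ?N and D = ?D and a = a, OF z' i HOL.refl, simplified, folded One_nat_def]
    pcomp_lin_left[where N = ?N and D = ?D and a = "a - e", OF x' i HOL.refl, simplified, folded One_nat_def]
  show ?thesis
    unfolding linear_map_def by (auto simp: E_carrier E_ops B l c c' linear_simps mult.commute simp del: One_nat_def)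
qed

lemma E_pcomp_linear_right:
  assumes A: "A \<in> carrier (opcmp E m a)" and i: "1 \<le> i" "i \<le> m"
  shows "linear_map (opcmp E n b) (opcmp E (m + n - 1) (a + b)) (\<lambda>B. pcomp E A i B)"
proof -
  from A obtain x z where A: "A = (m, a, x, z)" and x: "x \<in> cmps m a" and z: "z \<in> cmps m (a - e)"
    by (auto simp: E_carrier)
  let ?N = "m + n - 1" and ?D = "a + b - e"
  have c: "pcomp P x i x' \<in> cmps ?N (a + b)" "pcomp P z i x' \<in> cmps ?N ?D" if "x' \<in> cmps n b" for x'
    by (rule pcomp_closed[OF x that i] pcomp_closed[OF z that i]; simp)+
  have c': "pcomp P x i z' \<in> cmps ?N ?D" if "z' \<in> cmps n (b - e)" for z'
    by (rule pcomp_closed[OF x that i]; simp)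
  note l = pcomp_lin_right[where N = ?N and D = "a + b" and b = b, OF x i HOL.refl HOL.refl]
    pcomp_lin_right[where N = ?N and D = ?D and b = b, OF z i HOL.refl, simplified, folded One_nat_def]
    pcomp_lin_right[where N = ?N and D = ?D and b = "b - e", OF x i HOL.refl, simplified, folded One_nat_def]
  show ?thesis
    unfolding linear_map_def by (auto simp: E_carrier E_ops A l c c' linear_simps mult.commute simp del: One_nat_def)
qed

lemma E_unit:
  shows "ounit E \<in> carrier (opcmp E 1 0)"
    and "A \<in> carrier (opcmp E n d) \<Longrightarrow> pcomp E (ounit E) 1 A = A"
    and "\<lbrakk>A \<in> carrier (opcmp E n d); 1 \<le> i; i \<le> n\<rbrakk> \<Longrightarrow> pcomp E A i (ounit E) = A"
proof -
  show "ounit E \<in> carrier (opcmp E 1 0)" by (auto simp: E_carrier E_ops ounit_closed[simplified] zero_closed)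
  show "pcomp E (ounit E) 1 A = A" if "A \<in> carrier (opcmp E n d)"
    using that pcomp_lin_left(4)[of _ n d 1 1 n "d - e" "- e"]
    by (auto simp: E_carrier E_ops pcomp_unit_left[simplified] linear_simps ksign_simps)
  show "pcomp E A i (ounit E) = A" if "A \<in> carrier (opcmp E n d)" "1 \<le> i" "i \<le> n"
    using that pcomp_lin_right(4)[of _ n d i n 1 "d - e" "- e"]
    by (auto simp: E_carrier E_ops pcomp_unit_right linear_simps)
qed


lemma E_sequential:
  assumes F: "F \<in> carrier (opcmp E m a)" and G: "G \<in> carrier (opcmp E n b)" and H: "H \<in> carrier (opcmp E l c)"
    and i: "1 \<le> i" "i \<le> m" and j: "1 \<le> j" "j \<le> n"
  shows "pcomp E (pcomp E F i G) (i + j - 1) H = pcomp E F i (pcomp E G j H)"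
proof -
  from F obtain x1 z1 where F: "F = (m, a, x1, z1)" and x1: "x1 \<in> cmps m a" and z1: "z1 \<in> cmps m (a - e)"
    by (auto simp: E_carrier)
  from G obtain x2 z2 where G: "G = (n, b, x2, z2)" and x2: "x2 \<in> cmps n b" and z2: "z2 \<in> cmps n (b - e)"
    by (auto simp: E_carrier)
  from H obtain x3 z3 where H: "H = (l, c, x3, z3)" and x3: "x3 \<in> cmps l c" and z3: "z3 \<in> cmps l (c - e)"
    by (auto simp: E_carrier)
  obtain N D where N: "m + n - 1 + l - 1 = N" "m + (n + l - 1) - 1 = N"
    and D: "a + b + c - e = D" "a + (b + c) - e = D" using j by force
  define k where "k = i + j - 1"
  have k: "1 \<le> k" "k \<le> m + n - 1" using i j by (auto simp: k_def)
  note seq = pcomp_sequential[OF _ _ _ i j, folded k_def]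
  have c12: "pcomp P z1 i x2 \<in> cmps (m + n - 1) (a + b - e)" "pcomp P x1 i z2 \<in> cmps (m + n - 1) (a + b - e)"
    by (rule pcomp_closed[OF z1 x2 i] pcomp_closed[OF x1 z2 i]; simp)+
  have c23: "pcomp P z2 j x3 \<in> cmps (n + l - 1) (b + c - e)" "pcomp P x2 j z3 \<in> cmps (n + l - 1) (b + c - e)"
    "pcomp P x2 j x3 \<in> cmps (n + l - 1) (b + c)"
    by (rule pcomp_closed[OF z2 x3 j] pcomp_closed[OF x2 z3 j] pcomp_closed[OF x2 x3 j]; simp)+
  have c123: "pcomp P z1 i (pcomp P x2 j x3) \<in> cmps N D" "pcomp P x1 i (pcomp P z2 j x3) \<in> cmps N D"
    "pcomp P x1 i (pcomp P x2 j z3) \<in> cmps N D"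
    by (rule pcomp_closed[OF z1 c23(3) i] pcomp_closed[OF x1 c23(1) i] pcomp_closed[OF x1 c23(2) i];
        use N D in simp)+
  have L: "pcomp P (pcomp P z1 i x2 \<oplus>\<^bsub>opcmp P (m + n - 1) (a + b - e)\<^esub>
        s \<odot>\<^bsub>opcmp P (m + n - 1) (a + b - e)\<^esub> pcomp P x1 i z2) k x3
      = pcomp P (pcomp P z1 i x2) k x3 \<oplus>\<^bsub>opcmp P N D\<^esub> s \<odot>\<^bsub>opcmp P N D\<^esub> pcomp P (pcomp P x1 i z2) k x3" for s
    using N D by (intro pcomp_lin_left(3)[OF x3 k] c12) auto
  have R: "pcomp P x1 i (pcomp P z2 j x3 \<oplus>\<^bsub>opcmp P (n + l - 1) (b + c - e)\<^esub>
        s \<odot>\<^bsub>opcmp P (n + l - 1) (b + c - e)\<^esub> pcomp P x2 j z3)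
      = pcomp P x1 i (pcomp P z2 j x3) \<oplus>\<^bsub>opcmp P N D\<^esub> s \<odot>\<^bsub>opcmp P N D\<^esub> pcomp P x1 i (pcomp P x2 j z3)" for s
    using N D by (intro pcomp_lin_right(3)[OF x1 i] c23) auto
  show ?thesis
    unfolding F G H E_ops k_def[symmetric] N D L R seq[OF x1 x2 x3] seq[OF z1 x2 x3] seq[OF x1 z2 x3] seq[OF x1 x2 z3]
    using c123 by (simp add: linear_simps ksign_simps distrib_left mult.commute)
qed

lemma E_parallel:
  assumes F: "F \<in> carrier (opcmp E m a)" and G: "G \<in> carrier (opcmp E n b)" and H: "H \<in> carrier (opcmp E l c)"
    and i: "1 \<le> i" "i < k" "k \<le> m"
  shows "pcomp E (pcomp E F i G) (k + n - 1) H
     = ksign (b * c) \<odot>\<^bsub>opcmp E (m + n - 1 + l - 1) (a + b + c)\<^esub> pcomp E (pcomp E F k H) i G"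
proof -
  from F obtain x1 z1 where F: "F = (m, a, x1, z1)" and x1: "x1 \<in> cmps m a" and z1: "z1 \<in> cmps m (a - e)"
    by (auto simp: E_carrier)
  from G obtain x2 z2 where G: "G = (n, b, x2, z2)" and x2: "x2 \<in> cmps n b" and z2: "z2 \<in> cmps n (b - e)"
    by (auto simp: E_carrier)
  from H obtain x3 z3 where H: "H = (l, c, x3, z3)" and x3: "x3 \<in> cmps l c" and z3: "z3 \<in> cmps l (c - e)"
    by (auto simp: E_carrier)
  obtain N D D' where N: "m + n - 1 + l - 1 = N" "m + l - 1 + n - 1 = N"
    and D: "a + b + c - e = D" "a + c + b - e = D" and D': "a + b + c = D'" "a + c + b = D'" "D' - e = D"
    using i by force
  have i': "1 \<le> i" "i \<le> m" "1 \<le> k" "k \<le> m" "1 \<le> k + n - 1" "k + n - 1 \<le> m + n - 1" "i \<le> m + l - 1"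
    using i by auto
  have c12: "pcomp P z1 i x2 \<in> cmps (m + n - 1) (a + b - e)" "pcomp P x1 i z2 \<in> cmps (m + n - 1) (a + b - e)"
    by (rule pcomp_closed[OF z1 x2 i'(1,2)] pcomp_closed[OF x1 z2 i'(1,2)]; simp)+
  have c13: "pcomp P z1 k x3 \<in> cmps (m + l - 1) (a + c - e)" "pcomp P x1 k z3 \<in> cmps (m + l - 1) (a + c - e)"
    "pcomp P x1 k x3 \<in> cmps (m + l - 1) (a + c)"
    by (rule pcomp_closed[OF z1 x3 i'(3,4)] pcomp_closed[OF x1 z3 i'(3,4)] pcomp_closed[OF x1 x3 i'(3,4)]; simp)+
  have c132: "pcomp P (pcomp P z1 k x3) i x2 \<in> cmps N D" "pcomp P (pcomp P x1 k z3) i x2 \<in> cmps N D"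
    "pcomp P (pcomp P x1 k x3) i z2 \<in> cmps N D"
    by (rule pcomp_closed[OF c13(1) x2 i'(1,7)] pcomp_closed[OF c13(2) x2 i'(1,7)] pcomp_closed[OF c13(3) z2 i'(1,7)];
        use N D in simp)+
  have L: "pcomp P (pcomp P z1 i x2 \<oplus>\<^bsub>opcmp P (m + n - 1) (a + b - e)\<^esub>
        s \<odot>\<^bsub>opcmp P (m + n - 1) (a + b - e)\<^esub> pcomp P x1 i z2) (k + n - 1) x3
      = pcomp P (pcomp P z1 i x2) (k + n - 1) x3 \<oplus>\<^bsub>opcmp P N D\<^esub>
        s \<odot>\<^bsub>opcmp P N D\<^esub> pcomp P (pcomp P x1 i z2) (k + n - 1) x3" for s
    using N D by (intro pcomp_lin_left(3)[OF x3 i'(5,6)] c12) auto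
  have R: "pcomp P (pcomp P z1 k x3 \<oplus>\<^bsub>opcmp P (m + l - 1) (a + c - e)\<^esub>
        s \<odot>\<^bsub>opcmp P (m + l - 1) (a + c - e)\<^esub> pcomp P x1 k z3) i x2
      = pcomp P (pcomp P z1 k x3) i x2 \<oplus>\<^bsub>opcmp P N D\<^esub> s \<odot>\<^bsub>opcmp P N D\<^esub> pcomp P (pcomp P x1 k z3) i x2" for s
    using N D by (intro pcomp_lin_left(3)[OF x2 i'(1,7)] c13) auto
  note par = pcomp_parallel[OF _ _ _ i]
  \<comment> \<open>The sign of exchanging \<open>z2\<close> and \<open>x3\<close> is that of \<open>(b - e) c\<close>; the factor \<open>(-1)\<^bsup>e c\<^esup>\<close>
    is the one that appears when \<open>\<epsilon>\<close> moves past \<open>x3\<close>.\<close>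
  have D'': "a - e + b + c = D" "a + (b - e) + c = D" "a + b + (c - e) = D" using D by simp_all
  show ?thesis
    unfolding F G H E_ops N D D' L R par[OF x1 x2 x3, unfolded N D'] par[OF z1 x2 x3, unfolded N D'']
      par[OF x1 z2 x3, unfolded N D''] par[OF x1 x2 z3, unfolded N D'']
    using c132 by (simp add: linear_simps ksign_simps algebra_simps)
qed

lemma E_pcomp_act:
  assumes F: "F \<in> carrier (opcmp E m a)" and G: "G \<in> carrier (opcmp E n b)"
    and i: "1 \<le> i" "i \<le> m" and \<sigma>: "\<sigma> permutes {1..m}" and \<tau>: "\<tau> permutes {1..n}"
  shows "pcomp E (act E F \<sigma>) i (act E G \<tau>) = act E (pcomp E F (\<sigma> i) G) (block_perm n \<sigma> i \<tau>)"
proof -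
  from F obtain x1 z1 where F: "F = (m, a, x1, z1)" and x1: "x1 \<in> cmps m a" and z1: "z1 \<in> cmps m (a - e)"
    by (auto simp: E_carrier)
  from G obtain x2 z2 where G: "G = (n, b, x2, z2)" and x2: "x2 \<in> cmps n b" and z2: "z2 \<in> cmps n (b - e)"
    by (auto simp: E_carrier)
  have si: "1 \<le> \<sigma> i" "\<sigma> i \<le> m" using permutes_in_image[OF \<sigma>, of i] i by auto
  note bp = block_perm_permutes[OF \<sigma> \<tau> i]
  have c12: "pcomp P z1 (\<sigma> i) x2 \<in> cmps (m + n - 1) (a + b - e)" "pcomp P x1 (\<sigma> i) z2 \<in> cmps (m + n - 1) (a + b - e)"
    by (rule pcomp_closed[OF z1 x2 si] pcomp_closed[OF x1 z2 si]; simp)+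
  note pa = pcomp_act[OF _ _ i \<sigma> \<tau>]
  show ?thesis
    unfolding F G E_ops pa[OF x1 x2] pa[OF z1 x2] pa[OF x1 z2]
    using c12 by (simp add: act_lin[OF bp] smult_simps(1) del: One_nat_def)
qed

lemma E_odiff_pcomp:
  assumes F: "F \<in> carrier (opcmp E m a)" and G: "G \<in> carrier (opcmp E n b)" and i: "1 \<le> i" "i \<le> m"
  shows "odiff E (pcomp E F i G) = pcomp E (odiff E F) i G
           \<oplus>\<^bsub>opcmp E (m + n - 1) (a + b + 1)\<^esub>
           ksign a \<odot>\<^bsub>opcmp E (m + n - 1) (a + b + 1)\<^esub> pcomp E F i (odiff E G)"
proof -
  from F obtain x1 z1 where F: "F = (m, a, x1, z1)" and x1: "x1 \<in> cmps m a" and z1: "z1 \<in> cmps m (a - e)"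
    by (auto simp: E_carrier)
  from G obtain x2 z2 where G: "G = (n, b, x2, z2)" and x2: "x2 \<in> cmps n b" and z2: "z2 \<in> cmps n (b - e)"
    by (auto simp: E_carrier)
  obtain N D D' where N: "m + n - 1 = N"
    and D: "a + b + 1 - e = D" "a + 1 + b - e = D" "a + (b + 1) - e = D"
    and D': "a + b - e = D'" by force
  have dx1: "odiff P x1 \<in> cmps m (a + 1)" and dx2: "odiff P x2 \<in> cmps n (b + 1)"
    and dz1: "odiff P z1 \<in> cmps m (a + 1 - e)" and dz2: "odiff P z2 \<in> cmps n (b + 1 - e)"
    by (rule odiff_closed[OF x1] odiff_closed[OF x2] odiff_closed[OF z1] odiff_closed[OF z2]; simp)+
  have t1: "\<theta> m a x1 \<in> cmps m (a + 1 - e)" and t2: "\<theta> n b x2 \<in> cmps n (b + 1 - e)"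
    by (rule linear_mapD(1)[OF \<theta>_linear] x1 x2)+
  have c: "pcomp P z1 i x2 \<in> cmps N D'" "pcomp P x1 i z2 \<in> cmps N D'"
    by (rule pcomp_closed[OF z1 x2 i] pcomp_closed[OF x1 z2 i]; use N D' in simp)+
  have c': "pcomp P (\<theta> m a x1) i x2 \<in> cmps N D" "pcomp P x1 i (\<theta> n b x2) \<in> cmps N D"
    "pcomp P (odiff P z1) i x2 \<in> cmps N D" "pcomp P z1 i (odiff P x2) \<in> cmps N D"
    "pcomp P (odiff P x1) i z2 \<in> cmps N D" "pcomp P x1 i (odiff P z2) \<in> cmps N D"
    by (rule pcomp_closed[OF t1 x2 i] pcomp_closed[OF x1 t2 i] pcomp_closed[OF dz1 x2 i]
        pcomp_closed[OF z1 dx2 i] pcomp_closed[OF dx1 z2 i] pcomp_closed[OF x1 dz2 i]; use N D in simp)+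
  have L: "odiff P (pcomp P z1 i x2 \<oplus>\<^bsub>opcmp P N D'\<^esub> s \<odot>\<^bsub>opcmp P N D'\<^esub> pcomp P x1 i z2)
      = odiff P (pcomp P z1 i x2) \<oplus>\<^bsub>opcmp P N D\<^esub> s \<odot>\<^bsub>opcmp P N D\<^esub> odiff P (pcomp P x1 i z2)" for s
    using D D' c by (simp add: odiff_lin[of D D'] smult_simps(1))
  have R1: "pcomp P (\<theta> m a x1 \<oplus>\<^bsub>opcmp P m (a + 1 - e)\<^esub> s \<odot>\<^bsub>opcmp P m (a + 1 - e)\<^esub> odiff P z1) i x2
      = pcomp P (\<theta> m a x1) i x2 \<oplus>\<^bsub>opcmp P N D\<^esub> s \<odot>\<^bsub>opcmp P N D\<^esub> pcomp P (odiff P z1) i x2" for s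
    using N D by (intro pcomp_lin_left(3)[OF x2 i] t1 dz1) auto
  have R2: "pcomp P x1 i (\<theta> n b x2 \<oplus>\<^bsub>opcmp P n (b + 1 - e)\<^esub> s \<odot>\<^bsub>opcmp P n (b + 1 - e)\<^esub> odiff P z2)
      = pcomp P x1 i (\<theta> n b x2) \<oplus>\<^bsub>opcmp P N D\<^esub> s \<odot>\<^bsub>opcmp P N D\<^esub> pcomp P x1 i (odiff P z2)" for s
    using N D by (intro pcomp_lin_right(3)[OF x1 i] t2 dz2) auto
  have D'': "a - e + b + 1 = D" "a + (b - e) + 1 = D" using D by simp_all
  note dp = odiff_pcomp[OF _ _ i, unfolded N]
  have tags: "a + 1 + b = a + b + 1" "a + (b + 1) = a + b + 1" by simp_all
  show ?thesis
    unfolding F G E_ops N D D' L R1 R2 dp[OF x1 x2] dp[OF z1 x2, unfolded D''] dp[OF x1 z2, unfolded D'']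
      \<theta>_pcomp[OF x1 x2 i, unfolded N D] prod.inject
    using c'
    by (cases "even e"; cases "even a") (simp_all add: linear_simps ksign_def)
qed

sublocale E: dg_operad E
  by (rule dg_operad.intro)
    (blast intro: E_module E_odiff_linear E_odiff_odiff E_act E_unit E_pcomp_linear_left E_pcomp_linear_right
      E_sequential E_parallel E_pcomp_act E_odiff_pcomp permutes_id)+

end

section \<open>Morphisms and derivations of presented operads\<close>

context wf_dg_presentation
begin

sublocale Op: dg_operad Op by (rule dg_operad_Op)

lemma cl_closed: "twf \<Gamma> t \<Longrightarrow> cl t \<in> carrier (opcmp Op (tarity \<Gamma> t) (tdegree \<Gamma> t))"
  by (intro carrierI) (simp add: terms_def)

lemma cl_ops:
  "\<zero>\<^bsub>opcmp Op n d\<^esub> = cl (TZero n d)"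
  "ounit Op = cl TUnit"
  "twf \<Gamma> t \<Longrightarrow> odiff Op (cl t) = cl (TDiff t)"
  "\<lbrakk>twf \<Gamma> t; twf \<Gamma> u; same_type \<Gamma> t u\<rbrakk> \<Longrightarrow> cl t \<oplus>\<^bsub>opcmp Op n d\<^esub> cl u = cl (TAdd t u)"
  "twf \<Gamma> t \<Longrightarrow> c \<odot>\<^bsub>opcmp Op n d\<^esub> cl t = cl (TScale c t)"
  "\<lbrakk>twf \<Gamma> t; twf \<Gamma> u; 1 \<le> i; i \<le> tarity \<Gamma> t\<rbrakk> \<Longrightarrow> pcomp Op (cl t) i (cl u) = cl (TComp t i u)"
  "\<lbrakk>twf \<Gamma> t; \<tau> permutes {1..tarity \<Gamma> t}\<rbrakk> \<Longrightarrow> act Op (cl t) \<tau> = cl (TAct t \<tau>)"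
  by (rule zero_cl unit_cl odiff_cl[of _ "tarity \<Gamma> t" "tdegree \<Gamma> t"] add_cl[of _ "tarity \<Gamma> t" "tdegree \<Gamma> t"]
      smult_cl[of _ "tarity \<Gamma> t" "tdegree \<Gamma> t"] act_cl[of _ "tarity \<Gamma> t" "tdegree \<Gamma> t"]
      pcomp_cl[of _ "tarity \<Gamma> t" "tdegree \<Gamma> t" _ "tarity \<Gamma> u" "tdegree \<Gamma> u"];
      simp add: terms_def same_type_def)+

text \<open>A morphism out of a presented operad evaluates representing terms, so identities between such
  morphisms can be checked by induction on terms.\<close>

lemma hom_cl:
  assumes "dg_operad_hom Op Q \<psi>" and "\<And>x. \<psi> (cl (TGen x)) = v x"
  shows "twf \<Gamma> t \<Longrightarrow> \<psi> (cl t) = teval Q \<Gamma> v t"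
proof -
  interpret \<psi>: dg_operad_hom Op Q \<psi> by fact
  note lin = linear_mapD[OF \<psi>.hom_linear cl_closed]
  show "twf \<Gamma> t \<Longrightarrow> \<psi> (cl t) = teval Q \<Gamma> v t"
  proof (induction t)
    case (TZero n d)
    show ?case using \<psi>.hom_zero[of n d] by (simp add: zero_cl)
  next
    case (TAdd t u)
    then show ?case
      using lin(2)[of t "cl u"] cl_closed[of u] cl_ops(4)[of t u] by (simp add: same_type_def)
  next
    case (TScale c t)
    then show ?case using lin(3)[of t c] cl_ops(5)[of t] by simp
  next
    case (TDiff t)
    then show ?case using \<psi>.hom_odiff[OF cl_closed[of t]] cl_ops(3)[of t] by simp
  next
    case (TComp t i u)
    then show ?case using \<psi>.hom_pcomp[OF cl_closed[of t] cl_closed[of u], of i] cl_ops(6)[of t u i] by simp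
  next
    case (TAct t \<tau>)
    then show ?case using \<psi>.hom_act[OF cl_closed[of t], of \<tau>] cl_ops(7)[of t \<tau>] by simp
  qed (use assms(2) \<psi>.hom_ounit cl_ops(2) in simp_all)
qed

lemma teval_Op: "twf \<Gamma> t \<Longrightarrow> teval Op \<Gamma> (\<lambda>x. cl (TGen x)) t = cl t"
  using hom_cl[OF dg_operad_hom_id[OF dg_operad_Op], of "\<lambda>x. cl (TGen x)", OF HOL.refl, symmetric] .

lemma hom_exists:
  assumes "dg_operad Q"
    and "\<And>x. v x \<in> carrier (opcmp Q (gen_arity \<Gamma> x) (gen_degree \<Gamma> x))"
    and "\<And>t u. (t, u) \<in> relations \<Gamma> \<Longrightarrow> teval Q \<Gamma> v t = teval Q \<Gamma> v u"
  obtains \<phi> where "dg_operad_hom Op Q \<phi>" and "\<And>t. twf \<Gamma> t \<Longrightarrow> \<phi> (cl t) = teval Q \<Gamma> v t"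
proof (rule presented_operad_universal[OF assms])
  fix \<phi> assume \<phi>: "dg_operad_hom Op Q \<phi>" "\<And>x. \<phi> (cl (TGen x)) = v x"
  show thesis by (rule that[OF \<phi>(1) hom_cl[OF \<phi>]])
qed

end

text \<open>The value on (the class of) a term of the derivation of degree \<open>-e\<close>, twisted by \<open>\<theta>\<close>, that sends the
  generator \<open>x\<close> to \<open>v x\<close>. It is the \<open>\<epsilon>\<close>-component of the evaluation of the term in the
  extension at \<open>cl x + \<epsilon> v x\<close>; the Leibniz rule is built into the clause for compositions.\<close>

primrec term_derivation :: "('k::field, 'g) dg_presentation \<Rightarrow> int
    \<Rightarrow> (nat \<Rightarrow> int \<Rightarrow> ('k, 'g) dgterm set \<Rightarrow> ('k, 'g) dgterm set) \<Rightarrow> ('g \<Rightarrow> ('k, 'g) dgterm set)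
    \<Rightarrow> ('k, 'g) dgterm \<Rightarrow> ('k, 'g) dgterm set" where
  "term_derivation \<Gamma> e \<theta> v (TZero n d) = tclass \<Gamma> (TZero n (d - e))"
| "term_derivation \<Gamma> e \<theta> v TUnit = tclass \<Gamma> (TZero 1 (- e))"
| "term_derivation \<Gamma> e \<theta> v (TGen x) = v x"
| "term_derivation \<Gamma> e \<theta> v (TDiff t) =
     \<theta> (tarity \<Gamma> t) (tdegree \<Gamma> t) (tclass \<Gamma> t)
       \<oplus>\<^bsub>opcmp (presented_operad \<Gamma>) (tarity \<Gamma> t) (tdegree \<Gamma> t + 1 - e)\<^esub>
       ksign e \<odot>\<^bsub>opcmp (presented_operad \<Gamma>) (tarity \<Gamma> t) (tdegree \<Gamma> t + 1 - e)\<^esub>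
         odiff (presented_operad \<Gamma>) (term_derivation \<Gamma> e \<theta> v t)"
| "term_derivation \<Gamma> e \<theta> v (TAdd t u) =
     term_derivation \<Gamma> e \<theta> v t
       \<oplus>\<^bsub>opcmp (presented_operad \<Gamma>) (tarity \<Gamma> t) (tdegree \<Gamma> t - e)\<^esub> term_derivation \<Gamma> e \<theta> v u"
| "term_derivation \<Gamma> e \<theta> v (TScale c t) =
     c \<odot>\<^bsub>opcmp (presented_operad \<Gamma>) (tarity \<Gamma> t) (tdegree \<Gamma> t - e)\<^esub> term_derivation \<Gamma> e \<theta> v t"
| "term_derivation \<Gamma> e \<theta> v (TComp t i u) =
     (let M = opcmp (presented_operad \<Gamma>) (tarity \<Gamma> t + tarity \<Gamma> u - 1) (tdegree \<Gamma> t + tdegree \<Gamma> u - e) in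
      pcomp (presented_operad \<Gamma>) (term_derivation \<Gamma> e \<theta> v t) i (tclass \<Gamma> u)
       \<oplus>\<^bsub>M\<^esub> ksign (e * tdegree \<Gamma> t) \<odot>\<^bsub>M\<^esub>
         pcomp (presented_operad \<Gamma>) (tclass \<Gamma> t) i (term_derivation \<Gamma> e \<theta> v u))"
| "term_derivation \<Gamma> e \<theta> v (TAct t \<tau>) = act (presented_operad \<Gamma>) (term_derivation \<Gamma> e \<theta> v t) \<tau>"

context wf_dg_presentation
begin

text \<open>The universal property turns the evaluation in the extension into a morphism as soon as it
  respects the relations. Its first component is the identity, and the morphism property of
  the second component consists of the rules for a twisted derivation.\<close>

lemma derivation_exists:
  assumes "twisting_derivation Op e \<theta>"
    and v: "\<And>x. v x \<in> carrier (opcmp Op (gen_arity \<Gamma> x) (gen_degree \<Gamma> x - e))"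
    and rels: "\<And>t u. (t, u) \<in> relations \<Gamma> \<Longrightarrow> term_derivation \<Gamma> e \<theta> v t = term_derivation \<Gamma> e \<theta> v u"
  obtains \<delta> where "\<And>t. twf \<Gamma> t \<Longrightarrow> \<delta> (cl t) = term_derivation \<Gamma> e \<theta> v t"
    and "\<And>n d. linear_map (opcmp Op n d) (opcmp Op n (d - e)) \<delta>"
    and "\<And>n d A. A \<in> carrier (opcmp Op n d) \<Longrightarrow> \<delta> (odiff Op A)
           = \<theta> n d A \<oplus>\<^bsub>opcmp Op n (d + 1 - e)\<^esub> ksign e \<odot>\<^bsub>opcmp Op n (d + 1 - e)\<^esub> odiff Op (\<delta> A)"
    and "\<And>n d A \<tau>. A \<in> carrier (opcmp Op n d) \<Longrightarrow> \<tau> permutes {1..n} \<Longrightarrow> \<delta> (act Op A \<tau>) = act Op (\<delta> A) \<tau>"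
    and "\<And>m a A n b B i. \<lbrakk>A \<in> carrier (opcmp Op m a); B \<in> carrier (opcmp Op n b); 1 \<le> i; i \<le> m\<rbrakk>
           \<Longrightarrow> \<delta> (pcomp Op A i B) = pcomp Op (\<delta> A) i B \<oplus>\<^bsub>opcmp Op (m + n - 1) (a + b - e)\<^esub>
             ksign (e * a) \<odot>\<^bsub>opcmp Op (m + n - 1) (a + b - e)\<^esub> pcomp Op A i (\<delta> B)"
proof -
  interpret twisting_derivation Op e \<theta> by fact
  define V where "V x = (gen_arity \<Gamma> x, gen_degree \<Gamma> x, cl (TGen x), v x)" for x
  have V: "V x \<in> carrier (opcmp E (gen_arity \<Gamma> x) (gen_degree \<Gamma> x))" for x
    using v cl_closed[of "TGen x"] by (auto simp: V_def E_carrier)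
  have eval: "teval E \<Gamma> V t = (tarity \<Gamma> t, tdegree \<Gamma> t, cl t, term_derivation \<Gamma> e \<theta> v t)" if "twf \<Gamma> t" for t
    using that by (induction t) (auto simp: E_ops V_def cl_ops Let_def simp del: Image_singleton_iff)
  have eval_rel: "teval E \<Gamma> V t = teval E \<Gamma> V u" if "(t, u) \<in> relations \<Gamma>" for t u
    using typed[OF tcong.rel[OF that]] cl_eq[OF tcong.rel[OF that]] rels[OF that]
    by (simp add: eval same_type_def)
  obtain \<Phi> where \<Phi>: "dg_operad_hom Op E \<Phi>" "\<And>t. twf \<Gamma> t \<Longrightarrow> \<Phi> (cl t) = teval E \<Gamma> V t"
    by (rule hom_exists[OF E.dg_operad_axioms V], rule eval_rel, assumption, rule that)
  interpret \<Phi>: dg_operad_hom Op E \<Phi> by fact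
  define \<delta> where "\<delta> A = snd (snd (snd (\<Phi> A)))" for A
  have \<Phi>_eq: "\<Phi> A = (n, d, A, \<delta> A)" if "A \<in> carrier (opcmp Op n d)" for A n d
  proof -
    from that obtain t where t: "twf \<Gamma> t" "tarity \<Gamma> t = n" "tdegree \<Gamma> t = d" and A: "A = cl t"
      by (auto simp: terms_def elim!: carrierE)
    show ?thesis unfolding \<delta>_def A \<Phi>(2)[OF t(1)] eval[OF t(1)] t(2,3) by simp
  qed
  show thesis
  proof
    show "\<delta> (cl t) = term_derivation \<Gamma> e \<theta> v t" if "twf \<Gamma> t" for t
      using that by (simp add: \<delta>_def \<Phi>(2) eval)
    show "\<delta> (odiff Op A) = \<theta> n d A \<oplus>\<^bsub>opcmp Op n (d + 1 - e)\<^esub> ksign e \<odot>\<^bsub>opcmp Op n (d + 1 - e)\<^esub> odiff Op (\<delta> A)"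
      if "A \<in> carrier (opcmp Op n d)" for n d A
      using \<Phi>.hom_odiff[OF that] by (simp add: \<Phi>_eq[OF that] \<Phi>_eq[OF Op.odiff_closed[OF that HOL.refl]] E_ops)
    show "\<delta> (act Op A \<tau>) = act Op (\<delta> A) \<tau>" if "A \<in> carrier (opcmp Op n d)" "\<tau> permutes {1..n}" for n d A \<tau>
      using \<Phi>.hom_act[OF that] by (simp add: \<Phi>_eq[OF that(1)] \<Phi>_eq[OF Op.act_closed[OF that]] E_ops)
    show "\<delta> (pcomp Op A i B) = pcomp Op (\<delta> A) i B \<oplus>\<^bsub>opcmp Op (m + n - 1) (a + b - e)\<^esub>
             ksign (e * a) \<odot>\<^bsub>opcmp Op (m + n - 1) (a + b - e)\<^esub> pcomp Op A i (\<delta> B)"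
      if "A \<in> carrier (opcmp Op m a)" "B \<in> carrier (opcmp Op n b)" "1 \<le> i" "i \<le> m" for m a A n b B i
      using \<Phi>.hom_pcomp[OF that]
      by (simp add: \<Phi>_eq[OF that(1)] \<Phi>_eq[OF that(2)] \<Phi>_eq[OF Op.pcomp_closed[OF that HOL.refl HOL.refl]] E_ops)
    show "linear_map (opcmp Op n d) (opcmp Op n (d - e)) \<delta>" for n d
      unfolding linear_map_def
    proof (intro conjI Pi_I ballI allI)
      fix A assume A: "A \<in> carrier (opcmp Op n d)"
      show "\<delta> A \<in> carrier (opcmp Op n (d - e))"
        using linear_mapD(1)[OF \<Phi>.hom_linear A] by (simp add: \<Phi>_eq[OF A] E_carrier)
      show "\<delta> (c \<odot>\<^bsub>opcmp Op n d\<^esub> A) = c \<odot>\<^bsub>opcmp Op n (d - e)\<^esub> \<delta> A" for c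
        using linear_mapD(3)[OF \<Phi>.hom_linear A, of c] by (simp add: \<Phi>_eq[OF A] \<Phi>_eq[OF Op.smult_simps(1)[OF A]] E_ops)
      show "\<delta> (A \<oplus>\<^bsub>opcmp Op n d\<^esub> B) = \<delta> A \<oplus>\<^bsub>opcmp Op n (d - e)\<^esub> \<delta> B" if B: "B \<in> carrier (opcmp Op n d)" for B
        using linear_mapD(2)[OF \<Phi>.hom_linear A B]
        by (simp add: \<Phi>_eq[OF A] \<Phi>_eq[OF B] \<Phi>_eq[OF Op.add_closed[OF A B]] E_ops)
    qed
  qed
qed

end

section \<open>Weight gradings and contractions\<close>

text \<open>A zero is homogeneous of every weight, because relations equate terms of various weights with zero.\<close>

inductive homogeneous :: "('g \<Rightarrow> nat) \<Rightarrow> nat \<Rightarrow> ('k, 'g) dgterm \<Rightarrow> bool" for \<omega> :: "'g \<Rightarrow> nat" where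
  "homogeneous \<omega> w (TZero n d)"
| "homogeneous \<omega> 0 TUnit"
| "homogeneous \<omega> (\<omega> x) (TGen x)"
| "homogeneous \<omega> w t \<Longrightarrow> homogeneous \<omega> w (TDiff t)"
| "\<lbrakk>homogeneous \<omega> w t; homogeneous \<omega> w u\<rbrakk> \<Longrightarrow> homogeneous \<omega> w (TAdd t u)"
| "homogeneous \<omega> w t \<Longrightarrow> homogeneous \<omega> w (TScale c t)"
| "\<lbrakk>homogeneous \<omega> w t; homogeneous \<omega> w' u\<rbrakk> \<Longrightarrow> homogeneous \<omega> (w + w') (TComp t i u)"
| "homogeneous \<omega> w t \<Longrightarrow> homogeneous \<omega> w (TAct t \<tau>)"

text \<open>Every summand of a term of positive weight contains a generator of positive weight.\<close>

lemma (in dg_operad) teval_positive_weight: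
  assumes v: "\<And>x. v x \<in> carrier (opcmp P (gen_arity \<Gamma> x) (gen_degree \<Gamma> x))"
    and v0: "\<And>x. 0 < \<omega> x \<Longrightarrow> v x = \<zero>\<^bsub>opcmp P (gen_arity \<Gamma> x) (gen_degree \<Gamma> x)\<^esub>"
  shows "\<lbrakk>homogeneous \<omega> w t; twf \<Gamma> t; 0 < w\<rbrakk> \<Longrightarrow> teval P \<Gamma> v t = \<zero>\<^bsub>opcmp P (tarity \<Gamma> t) (tdegree \<Gamma> t)\<^esub>"
proof (induction rule: homogeneous.induct)
  case (4 w t)
  then show ?case by (simp add: odiff_lin)
next
  case (7 w t w' u i)
  then have tu: "twf \<Gamma> t" "twf \<Gamma> u" and i: "1 \<le> i" "i \<le> tarity \<Gamma> t" by auto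
  from 7 consider "0 < w" | "0 < w'" by auto
  then show ?case
  proof cases
    case 1
    then show ?thesis using 7 tu pcomp_lin_left(4)[OF teval_closed[OF v tu(2)] i HOL.refl HOL.refl] by simp
  next
    case 2
    then show ?thesis using 7 tu pcomp_lin_right(4)[OF teval_closed[OF v tu(1)] i HOL.refl HOL.refl] by simp
  qed
qed (auto simp: v0 linear_simps act_lin same_type_def)

lemma teval_weight_0:
  assumes "\<And>x. \<omega> x = 0 \<Longrightarrow> v x = v' x"
  shows "\<lbrakk>homogeneous \<omega> w t; w = 0\<rbrakk> \<Longrightarrow> teval P \<Gamma> v t = teval P \<Gamma> v' t"
  by (induction rule: homogeneous.induct) (auto simp: assms)

locale weighted_presentation = wf_dg_presentation \<Gamma> for \<Gamma> :: "('k::field, 'g) dg_presentation" +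
  fixes \<omega> :: "'g \<Rightarrow> nat"
  assumes relations_homogeneous:
    "(t, u) \<in> relations \<Gamma> \<Longrightarrow> \<exists>w. homogeneous \<omega> w t \<and> homogeneous \<omega> w u"
begin

text \<open>Finite sums of homogeneous classes, in any order and with repetition of weights.\<close>

inductive_set hspan :: "nat \<Rightarrow> int \<Rightarrow> ('k, 'g) dgterm set set" for n d where
  zero: "\<zero>\<^bsub>opcmp Op n d\<^esub> \<in> hspan n d"
| add: "\<lbrakk>homogeneous \<omega> w t; t \<in> terms \<Gamma> n d; A \<in> hspan n d\<rbrakk> \<Longrightarrow> cl t \<oplus>\<^bsub>opcmp Op n d\<^esub> A \<in> hspan n d"

lemma hspan_closed: "A \<in> hspan n d \<Longrightarrow> A \<in> carrier (opcmp Op n d)"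
  by (induction rule: hspan.induct) (auto intro: Op.closed carrierI)

lemma hspan_homogeneous: "\<lbrakk>homogeneous \<omega> w t; t \<in> terms \<Gamma> n d\<rbrakk> \<Longrightarrow> cl t \<in> hspan n d"
  using hspan.add[OF _ _ hspan.zero, of w t n d] Op.add_zero_simps(1)[OF carrierI, of t n d] by simp

lemma hspan_add: "\<lbrakk>A \<in> hspan n d; B \<in> hspan n d\<rbrakk> \<Longrightarrow> A \<oplus>\<^bsub>opcmp Op n d\<^esub> B \<in> hspan n d"
proof (induction rule: hspan.induct)
  case zero
  then show ?case by (simp add: Op.add_zero_simps hspan_closed)
next
  case (add w t A)
  then show ?case
    using hspan.add[of w t n d "A \<oplus>\<^bsub>opcmp Op n d\<^esub> B"]
    by (simp add: Op.add_ac(2) carrierI hspan_closed)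
qed

lemma hspan_linear:
  assumes lin: "linear_map (opcmp Op n d) (opcmp Op n' d') F"
    and F: "\<And>w t. \<lbrakk>homogeneous \<omega> w t; t \<in> terms \<Gamma> n d\<rbrakk> \<Longrightarrow> F (cl t) \<in> hspan n' d'"
  shows "A \<in> hspan n d \<Longrightarrow> F A \<in> hspan n' d'"
proof (induction rule: hspan.induct)
  case zero
  then show ?case by (simp add: Op.linear_map_zero[OF lin] hspan.zero)
next
  case (add w t A)
  then show ?case by (simp add: linear_mapD(2)[OF lin carrierI hspan_closed] F hspan_add)
qed

text \<open>The operations are linear in each argument and send homogeneous terms to homogeneous terms.\<close>

lemma cl_hspan: "twf \<Gamma> t \<Longrightarrow> cl t \<in> hspan (tarity \<Gamma> t) (tdegree \<Gamma> t)"
proof (induction t)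
  case (TDiff t)
  have "odiff Op (cl t) \<in> hspan (tarity \<Gamma> t) (tdegree \<Gamma> t + 1)"
  proof (rule hspan_linear[OF Op.odiff_linear])
    fix w t' assume t': "homogeneous \<omega> w t'" "t' \<in> terms \<Gamma> (tarity \<Gamma> t) (tdegree \<Gamma> t)"
    show "odiff Op (cl t') \<in> hspan (tarity \<Gamma> t) (tdegree \<Gamma> t + 1)"
      unfolding odiff_cl[OF t'(2)]
      by (rule hspan_homogeneous[OF homogeneous.intros(4)[OF t'(1)] terms_intros(5)[OF t'(2)]])
  qed (use TDiff in simp)
  then show ?case using TDiff by (simp add: cl_ops)
next
  case (TAdd t u)
  then show ?case using hspan_add[of "cl t" "tarity \<Gamma> t" "tdegree \<Gamma> t" "cl u"] by (simp add: cl_ops same_type_def)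
next
  case (TScale c t)
  let ?M = "opcmp Op (tarity \<Gamma> t) (tdegree \<Gamma> t)"
  have lin: "linear_map ?M ?M (\<lambda>A. c \<odot>\<^bsub>?M\<^esub> A)"
    by (simp add: linear_map_def Op.linear_simps mult.commute)
  have "c \<odot>\<^bsub>?M\<^esub> cl t \<in> hspan (tarity \<Gamma> t) (tdegree \<Gamma> t)"
  proof (rule hspan_linear[OF lin])
    fix w t' assume t': "homogeneous \<omega> w t'" "t' \<in> terms \<Gamma> (tarity \<Gamma> t) (tdegree \<Gamma> t)"
    show "c \<odot>\<^bsub>?M\<^esub> cl t' \<in> hspan (tarity \<Gamma> t) (tdegree \<Gamma> t)"
      unfolding smult_cl[OF t'(2)]
      by (rule hspan_homogeneous[OF homogeneous.intros(6)[OF t'(1)] terms_intros(4)[OF t'(2)]])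
  qed (use TScale in simp)
  then show ?case using TScale by (simp add: cl_ops)
next
  case (TAct t \<tau>)
  then have \<tau>: "\<tau> permutes {1..tarity \<Gamma> t}" by simp
  have "act Op (cl t) \<tau> \<in> hspan (tarity \<Gamma> t) (tdegree \<Gamma> t)"
  proof (rule hspan_linear[OF Op.act_linear])
    fix w t' assume t': "homogeneous \<omega> w t'" "t' \<in> terms \<Gamma> (tarity \<Gamma> t) (tdegree \<Gamma> t)"
    show "act Op (cl t') \<tau> \<in> hspan (tarity \<Gamma> t) (tdegree \<Gamma> t)"
      unfolding act_cl[OF t'(2) \<tau>]
      by (rule hspan_homogeneous[OF homogeneous.intros(8)[OF t'(1)] terms_intros(6)[OF t'(2) \<tau>]])
  qed (use TAct in simp_all)
  then show ?case using TAct by (simp add: cl_ops)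
next
  case (TComp t i u)
  let ?m = "tarity \<Gamma> t" and ?a = "tdegree \<Gamma> t" and ?n = "tarity \<Gamma> u" and ?b = "tdegree \<Gamma> u"
  have i: "1 \<le> i" "i \<le> ?m" and tu: "twf \<Gamma> t" "twf \<Gamma> u" using TComp.prems by auto
  have "pcomp Op (cl t) i (cl u) \<in> hspan (?m + ?n - 1) (?a + ?b)"
  proof (rule hspan_linear[OF Op.pcomp_linear_left[OF cl_closed[OF tu(2)] i]])
    fix w t' assume t': "homogeneous \<omega> w t'" "t' \<in> terms \<Gamma> ?m ?a"
    show "pcomp Op (cl t') i (cl u) \<in> hspan (?m + ?n - 1) (?a + ?b)"
    proof (rule hspan_linear[OF Op.pcomp_linear_right[OF carrierI[OF t'(2)] i]])
      fix w' u' assume u': "homogeneous \<omega> w' u'" "u' \<in> terms \<Gamma> ?n ?b"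
      show "pcomp Op (cl t') i (cl u') \<in> hspan (?m + ?n - 1) (?a + ?b)"
        unfolding pcomp_cl[OF t'(2) u'(2) i]
        using hspan_homogeneous[OF homogeneous.intros(7)[OF t'(1) u'(1)] terms_intros(7)[OF t'(2) u'(2) i]] .
    qed (use TComp tu in blast)
  qed (use TComp tu in blast)
  then show ?case using cl_ops(6)[OF tu i] by simp
qed (auto intro!: hspan_homogeneous intro: homogeneous.intros simp: terms_def)

lemma carrier_hspan: "A \<in> carrier (opcmp Op n d) \<Longrightarrow> A \<in> hspan n d"
  using cl_hspan by (auto simp: terms_def elim!: carrierE)

lemma twisting_zero: "twisting_derivation Op 0 (\<lambda>n d _. \<zero>\<^bsub>opcmp Op n (d + 1)\<^esub>)"
proof (rule twisting_derivation.intro[OF dg_operad_Op twisting_derivation_axioms.intro], goal_cases)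
  case (1 n d)
  then show ?case by (simp add: linear_map_def Op.linear_simps)
next
  case (2 f n d \<tau>)
  then show ?case by (simp add: Op.act_lin)
next
  case (3 f n d)
  have "odiff Op \<zero>\<^bsub>opcmp Op n (d + 1)\<^esub> = \<zero>\<^bsub>opcmp Op n (d + 2)\<^esub>" by (rule Op.odiff_lin(3)) simp
  moreover have "d + 1 + 1 = d + 2" "d + 2 - 0 = d + 2" by simp_all
  ultimately show ?case using Op.zero_closed[of n "d + 2"] by (simp only: Op.linear_simps)
next
  case (4 f m a g n b i)
  have D: "a + b + 1 - 0 = a + 1 + b" "a + (b + 1) = a + 1 + b" "a + b + 1 = a + 1 + b" by simp_all
  show ?case
    unfolding Op.pcomp_lin_left(4)[OF 4(2-4) HOL.refl HOL.refl] Op.pcomp_lin_right(4)[OF 4(1,3,4) HOL.refl HOL.refl] D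
    by (simp add: Op.linear_simps)
qed

end

locale weight_operator = weighted_presentation \<Gamma> \<omega>
  for \<Gamma> :: "('k::field, 'g) dg_presentation" and \<omega> :: "'g \<Rightarrow> nat" +
  fixes W :: "('k, 'g) dgterm set \<Rightarrow> ('k, 'g) dgterm set"
  assumes W_linear: "linear_map (opcmp Op n d) (opcmp Op n d) W"
    and W_odiff: "A \<in> carrier (opcmp Op n d) \<Longrightarrow> W (odiff Op A) = odiff Op (W A)"
    and W_act: "\<lbrakk>A \<in> carrier (opcmp Op n d); \<tau> permutes {1..n}\<rbrakk> \<Longrightarrow> W (act Op A \<tau>) = act Op (W A) \<tau>"
    and W_pcomp: "\<lbrakk>A \<in> carrier (opcmp Op m a); B \<in> carrier (opcmp Op n b); 1 \<le> i; i \<le> m\<rbrakk>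
           \<Longrightarrow> W (pcomp Op A i B) = pcomp Op (W A) i B \<oplus>\<^bsub>opcmp Op (m + n - 1) (a + b)\<^esub> pcomp Op A i (W B)"
    and W_homogeneous: "\<lbrakk>homogeneous \<omega> w t; t \<in> terms \<Gamma> n d\<rbrakk> \<Longrightarrow> W (cl t) = of_nat w \<odot>\<^bsub>opcmp Op n d\<^esub> cl t"

text \<open>The untwisted derivation of degree 0 with \<open>x \<mapsto> \<omega> x \<cdot> x\<close> multiplies every homogeneous term by its
  weight. Both sides of a relation have the same weight and the same class, so it respects the relations.\<close>

lemma (in weighted_presentation) weight_operator_exists: obtains W where "weight_operator \<Gamma> \<omega> W"
proof -
  define v where "v x = of_nat (\<omega> x) \<odot>\<^bsub>opcmp Op (gen_arity \<Gamma> x) (gen_degree \<Gamma> x)\<^esub> cl (TGen x)" for x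
  let ?\<theta> = "\<lambda>n d (_ :: ('k, 'g) dgterm set). \<zero>\<^bsub>opcmp Op n (d + 1)\<^esub>"
  have v: "v x \<in> carrier (opcmp Op (gen_arity \<Gamma> x) (gen_degree \<Gamma> x - 0))" for x
    using Op.smult_simps(1)[OF cl_closed[of "TGen x"]] by (simp add: v_def)
  have wt: "\<lbrakk>homogeneous \<omega> w t; twf \<Gamma> t\<rbrakk>
    \<Longrightarrow> term_derivation \<Gamma> 0 ?\<theta> v t = of_nat w \<odot>\<^bsub>opcmp Op (tarity \<Gamma> t) (tdegree \<Gamma> t)\<^esub> cl t" for w t
  proof (induction rule: homogeneous.induct)
    case (1 w n d)
    show ?case using Op.smult_zero[where c = "of_nat w" and n = n and d = d] by (simp add: zero_cl)
  next
    case 2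
    show ?case using Op.smult_simps(5)[OF Op.ounit_closed] by (simp add: zero_cl unit_cl)
  next
    case (4 w t)
    have t: "twf \<Gamma> t" using 4 by simp
    have "odiff Op (of_nat w \<odot>\<^bsub>opcmp Op (tarity \<Gamma> t) (tdegree \<Gamma> t)\<^esub> cl t)
        = of_nat w \<odot>\<^bsub>opcmp Op (tarity \<Gamma> t) (tdegree \<Gamma> t + 1)\<^esub> cl (TDiff t)"
      using Op.odiff_lin(2)[OF HOL.refl cl_closed[OF t]] cl_ops(3)[OF t] by simp
    then show ?case
      using 4 t cl_closed[of "TDiff t"] by (simp add: ksign_simps Op.linear_simps)
  next
    case (5 w t u)
    then have tu: "twf \<Gamma> t" "twf \<Gamma> u" "same_type \<Gamma> t u" by auto
    have cu: "cl u \<in> carrier (opcmp Op (tarity \<Gamma> t) (tdegree \<Gamma> t))"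
      using cl_closed[OF tu(2)] tu(3) by (simp add: same_type_def)
    show ?case
      using 5 tu Op.smult_simps(6)[OF cl_closed[OF tu(1)] cu, of "of_nat w"] cl_ops(4)[OF tu]
      by (simp add: same_type_def)
  next
    case (6 w t c)
    then have t: "twf \<Gamma> t" by simp
    show ?case
      using 6 t cl_closed[OF t]
      by (simp add: cl_ops(5)[OF t, where c = c and n = "tarity \<Gamma> t" and d = "tdegree \<Gamma> t", symmetric]
          Op.smult_smult mult.commute)
  next
    case (7 w t w' u i)
    then have tu: "twf \<Gamma> t" "twf \<Gamma> u" and i: "1 \<le> i" "i \<le> tarity \<Gamma> t" by auto
    note c = cl_closed[OF tu(1)] cl_closed[OF tu(2)]
    note cc = Op.pcomp_closed[OF c i HOL.refl HOL.refl]
    show ?case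
      using 7 tu Op.pcomp_lin_left(2)[OF c(2) i HOL.refl HOL.refl c(1), of "of_nat w"]
        Op.pcomp_lin_right(2)[OF c(1) i HOL.refl HOL.refl c(2), of "of_nat w'"] cl_ops(6)[OF tu i]
        Op.smult_simps(2)[OF cc, of "of_nat w" "of_nat w'"] cc
      by (simp add: Let_def ksign_simps Op.linear_simps)
  next
    case (8 w t \<tau>)
    then have t: "twf \<Gamma> t" and \<tau>: "\<tau> permutes {1..tarity \<Gamma> t}" by auto
    show ?case
      using 8 Op.act_lin(2)[OF \<tau> cl_closed[OF t], of "of_nat w"] cl_ops(7)[OF t \<tau>] by simp
  qed (simp add: v_def)
  have rels: "term_derivation \<Gamma> 0 ?\<theta> v t = term_derivation \<Gamma> 0 ?\<theta> v u" if tu: "(t, u) \<in> relations \<Gamma>" for t u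
  proof -
    obtain w where "homogeneous \<omega> w t" "homogeneous \<omega> w u" using relations_homogeneous[OF tu] by blast
    then show ?thesis
      using wt typed[OF tcong.rel[OF tu]] cl_eq[OF tcong.rel[OF tu]] by (simp add: same_type_def)
  qed
  show thesis
  proof (rule derivation_exists[OF twisting_zero v rels], assumption)
    fix W
    assume W: "\<And>t. twf \<Gamma> t \<Longrightarrow> W (cl t) = term_derivation \<Gamma> 0 ?\<theta> v t"
      "\<And>n d. linear_map (opcmp Op n d) (opcmp Op n (d - 0)) W"
      "\<And>n d A. A \<in> Op.cmps n d \<Longrightarrow> W (odiff Op A) = \<zero>\<^bsub>opcmp Op n (d + 1)\<^esub>
          \<oplus>\<^bsub>opcmp Op n (d + 1 - 0)\<^esub> ksign 0 \<odot>\<^bsub>opcmp Op n (d + 1 - 0)\<^esub> odiff Op (W A)"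
      "\<And>n d A \<tau>. A \<in> Op.cmps n d \<Longrightarrow> \<tau> permutes {1..n} \<Longrightarrow> W (act Op A \<tau>) = act Op (W A) \<tau>"
      "\<And>m a A n b B i. \<lbrakk>A \<in> Op.cmps m a; B \<in> Op.cmps n b; 1 \<le> i; i \<le> m\<rbrakk>
         \<Longrightarrow> W (pcomp Op A i B) = pcomp Op (W A) i B \<oplus>\<^bsub>opcmp Op (m + n - 1) (a + b - 0)\<^esub>
           ksign (0 * a) \<odot>\<^bsub>opcmp Op (m + n - 1) (a + b - 0)\<^esub> pcomp Op A i (W B)"
    have lin: "linear_map (opcmp Op n d) (opcmp Op n d) W" for n d using W(2)[of n d] by simp
    note Wc = linear_mapD(1)[OF lin]
    show thesis
    proof (rule that, intro weight_operator.intro weight_operator_axioms.intro weighted_presentation_axioms lin)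
      show "W (odiff Op A) = odiff Op (W A)" if "A \<in> Op.cmps n d" for n d A
        using W(3)[OF that] Op.odiff_closed[OF Wc[OF that] HOL.refl] by (simp add: ksign_simps Op.linear_simps)
      show "W (pcomp Op A i B) = pcomp Op (W A) i B \<oplus>\<^bsub>opcmp Op (m + n - 1) (a + b)\<^esub> pcomp Op A i (W B)"
        if "A \<in> Op.cmps m a" "B \<in> Op.cmps n b" "1 \<le> i" "i \<le> m" for m a A n b B i
        using W(5)[OF that] Op.pcomp_closed[OF that(1) Wc[OF that(2)] that(3,4) HOL.refl HOL.refl]
        by (simp add: ksign_simps Op.linear_simps)
      show "W (cl t) = of_nat w \<odot>\<^bsub>opcmp Op n d\<^esub> cl t" if "homogeneous \<omega> w t" "t \<in> terms \<Gamma> n d" for w t n d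
        using that wt W(1) by (auto simp: terms_def)
    qed (rule lin, rule W(4))
  qed
qed

primrec diff_free :: "('k, 'g) dgterm \<Rightarrow> bool" where
  "diff_free (TZero n d) \<longleftrightarrow> True"
| "diff_free TUnit \<longleftrightarrow> True"
| "diff_free (TGen x) \<longleftrightarrow> True"
| "diff_free (TDiff t) \<longleftrightarrow> False"
| "diff_free (TAdd t u) \<longleftrightarrow> diff_free t \<and> diff_free u"
| "diff_free (TScale c t) \<longleftrightarrow> diff_free t"
| "diff_free (TComp t i u) \<longleftrightarrow> diff_free t \<and> diff_free u"
| "diff_free (TAct t \<tau>) \<longleftrightarrow> diff_free t"

text \<open>A twisted derivation that vanishes on the generators can only be nonzero on a term because of
  the twist, which enters through differentials.\<close>

lemma (in wf_dg_presentation) term_derivation_diff_free: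
  assumes v: "\<And>x. v x = \<zero>\<^bsub>opcmp Op (gen_arity \<Gamma> x) (gen_degree \<Gamma> x - e)\<^esub>"
  shows "\<lbrakk>diff_free t; twf \<Gamma> t\<rbrakk>
    \<Longrightarrow> term_derivation \<Gamma> e \<theta> v t = \<zero>\<^bsub>opcmp Op (tarity \<Gamma> t) (tdegree \<Gamma> t - e)\<^esub>"
proof (induction t)
  case (TComp t i u)
  then have tu: "twf \<Gamma> t" "twf \<Gamma> u" and i: "1 \<le> i" "i \<le> tarity \<Gamma> t" by auto
  note c = cl_closed[OF tu(1)] cl_closed[OF tu(2)]
  let ?D = "tdegree \<Gamma> t + tdegree \<Gamma> u - e"
  have "pcomp Op \<zero>\<^bsub>opcmp Op (tarity \<Gamma> t) (tdegree \<Gamma> t - e)\<^esub> i (cl u)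
      = \<zero>\<^bsub>opcmp Op (tarity \<Gamma> t + tarity \<Gamma> u - 1) ?D\<^esub>"
    and "pcomp Op (cl t) i \<zero>\<^bsub>opcmp Op (tarity \<Gamma> u) (tdegree \<Gamma> u - e)\<^esub>
      = \<zero>\<^bsub>opcmp Op (tarity \<Gamma> t + tarity \<Gamma> u - 1) ?D\<^esub>"
    by (rule Op.pcomp_lin_left(4)[OF c(2) i HOL.refl] Op.pcomp_lin_right(4)[OF c(1) i HOL.refl]; simp)+
  then show ?case using TComp tu by (simp add: Let_def Op.linear_simps)
qed (auto simp: v zero_cl[symmetric] Op.linear_simps Op.act_lin same_type_def)

context weight_operator
begin

lemmas W_closed = linear_mapD(1)[OF W_linear]

text \<open>Since \<open>W\<close> is a derivation of degree 0 commuting with \<open>d\<close>, it may twist an extension with \<open>e = 1\<close>.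
  The resulting derivations \<open>h\<close> satisfy \<open>h d = W - d h\<close>.\<close>

lemma twisting_weight_operator: "twisting_derivation Op 1 (\<lambda>_ _. W)"
proof (rule twisting_derivation.intro[OF dg_operad_Op twisting_derivation_axioms.intro], goal_cases)
  case (1 n d)
  show ?case using W_linear[of n d] by simp
next
  case (2 f n d \<tau>)
  then show ?case by (rule W_act)
next
  case (3 f n d)
  have "odiff Op (W f) \<in> Op.cmps n (d + 2 - 1)" by (rule Op.odiff_closed[OF W_closed[OF 3]]) simp
  then show ?case using Op.add_zero_simps(3) by (simp only: W_odiff[OF 3] ksign_simps)
next
  case (4 f m a g n b i)
  have "pcomp Op f i (W g) \<in> Op.cmps (m + n - 1) (a + b)"
    by (rule Op.pcomp_closed[OF 4(1) W_closed[OF 4(2)] 4(3,4) HOL.refl HOL.refl])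
  moreover have "ksign (a * (1 + 1)) = (1::'k)" by (simp add: ksign_def)
  moreover have "a + b + 1 - 1 = a + b" by simp
  ultimately show ?case by (simp only: W_pcomp[OF 4] Op.smult_simps)
qed

text \<open>Sums of \<open>k\<close> eigenvectors of \<open>W\<close> with nonzero eigenvalues. The number of summands is recorded for the
  induction in \<open>eigensum_cocycle\<close>.\<close>

inductive eigensum :: "nat \<Rightarrow> int \<Rightarrow> nat \<Rightarrow> ('k, 'g) dgterm set \<Rightarrow> bool" for n d where
  zero: "eigensum n d 0 \<zero>\<^bsub>opcmp Op n d\<^esub>"
| add: "\<lbrakk>eigensum n d k A; B \<in> carrier (opcmp Op n d); W B = c \<odot>\<^bsub>opcmp Op n d\<^esub> B; c \<noteq> 0\<rbrakk>
    \<Longrightarrow> eigensum n d (Suc k) (B \<oplus>\<^bsub>opcmp Op n d\<^esub> A)"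

lemma eigensum_closed: "eigensum n d k A \<Longrightarrow> A \<in> carrier (opcmp Op n d)"
  by (induction rule: eigensum.induct) (auto intro: Op.closed)

text \<open>An eigenvector for \<open>b\<close> is sent by \<open>W + c\<close> to a multiple of itself, which is still an eigenvector for \<open>b\<close>.\<close>

lemma eigensum_shift:
  "eigensum n d k A \<Longrightarrow> eigensum n d k (W A \<oplus>\<^bsub>opcmp Op n d\<^esub> c \<odot>\<^bsub>opcmp Op n d\<^esub> A)"
proof (induction rule: eigensum.induct)
  case zero
  have "W \<zero>\<^bsub>opcmp Op n d\<^esub> \<oplus>\<^bsub>opcmp Op n d\<^esub> c \<odot>\<^bsub>opcmp Op n d\<^esub> \<zero>\<^bsub>opcmp Op n d\<^esub> = \<zero>\<^bsub>opcmp Op n d\<^esub>"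
    by (simp add: Op.linear_map_zero[OF W_linear] Op.linear_simps)
  then show ?case using eigensum.zero by simp
next
  case (add k A B b)
  note A = eigensum_closed[OF add.hyps(1)] and B = add.hyps(2)
  note WA = W_closed[OF A]
  have "W ((b + c) \<odot>\<^bsub>opcmp Op n d\<^esub> B) = b \<odot>\<^bsub>opcmp Op n d\<^esub> ((b + c) \<odot>\<^bsub>opcmp Op n d\<^esub> B)"
    using linear_mapD(3)[OF W_linear B, of "b + c"] add.hyps(3) B by (simp add: Op.smult_smult mult.commute)
  then have "eigensum n d (Suc k) ((b + c) \<odot>\<^bsub>opcmp Op n d\<^esub> B
      \<oplus>\<^bsub>opcmp Op n d\<^esub> (W A \<oplus>\<^bsub>opcmp Op n d\<^esub> c \<odot>\<^bsub>opcmp Op n d\<^esub> A))"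
    using add B by (intro eigensum.add) (auto intro: Op.closed)
  also have "(b + c) \<odot>\<^bsub>opcmp Op n d\<^esub> B \<oplus>\<^bsub>opcmp Op n d\<^esub> (W A \<oplus>\<^bsub>opcmp Op n d\<^esub> c \<odot>\<^bsub>opcmp Op n d\<^esub> A)
      = W (B \<oplus>\<^bsub>opcmp Op n d\<^esub> A) \<oplus>\<^bsub>opcmp Op n d\<^esub> c \<odot>\<^bsub>opcmp Op n d\<^esub> (B \<oplus>\<^bsub>opcmp Op n d\<^esub> A)"
    unfolding linear_mapD(2)[OF W_linear B A] add.hyps(3)
    using A B WA by (simp add: Op.smult_simps(2) Op.linear_simps)
  finally show ?case .
qed

end

text \<open>A homotopy \<open>h\<close> from \<open>W\<close> to zero.\<close>

locale contracted_presentation = weight_operator \<Gamma> \<omega> W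
  for \<Gamma> :: "('k::field, 'g) dg_presentation" and \<omega> W +
  fixes h :: "('k, 'g) dgterm set \<Rightarrow> ('k, 'g) dgterm set"
  assumes h_linear: "linear_map (opcmp Op n d) (opcmp Op n (d - 1)) h"
    and h_odiff: "A \<in> carrier (opcmp Op n d) \<Longrightarrow> h (odiff Op A) = W A \<oplus>\<^bsub>opcmp Op n d\<^esub> (- 1) \<odot>\<^bsub>opcmp Op n d\<^esub> odiff Op (h A)"
begin

lemma W_cocycle:
  assumes "A \<in> cocycles Op n d"
  shows "W A = odiff Op (h A)"
proof -
  from assms have A: "A \<in> carrier (opcmp Op n d)" and dA: "odiff Op A = \<zero>\<^bsub>opcmp Op n (d + 1)\<^esub>"
    by (auto simp: cocycles_def)
  have dh: "odiff Op (h A) \<in> carrier (opcmp Op n d)"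
    by (rule Op.odiff_closed[OF linear_mapD(1)[OF h_linear A]]) simp
  have "h (odiff Op A) = \<zero>\<^bsub>opcmp Op n (d + 1 - 1)\<^esub>"
    unfolding dA
    using linear_mapD(3)[OF h_linear Op.zero_closed[of n "d + 1"], of 0]
      linear_mapD(1)[OF h_linear Op.zero_closed[of n "d + 1"]]
    by (simp add: Op.smult_simps(5) Op.zero_closed)
  then have 0: "W A \<oplus>\<^bsub>opcmp Op n d\<^esub> (- 1) \<odot>\<^bsub>opcmp Op n d\<^esub> odiff Op (h A) = \<zero>\<^bsub>opcmp Op n d\<^esub>"
    using h_odiff[OF A] by simp
  have "W A = (W A \<oplus>\<^bsub>opcmp Op n d\<^esub> (- 1) \<odot>\<^bsub>opcmp Op n d\<^esub> odiff Op (h A)) \<oplus>\<^bsub>opcmp Op n d\<^esub> odiff Op (h A)"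
    using W_closed[OF A] dh by (simp add: Op.add_ac(2) Op.add_zero_simps Op.smult_simps(1))
  then show ?thesis unfolding 0 using dh by (simp add: Op.add_zero_simps)
qed

text \<open>Let \<open>A\<close> be a cocycle and a sum of \<open>k + 1\<close> eigenvectors, one of them with eigenvalue \<open>c\<close>. Then
  \<open>(W - c) A\<close> is a cocycle and a sum of \<open>k\<close> eigenvectors, hence a coboundary \<open>d p\<close> by induction.
  As \<open>W A = d (h A)\<close>, the element \<open>c A = d (h A - p)\<close> is a coboundary, and \<open>c\<close> is invertible.\<close>

lemma eigensum_cocycle:
  "\<lbrakk>eigensum n d k A; A \<in> cocycles Op n d\<rbrakk> \<Longrightarrow> A \<in> coboundaries Op n d"
proof (induction k arbitrary: A)
  case 0
  then have A: "A = \<zero>\<^bsub>opcmp Op n d\<^esub>" by (auto elim: eigensum.cases)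
  have "odiff Op \<zero>\<^bsub>opcmp Op n (d - 1)\<^esub> = \<zero>\<^bsub>opcmp Op n d\<^esub>" by (rule Op.odiff_lin(3)) simp
  then show ?case unfolding A coboundaries_def using Op.zero_closed[of n "d - 1"] by force
next
  case (Suc k)
  from Suc.prems(1) obtain A' B c where AB: "A = B \<oplus>\<^bsub>opcmp Op n d\<^esub> A'" and A': "eigensum n d k A'"
    and B: "B \<in> carrier (opcmp Op n d)" and WB: "W B = c \<odot>\<^bsub>opcmp Op n d\<^esub> B" and c: "c \<noteq> 0"
    by (auto elim: eigensum.cases)
  note A'c = eigensum_closed[OF A']
  have A: "A \<in> carrier (opcmp Op n d)" and dA: "odiff Op A = \<zero>\<^bsub>opcmp Op n (d + 1)\<^esub>"
    using Suc.prems(2) by (auto simp: cocycles_def)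
  define Z where "Z = W A \<oplus>\<^bsub>opcmp Op n d\<^esub> (- c) \<odot>\<^bsub>opcmp Op n d\<^esub> A"
  have Z_eq: "Z = W A' \<oplus>\<^bsub>opcmp Op n d\<^esub> (- c) \<odot>\<^bsub>opcmp Op n d\<^esub> A'"
  proof -
    have "c \<odot>\<^bsub>opcmp Op n d\<^esub> B \<oplus>\<^bsub>opcmp Op n d\<^esub> (- c) \<odot>\<^bsub>opcmp Op n d\<^esub> B = \<zero>\<^bsub>opcmp Op n d\<^esub>"
      using Op.smult_simps(2)[OF B, of c "- c"] Op.smult_simps(5)[OF B] by simp
    moreover have "Z = (c \<odot>\<^bsub>opcmp Op n d\<^esub> B \<oplus>\<^bsub>opcmp Op n d\<^esub> (- c) \<odot>\<^bsub>opcmp Op n d\<^esub> B)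
        \<oplus>\<^bsub>opcmp Op n d\<^esub> (W A' \<oplus>\<^bsub>opcmp Op n d\<^esub> (- c) \<odot>\<^bsub>opcmp Op n d\<^esub> A')"
      unfolding Z_def AB linear_mapD(2)[OF W_linear B A'c] WB
      using B A'c W_closed[OF A'c] by (simp add: Op.linear_simps)
    ultimately show ?thesis
      using W_closed[OF A'c] A'c by (simp add: Op.linear_simps)
  qed
  have "eigensum n d k Z" unfolding Z_eq by (rule eigensum_shift[OF A'])
  moreover have "Z \<in> cocycles Op n d"
  proof -
    have "odiff Op (W A) = \<zero>\<^bsub>opcmp Op n (d + 1)\<^esub>"
      by (simp add: W_odiff[OF A, symmetric] dA Op.linear_map_zero[OF W_linear])
    then show ?thesis
      using W_closed[OF A] A by (simp add: cocycles_def Z_def Op.odiff_lin dA Op.linear_simps)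
  qed
  ultimately have "Z \<in> coboundaries Op n d" by (rule Suc.IH)
  then obtain p where p: "p \<in> carrier (opcmp Op n (d - 1))" and Zp: "Z = odiff Op p"
    by (auto simp: coboundaries_def)
  note hA = linear_mapD(1)[OF h_linear A]
  define q where "q = (1 / c) \<odot>\<^bsub>opcmp Op n (d - 1)\<^esub> (h A \<oplus>\<^bsub>opcmp Op n (d - 1)\<^esub> (- 1) \<odot>\<^bsub>opcmp Op n (d - 1)\<^esub> p)"
  have q: "q \<in> carrier (opcmp Op n (d - 1))" using hA p by (simp add: q_def Op.closed)
  have "odiff Op q = (1 / c) \<odot>\<^bsub>opcmp Op n d\<^esub> (odiff Op (h A) \<oplus>\<^bsub>opcmp Op n d\<^esub> (- 1) \<odot>\<^bsub>opcmp Op n d\<^esub> odiff Op p)"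
    using hA p by (simp add: q_def Op.odiff_lin[of d "d - 1"] Op.closed)
  also have "odiff Op (h A) = W A" by (rule W_cocycle[OF Suc.prems(2), symmetric])
  also have "W A \<oplus>\<^bsub>opcmp Op n d\<^esub> (- 1) \<odot>\<^bsub>opcmp Op n d\<^esub> odiff Op p
      = (W A \<oplus>\<^bsub>opcmp Op n d\<^esub> (- 1) \<odot>\<^bsub>opcmp Op n d\<^esub> W A) \<oplus>\<^bsub>opcmp Op n d\<^esub> c \<odot>\<^bsub>opcmp Op n d\<^esub> A"
    unfolding Zp[symmetric] Z_def using W_closed[OF A] A
    by (simp add: Op.linear_simps del: Op.add_zero_simps(3))
  also have "\<dots> = c \<odot>\<^bsub>opcmp Op n d\<^esub> A"
    using W_closed[OF A] A by (simp add: Op.linear_simps)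
  also have "(1 / c) \<odot>\<^bsub>opcmp Op n d\<^esub> (c \<odot>\<^bsub>opcmp Op n d\<^esub> A) = A"
    using c A by (simp add: Op.linear_simps)
  finally show ?case using q by (auto simp: coboundaries_def)
qed

text \<open>The endomorphism \<open>\<rho>\<close> is the projection to weight 0: it fixes the terms of weight 0 and kills those of
  positive weight. Thus \<open>A - \<rho> A\<close> is a sum of eigenvectors of \<open>W\<close> with positive integers as eigenvalues,
  which are nonzero in characteristic zero.\<close>

theorem cocycle_cohomologous_to_weight_0_part:
  assumes char: "\<And>w. 0 < w \<Longrightarrow> of_nat w \<noteq> (0::'k)"
    and \<rho>: "dg_operad_hom Op Op \<rho>"
    and \<rho>_pos: "\<And>x. 0 < \<omega> x \<Longrightarrow> \<rho> (cl (TGen x)) = \<zero>\<^bsub>opcmp Op (gen_arity \<Gamma> x) (gen_degree \<Gamma> x)\<^esub>"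
    and \<rho>_0: "\<And>x. \<omega> x = 0 \<Longrightarrow> \<rho> (cl (TGen x)) = cl (TGen x)"
    and A: "A \<in> cocycles Op n d"
  shows "A \<oplus>\<^bsub>opcmp Op n d\<^esub> (- 1) \<odot>\<^bsub>opcmp Op n d\<^esub> \<rho> A \<in> coboundaries Op n d"
proof -
  interpret \<rho>: dg_operad_hom Op Op \<rho> by fact
  let ?D = "\<lambda>A. A \<oplus>\<^bsub>opcmp Op n d\<^esub> (- 1) \<odot>\<^bsub>opcmp Op n d\<^esub> \<rho> A"
  note \<rho>c = linear_mapD(1)[OF \<rho>.hom_linear]
  have "\<exists>k. eigensum n d k (?D B)" if "B \<in> hspan n d" for B
    using that
  proof (induction rule: hspan.induct)
    case zero
    show ?case using eigensum.zero by (auto simp: \<rho>.hom_zero Op.linear_simps)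
  next
    case (add w t B)
    then obtain k where k: "eigensum n d k (?D B)" by blast
    have t: "twf \<Gamma> t" "tarity \<Gamma> t = n" "tdegree \<Gamma> t = d" using add.hyps(2) by (auto simp: terms_def)
    note ct = carrierI[OF add.hyps(2)] and B = hspan_closed[OF add.hyps(3)]
    have split: "?D (cl t \<oplus>\<^bsub>opcmp Op n d\<^esub> B) = ?D (cl t) \<oplus>\<^bsub>opcmp Op n d\<^esub> ?D B"
      unfolding linear_mapD(2)[OF \<rho>.hom_linear ct B]
      using ct B \<rho>c[OF ct] \<rho>c[OF B] by (simp add: Op.linear_simps)
    have \<rho>t: "\<rho> (cl t) = teval Op \<Gamma> (\<lambda>x. \<rho> (cl (TGen x))) t"
      by (rule hom_cl[OF \<rho> HOL.refl t(1)])
    show ?case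
    proof (cases "w = 0")
      case True
      have "\<rho> (cl t) = cl t"
        unfolding \<rho>t using teval_weight_0[OF \<rho>_0 add.hyps(1) True, where P = Op and \<Gamma> = \<Gamma>] teval_Op[OF t(1)] by simp
      then have "?D (cl t \<oplus>\<^bsub>opcmp Op n d\<^esub> B) = ?D B"
        unfolding split using ct eigensum_closed[OF k] by (simp add: Op.linear_simps)
      then show ?thesis using k by auto
    next
      case False
      have "\<rho> (cl (TGen x)) \<in> carrier (opcmp Op (gen_arity \<Gamma> x) (gen_degree \<Gamma> x))" for x
        using \<rho>c[OF cl_closed[of "TGen x"]] by simp
      then have "\<rho> (cl t) = \<zero>\<^bsub>opcmp Op n d\<^esub>"
        unfolding \<rho>t using Op.teval_positive_weight[OF _ \<rho>_pos add.hyps(1) t(1)] False t(2,3) by blast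
      then have "?D (cl t \<oplus>\<^bsub>opcmp Op n d\<^esub> B) = cl t \<oplus>\<^bsub>opcmp Op n d\<^esub> ?D B"
        unfolding split using ct by (simp add: Op.linear_simps)
      then show ?thesis
        using eigensum.add[OF k ct W_homogeneous[OF add.hyps(1,2)] char] False by auto
    qed
  qed
  then obtain k where k: "eigensum n d k (?D A)"
    using carrier_hspan A unfolding cocycles_def by blast
  have c: "A \<in> carrier (opcmp Op n d)" "odiff Op A = \<zero>\<^bsub>opcmp Op n (d + 1)\<^esub>"
    using A by (auto simp: cocycles_def)
  have "?D A \<in> cocycles Op n d"
    using c \<rho>c[OF c(1)] \<rho>.hom_odiff[OF c(1), symmetric]
    by (simp add: cocycles_def Op.odiff_lin \<rho>.hom_zero Op.linear_simps)
  with k show ?thesis by (rule eigensum_cocycle)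
qed

end

section \<open>The Jacobi operad\<close>

definition jacobi_weight :: "jacobi_gen \<Rightarrow> nat" where
  "jacobi_weight x = (case x of JMu \<Rightarrow> 0 | JI \<Rightarrow> 1 | JJ \<Rightarrow> 1)"

lemma jacobi_weight_simps [simp]: "jacobi_weight JMu = 0" "jacobi_weight JI = 1" "jacobi_weight JJ = 1"
  by (simp_all add: jacobi_weight_def)

lemma jacobi_gen_simps [simp]:
  "gen_arity jacobi_presentation JMu = 2" "gen_arity jacobi_presentation JI = 1"
  "gen_arity jacobi_presentation JJ = 1" "gen_degree jacobi_presentation JMu = 0"
  "gen_degree jacobi_presentation JI = - 2" "gen_degree jacobi_presentation JJ = - 1"
  by (simp_all add: jacobi_presentation_def)

lemma comm_gen_simps [simp]:
  "gen_arity comm_presentation x = 2" "gen_degree comm_presentation x = 0"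
  by (simp_all add: comm_presentation_def)

lemma homogeneous_tsum: "(\<And>t. t \<in> set ts \<Longrightarrow> homogeneous \<omega> w t) \<Longrightarrow> homogeneous \<omega> w (tsum n d ts)"
  by (induction ts) (auto simp: tsum_def intro: homogeneous.intros)

lemma homogeneous_comp: "\<lbrakk>homogeneous \<omega> a t; homogeneous \<omega> b u; w = a + b\<rbrakk> \<Longrightarrow> homogeneous \<omega> w (TComp t i u)"
  by (simp add: homogeneous.intros)

lemma homogeneous_gen: "w = \<omega> x \<Longrightarrow> homogeneous \<omega> w (TGen x)"
  by (simp add: homogeneous.intros)

lemma homogeneous_mu_iter: "homogeneous \<omega> 0 M \<Longrightarrow> homogeneous \<omega> 0 (mu_iter M m)"
  by (induction M m rule: mu_iter.induct) (auto intro: homogeneous.intros homogeneous_comp)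

text \<open>Homogeneity and the absence of differentials can be read off the common shape of the summands.\<close>

lemma do_relation_summands:
  assumes "(t, u) \<in> do_relation M D d n"
  obtains ts where "t = tsum (n + 1) d ts" and "u = TZero (n + 1) d"
    and "\<And>x. x \<in> set ts
      \<Longrightarrow> \<exists>c m p \<tau>. x = TScale c (TAct (TComp (mu_iter M m) 1 (TComp D 1 (mu_iter M p))) \<tau>)"
proof -
  obtain e where t: "t = tsum (n + 1) d (concat (map (\<lambda>p. map (\<lambda>\<sigma>. TScale ((- 1) ^ p)
       (TAct (TComp (mu_iter M (n + 1 - p + 1)) 1 (TComp D 1 (mu_iter M p))) (inv_into UNIV \<sigma>)))
     (e p)) [1..<n + 2]))" and u: "u = TZero (n + 1) d"
    using assms unfolding do_relation_def by blast
  show thesis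
    by (rule that[OF t u]) (auto simp only: set_concat set_map elim!: UN_E imageE, intro exI, rule HOL.refl)
qed

lemma homogeneous_do_relation:
  assumes M: "homogeneous \<omega> 0 M" and D: "homogeneous \<omega> w D" and tu: "(t, u) \<in> do_relation M D d n"
  shows "homogeneous \<omega> w t \<and> homogeneous \<omega> w u"
proof -
  have sm: "homogeneous \<omega> w (TComp (mu_iter M m) 1 (TComp D 1 (mu_iter M p)))" for m p
    by (rule homogeneous_comp[OF homogeneous_mu_iter[OF M] homogeneous_comp[OF D homogeneous_mu_iter[OF M] HOL.refl]])
      simp
  from tu obtain ts where t: "t = tsum (n + 1) d ts" and u: "u = TZero (n + 1) d"
    and ts: "\<And>x. x \<in> set ts
      \<Longrightarrow> \<exists>c m p \<tau>. x = TScale c (TAct (TComp (mu_iter M m) 1 (TComp D 1 (mu_iter M p))) \<tau>)"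
    by (rule do_relation_summands) blast
  have "homogeneous \<omega> w x" if "x \<in> set ts" for x
    using ts[OF that] homogeneous.intros(6)[OF homogeneous.intros(8)[OF sm]] by blast
  then show ?thesis unfolding t u by (blast intro: homogeneous_tsum homogeneous.intros(1))
qed

lemma diff_free_tsum: "diff_free (tsum n d ts) \<longleftrightarrow> (\<forall>t\<in>set ts. diff_free t)"
  by (induction ts) (auto simp: tsum_def)

lemma diff_free_mu_iter: "diff_free M \<Longrightarrow> diff_free (mu_iter M m)"
  by (induction M m rule: mu_iter.induct) auto

lemma diff_free_do_relation:
  assumes M: "diff_free M" and D: "diff_free D" and tu: "(t, u) \<in> do_relation M D d n"
  shows "diff_free t \<and> diff_free u"
proof -
  from tu obtain ts where t: "t = tsum (n + 1) d ts" and u: "u = TZero (n + 1) d"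
    and ts: "\<And>x. x \<in> set ts
      \<Longrightarrow> \<exists>c m p \<tau>. x = TScale c (TAct (TComp (mu_iter M m) 1 (TComp D 1 (mu_iter M p))) \<tau>)"
    by (rule do_relation_summands) blast
  show ?thesis unfolding t u using ts M D diff_free_mu_iter[OF M] by (fastforce simp: diff_free_tsum)
qed

text \<open>The relations of the commutative operad, for a generator \<open>x\<close> in the role of \<open>\<mu>\<close>. They occur in both
  presentations.\<close>

definition comm_relations :: "'g \<Rightarrow> (('k, 'g) dgterm \<times> ('k, 'g) dgterm) set" where
  "comm_relations x = {(TDiff (TGen x), TZero 2 1), (TAct (TGen x) (transpose 1 2), TGen x),
     (TComp (TGen x) 1 (TGen x), TComp (TGen x) 2 (TGen x))}"

lemma relations_comm: "relations comm_presentation = comm_relations CMu"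
  by (simp add: comm_presentation_def comm_relations_def Let_def)

lemma jacobi_relation_cases:
  assumes "(t, u) \<in> relations (jacobi_presentation :: ('k::field, jacobi_gen) dg_presentation)"
  obtains (comm) "(t, u) \<in> comm_relations JMu"
  | (i_di) "t = TComp (TGen JI) 1 (TDiff (TGen JI))"
      "u = TAdd (TComp (TDiff (TGen JI)) 1 (TGen JI)) (TScale 2 (TComp (TGen JJ) 1 (TGen JI)))"
  | (i_j) "t = TComp (TGen JI) 1 (TGen JJ)" "u = TComp (TGen JJ) 1 (TGen JI)"
  | (di_j) "t = TAdd (TComp (TDiff (TGen JI)) 1 (TGen JJ)) (TComp (TGen JJ) 1 (TDiff (TGen JI)))" "u = TZero 1 (- 2)"
  | (j_j) "t = TComp (TGen JJ) 1 (TGen JJ)" "u = TZero 1 (- 2)"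
  | (do_j) "(t, u) \<in> do_relation (TGen JMu) (TGen JJ) (- 1) 1"
  | (do_i) "(t, u) \<in> do_relation (TGen JMu) (TGen JI) (- 2) 2"
  using assms by (auto simp: jacobi_presentation_def comm_relations_def Let_def)

text \<open>The relations of weight 0 are those of the commutative operad. This is also what makes the retraction
  to it well defined, since an evaluation at \<open>i = j = 0\<close> kills both sides of all other relations.\<close>

lemma jacobi_relation_weight:
  assumes "(t, u) \<in> relations (jacobi_presentation :: ('k::field, jacobi_gen) dg_presentation)"
  shows "(t, u) \<in> comm_relations JMu \<and> homogeneous jacobi_weight 0 t \<and> homogeneous jacobi_weight 0 u
    \<or> (\<exists>w>0. homogeneous jacobi_weight w t \<and> homogeneous jacobi_weight w u)"
proof -
  have g: "homogeneous jacobi_weight 0 (TGen JMu)" "homogeneous jacobi_weight 1 (TGen JI)"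
    "homogeneous jacobi_weight 1 (TGen JJ)" "homogeneous jacobi_weight 1 (TDiff (TGen JI))"
    by (auto intro!: homogeneous_gen homogeneous.intros(4))
  have c: "homogeneous jacobi_weight 2 (TComp x i y)"
    if "homogeneous jacobi_weight 1 x" "homogeneous jacobi_weight 1 y" for x y :: "('k, jacobi_gen) dgterm" and i
    by (rule homogeneous_comp[OF that]) simp
  have two: ?thesis if "homogeneous jacobi_weight 2 t" "homogeneous jacobi_weight 2 u"
    using that by (intro disjI2 exI[of _ 2]) simp
  have mm: "homogeneous jacobi_weight 0 (TComp (TGen JMu) i (TGen JMu))" for i
    by (rule homogeneous_comp[OF g(1) g(1)]) simp
  show ?thesis
    using assms
  proof (cases rule: jacobi_relation_cases)
    case comm
    have "homogeneous jacobi_weight 0 t \<and> homogeneous jacobi_weight 0 u"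
      using comm g(1) mm homogeneous.intros(1,4,8) unfolding comm_relations_def by fast
    then show ?thesis using comm by blast
  next
    case i_di
    show ?thesis
      unfolding i_di
      by (rule two[unfolded i_di]) (intro c homogeneous.intros(5,6) g)+
  next
    case i_j
    show ?thesis unfolding i_j by (rule two[unfolded i_j]) (intro c g)+
  next
    case di_j
    show ?thesis unfolding di_j by (rule two[unfolded di_j]) (intro c homogeneous.intros(1,5) g)+
  next
    case j_j
    show ?thesis unfolding j_j by (rule two[unfolded j_j]) (intro c homogeneous.intros(1) g)+
  next
    case do_j
    then show ?thesis using homogeneous_do_relation[OF g(1,3)] by blast
  next
    case do_i
    then show ?thesis using homogeneous_do_relation[OF g(1,2)] by blast
  qed
qed

lemma weighted_jacobi: "weighted_presentation (jacobi_presentation :: ('k::field, jacobi_gen) dg_presentation) jacobi_weight"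
  using jacobi_relation_weight
  by (intro weighted_presentation.intro wf_dg_presentation.intro wf_jacobi_presentation
      weighted_presentation_axioms.intro) blast

text \<open>The evaluations that send \<open>\<mu>\<close> to \<open>\<mu>\<close> respect the relations of the commutative operad. This serves for the
  inclusion of the commutative operad into the Jacobi operad as well as for the retraction.\<close>

lemma comm_relations_hold:
  assumes "\<And>t u. (t, u) \<in> comm_relations x \<Longrightarrow> (t, u) \<in> relations (\<Gamma> :: ('k::field, 'g) dg_presentation)"
    and wf: "wf_presentation \<Gamma>" and x: "gen_arity \<Gamma> x = 2" "gen_degree \<Gamma> x = 0"
    and v: "v y = tclass \<Gamma> (TGen x)"
    and tu: "(t, u) \<in> comm_relations y"
  shows "teval (presented_operad \<Gamma>) \<Gamma>' v t = teval (presented_operad \<Gamma>) \<Gamma>' v u"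
proof -
  interpret wf_dg_presentation \<Gamma> by (rule wf_dg_presentation.intro) fact
  have \<tau>: "transpose 1 2 permutes {1..tarity \<Gamma> (TGen x)}" by (auto simp: x intro!: permutes_swap_id)
  have eq: "cl t' = cl u'" if "(t', u') \<in> comm_relations x" for t' u'
    by (intro cl_eq tcong.rel assms(1) that)
  have g: "twf \<Gamma> (TGen x)" by simp
  from tu consider "t = TDiff (TGen y)" "u = TZero 2 1" | "t = TAct (TGen y) (transpose 1 2)" "u = TGen y"
    | "t = TComp (TGen y) 1 (TGen y)" "u = TComp (TGen y) 2 (TGen y)"
    by (auto simp: comm_relations_def)
  then show ?thesis
  proof cases
    case 1
    then show ?thesis using eq[of "TDiff (TGen x)" "TZero 2 1"] cl_ops(3)[OF g] v
      by (simp add: comm_relations_def zero_cl)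
  next
    case 2
    then show ?thesis using eq[of "TAct (TGen x) (transpose 1 2)" "TGen x"] cl_ops(7)[OF g \<tau>] v
      by (simp add: comm_relations_def)
  next
    case 3
    then show ?thesis
      using eq[of "TComp (TGen x) 1 (TGen x)" "TComp (TGen x) 2 (TGen x)"] cl_ops(6)[OF g g, of 1] cl_ops(6)[OF g g, of 2] v
      by (simp add: comm_relations_def x)
  qed
qed

text \<open>The derivation twisted by \<open>W\<close> that vanishes on the generators sends \<open>dx\<close> to \<open>W x\<close>, that is, \<open>d\<mu>\<close> to 0,
  \<open>di\<close> to \<open>i\<close> and \<open>dj\<close> to \<open>j\<close>. The relations without a differential are killed termwise.
  Both sides of \<open>i di = di i + 2 j i\<close> are sent to \<open>i i\<close>, as \<open>h\<close> passes \<open>i\<close> without a sign.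
  Since \<open>h\<close> passes \<open>j\<close> with a sign, \<open>di j + j di\<close> is sent to \<open>i j - j i\<close>, which
  vanishes by the relation \<open>i j = j i\<close>.\<close>

lemma jacobi_contraction:
  assumes "weight_operator (jacobi_presentation :: ('k::field, jacobi_gen) dg_presentation) jacobi_weight W"
  obtains h where "contracted_presentation (jacobi_presentation :: ('k, jacobi_gen) dg_presentation) jacobi_weight W h"
proof -
  let ?\<Gamma> = "jacobi_presentation :: ('k, jacobi_gen) dg_presentation"
  interpret weight_operator ?\<Gamma> jacobi_weight W by fact
  define v where "v x = \<zero>\<^bsub>opcmp Op (gen_arity ?\<Gamma> x) (gen_degree ?\<Gamma> x - 1)\<^esub>" for x
  define h0 where "h0 = term_derivation ?\<Gamma> 1 (\<lambda>_ _. W) v"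
  have v: "v x \<in> carrier (opcmp Op (gen_arity ?\<Gamma> x) (gen_degree ?\<Gamma> x - 1))" for x
    unfolding v_def by (rule Op.zero_closed)
  have free: "h0 t = \<zero>\<^bsub>opcmp Op (tarity ?\<Gamma> t) (tdegree ?\<Gamma> t - 1)\<^esub>" if "diff_free t" "twf ?\<Gamma> t" for t
    unfolding h0_def using term_derivation_diff_free[OF v_def that] by simp
  have gc: "cl (TGen x) \<in> carrier (opcmp Op (gen_arity ?\<Gamma> x) (gen_degree ?\<Gamma> x))" for x
    using cl_closed[of "TGen x"] by simp
  have d_gen: "h0 (TDiff (TGen x)) = of_nat (jacobi_weight x) \<odot>\<^bsub>opcmp Op (gen_arity ?\<Gamma> x) (gen_degree ?\<Gamma> x)\<^esub> cl (TGen x)" for x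
  proof -
    have "odiff Op (v x) = \<zero>\<^bsub>opcmp Op (gen_arity ?\<Gamma> x) (gen_degree ?\<Gamma> x)\<^esub>"
      unfolding v_def by (rule Op.odiff_lin(3)) simp
    moreover have "W (cl (TGen x)) = of_nat (jacobi_weight x) \<odot>\<^bsub>opcmp Op (gen_arity ?\<Gamma> x) (gen_degree ?\<Gamma> x)\<^esub> cl (TGen x)"
      by (rule W_homogeneous) (auto simp: terms_def intro: homogeneous.intros)
    ultimately show ?thesis
      using gc[of x] by (simp add: h0_def Op.linear_simps)
  qed
  have d_i: "h0 (TDiff (TGen JI)) = cl (TGen JI)"
    using d_gen[of JI] gc[of JI] by (simp add: Op.smult_simps(4))
  have gens: "cl (TGen JI) \<in> carrier (opcmp Op 1 (- 2))" "cl (TGen JJ) \<in> carrier (opcmp Op 1 (- 1))"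
    "cl (TDiff (TGen JI)) \<in> carrier (opcmp Op 1 (- 1))"
    using gc[of JI] gc[of JJ] cl_closed[of "TDiff (TGen JI)"] by simp_all
  have vIJ: "h0 (TGen JI) = \<zero>\<^bsub>opcmp Op 1 (- 3)\<^esub>" "h0 (TGen JJ) = \<zero>\<^bsub>opcmp Op 1 (- 2)\<^esub>"
    by (simp_all add: h0_def v_def)
  have comp: "h0 (TComp x 1 y) = pcomp Op (h0 x) 1 (cl y) \<oplus>\<^bsub>opcmp Op 1 (tdegree ?\<Gamma> x + tdegree ?\<Gamma> y - 1)\<^esub>
      ksign (tdegree ?\<Gamma> x) \<odot>\<^bsub>opcmp Op 1 (tdegree ?\<Gamma> x + tdegree ?\<Gamma> y - 1)\<^esub> pcomp Op (cl x) 1 (h0 y)"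
    if "tarity ?\<Gamma> x = 1" "tarity ?\<Gamma> y = 1" for x y
    using that by (simp add: h0_def Let_def)
  note pz = Op.pcomp_lin_left(4)[where m = 1 and n = 1 and N = 1 and i = 1]
    Op.pcomp_lin_right(4)[where m = 1 and n = 1 and N = 1 and i = 1]
  have ii: "pcomp Op (cl (TGen JI)) 1 (cl (TGen JI)) \<in> carrier (opcmp Op 1 (- 4))"
    and ij: "pcomp Op (cl (TGen JI)) 1 (cl (TGen JJ)) \<in> carrier (opcmp Op 1 (- 3))"
    by (rule Op.pcomp_closed[OF gens(1) gens(1)] Op.pcomp_closed[OF gens(1) gens(2)]; simp)+
  have rels: "h0 t = h0 u" if "(t, u) \<in> relations ?\<Gamma>" for t u
  proof -
    have ty: "twf ?\<Gamma> t" "twf ?\<Gamma> u" "tarity ?\<Gamma> t = tarity ?\<Gamma> u" "tdegree ?\<Gamma> t = tdegree ?\<Gamma> u"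
      using typed[OF tcong.rel[OF that]] by (auto simp: same_type_def)
    have free_case: "h0 t = h0 u" if "diff_free t" "diff_free u"
      using free that ty by simp
    from that show ?thesis
    proof (cases rule: jacobi_relation_cases)
      case comm
      then consider "diff_free t" "diff_free u" | "t = TDiff (TGen JMu)" "u = TZero 2 1"
        by (auto simp: comm_relations_def)
      then show ?thesis
      proof cases
        case 2
        then show ?thesis
          using d_gen[of JMu] gc[of JMu] by (simp add: h0_def Op.smult_simps(5) zero_cl)
      qed (rule free_case)
    next
      case i_di
      have 1: "h0 t = pcomp Op (cl (TGen JI)) 1 (cl (TGen JI))"
        unfolding i_di using ii
        by (simp add: comp vIJ d_i pz(1)[OF gens(3)] Op.linear_simps ksign_def del: One_nat_def)
      have "h0 (TComp (TDiff (TGen JI)) 1 (TGen JI)) = pcomp Op (cl (TGen JI)) 1 (cl (TGen JI))"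
        using ii by (simp add: comp vIJ d_i pz(2)[OF gens(3)] Op.linear_simps ksign_def del: One_nat_def)
      moreover have "h0 (TScale 2 (TComp (TGen JJ) 1 (TGen JI))) = \<zero>\<^bsub>opcmp Op 1 (- 4)\<^esub>"
        by (subst free) auto
      ultimately have "h0 u = pcomp Op (cl (TGen JI)) 1 (cl (TGen JI)) \<oplus>\<^bsub>opcmp Op 1 (- 4)\<^esub> \<zero>\<^bsub>opcmp Op 1 (- 4)\<^esub>"
        unfolding i_di by (simp add: h0_def)
      then show ?thesis using 1 ii by (simp add: Op.linear_simps)
    next
      case di_j
      have ji: "pcomp Op (cl (TGen JJ)) 1 (cl (TGen JI)) = pcomp Op (cl (TGen JI)) 1 (cl (TGen JJ))"
      proof -
        have "(TComp (TGen JI) 1 (TGen JJ), TComp (TGen JJ) 1 (TGen JI)) \<in> relations ?\<Gamma>"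
          by (simp add: jacobi_presentation_def Let_def)
        then have "cl (TComp (TGen JI) 1 (TGen JJ)) = cl (TComp (TGen JJ) 1 (TGen JI))"
          by (intro cl_eq tcong.rel)
        then show ?thesis
          using cl_ops(6)[of "TGen JI" "TGen JJ" 1] cl_ops(6)[of "TGen JJ" "TGen JI" 1] by simp
      qed
      have "h0 (TComp (TDiff (TGen JI)) 1 (TGen JJ)) = pcomp Op (cl (TGen JI)) 1 (cl (TGen JJ))"
        using ij by (simp add: comp vIJ d_i pz(2)[OF gens(3)] Op.linear_simps ksign_def del: One_nat_def)
      moreover have "h0 (TComp (TGen JJ) 1 (TDiff (TGen JI)))
          = (- 1) \<odot>\<^bsub>opcmp Op 1 (- 3)\<^esub> pcomp Op (cl (TGen JI)) 1 (cl (TGen JJ))"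
        using ij by (simp add: comp vIJ d_i ji pz(1)[OF gens(3)] Op.linear_simps ksign_def del: One_nat_def)
      ultimately have "h0 t = pcomp Op (cl (TGen JI)) 1 (cl (TGen JJ)) \<oplus>\<^bsub>opcmp Op 1 (- 3)\<^esub>
          (- 1) \<odot>\<^bsub>opcmp Op 1 (- 3)\<^esub> pcomp Op (cl (TGen JI)) 1 (cl (TGen JJ))"
        unfolding di_j by (simp add: h0_def)
      moreover have "h0 u = \<zero>\<^bsub>opcmp Op 1 (- 3)\<^esub>" unfolding di_j by (simp add: h0_def zero_cl)
      ultimately show ?thesis using ij by (simp add: Op.linear_simps)
    next
      case do_j
      have "diff_free t \<and> diff_free u" by (rule diff_free_do_relation[OF _ _ do_j]) simp_all
      then show ?thesis using free_case by blast
    next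
      case do_i
      have "diff_free t \<and> diff_free u" by (rule diff_free_do_relation[OF _ _ do_i]) simp_all
      then show ?thesis using free_case by blast
    qed (rule free_case; simp)+
  qed
  show thesis
  proof (rule derivation_exists[OF twisting_weight_operator v rels[unfolded h0_def]], assumption)
    fix h
    assume lin: "\<And>n d. linear_map (opcmp Op n d) (opcmp Op n (d - 1)) h"
      and od: "\<And>n d A. A \<in> Op.cmps n d \<Longrightarrow> h (odiff Op A)
         = W A \<oplus>\<^bsub>opcmp Op n (d + 1 - 1)\<^esub> ksign 1 \<odot>\<^bsub>opcmp Op n (d + 1 - 1)\<^esub> odiff Op (h A)"
    show thesis
    proof (rule that, intro contracted_presentation.intro contracted_presentation_axioms.intro weight_operator_axioms lin)
      show "h (odiff Op A) = W A \<oplus>\<^bsub>opcmp Op n d\<^esub> - 1 \<odot>\<^bsub>opcmp Op n d\<^esub> odiff Op (h A)"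
        if "A \<in> Op.cmps n d" for n d A
        using od[OF that] by (simp add: ksign_def)
    qed (rule lin)
  qed
qed

lemma map_generator_typing:
  fixes t :: "('k::field, comm_gen) dgterm"
  shows "tarity (jacobi_presentation :: ('k, jacobi_gen) dg_presentation) (map_dgterm (\<lambda>_. JMu) t) = tarity comm_presentation t"
    and "tdegree (jacobi_presentation :: ('k, jacobi_gen) dg_presentation) (map_dgterm (\<lambda>_. JMu) t) = tdegree comm_presentation t"
    and "twf comm_presentation t \<Longrightarrow> twf (jacobi_presentation :: ('k, jacobi_gen) dg_presentation) (map_dgterm (\<lambda>_. JMu) t)"
proof -
  let ?J = "jacobi_presentation :: ('k, jacobi_gen) dg_presentation" and ?m = "map_dgterm (\<lambda>_. JMu)"
  have ty: "tarity ?J (?m u) = tarity comm_presentation u \<and> tdegree ?J (?m u) = tdegree comm_presentation u"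
    for u :: "('k, comm_gen) dgterm" by (induction u) auto
  then show "tarity ?J (?m t) = tarity comm_presentation t" "tdegree ?J (?m t) = tdegree comm_presentation t"
    by auto
  show "twf comm_presentation t \<Longrightarrow> twf ?J (?m t)"
    by (induction t) (auto simp: ty same_type_def)
qed

interpretation C: wf_dg_presentation "comm_presentation :: ('k::field, comm_gen) dg_presentation"
  by (intro wf_dg_presentation.intro wf_comm_presentation)

interpretation J: wf_dg_presentation "jacobi_presentation :: ('k::field, jacobi_gen) dg_presentation"
  by (intro wf_dg_presentation.intro wf_jacobi_presentation)

lemma comm_relations_jacobi: "(t, u) \<in> comm_relations JMu \<Longrightarrow> (t, u) \<in> relations jacobi_presentation"
  by (auto simp: comm_relations_def jacobi_presentation_def Let_def)

text \<open>Renaming \<open>\<mu>\<close> in a term amounts to evaluating the term in the Jacobi operad. Hence the result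
  depends on the class of the term only, and the renaming is the morphism given by the universal property.\<close>

lemma comm_to_jacobi_hom:
  shows "dg_operad_hom comm_operad jacobi_operad
      (comm_to_jacobi :: ('k::field, comm_gen) dgterm set \<Rightarrow> ('k, jacobi_gen) dgterm set)"
    and "twf comm_presentation t \<Longrightarrow> (comm_to_jacobi :: ('k, comm_gen) dgterm set \<Rightarrow> _) (tclass comm_presentation t)
      = tclass jacobi_presentation (map_dgterm (\<lambda>_. JMu) t)"
proof -
  let ?C = "comm_presentation :: ('k, comm_gen) dg_presentation"
  let ?J = "jacobi_presentation :: ('k, jacobi_gen) dg_presentation"
  let ?m = "map_dgterm (\<lambda>_. JMu) :: ('k, comm_gen) dgterm \<Rightarrow> ('k, jacobi_gen) dgterm"
  let ?v = "\<lambda>_ :: comm_gen. tclass ?J (TGen JMu)"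
  have v: "?v x \<in> carrier (opcmp (presented_operad ?J) (gen_arity ?C x) (gen_degree ?C x))" for x
    using J.cl_closed[of "TGen JMu"] by simp
  have rels: "teval (presented_operad ?J) ?C ?v t = teval (presented_operad ?J) ?C ?v u"
    if "(t, u) \<in> relations ?C" for t u
    by (rule comm_relations_hold[where x = JMu and y = CMu])
      (use that in \<open>auto simp: wf_jacobi_presentation relations_comm comm_relations_jacobi\<close>)
  have eval: "teval (presented_operad ?J) ?C ?v t = tclass ?J (?m t)" if "twf ?C t" for t
    using that
  proof (induction t)
    case (TAdd t u)
    then show ?case
      using J.cl_ops(4)[of "?m t" "?m u"] by (simp add: map_generator_typing same_type_def)
  next
    case (TComp t i u)
    then show ?case
      using J.cl_ops(6)[of "?m t" "?m u" i] by (simp add: map_generator_typing)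
  next
    case (TAct t \<tau>)
    then show ?case
      using J.cl_ops(7)[of "?m t" \<tau>] by (simp add: map_generator_typing)
  qed (simp_all add: J.cl_ops map_generator_typing del: Image_singleton_iff)
  have on_class: "comm_to_jacobi (tclass ?C t) = tclass ?J (?m t)" if t: "twf ?C t" for t
    unfolding comm_to_jacobi_def
  proof (rule C.cl_UN[OF _ t])
    fix u assume tu: "tcong ?C t u"
    have "teval (presented_operad ?J) ?C ?v t = teval (presented_operad ?J) ?C ?v u"
      by (rule J.Op.teval_tcong[OF wf_comm_presentation v rels tu])
    then show "tclass ?J (?m t) = tclass ?J (?m u)"
      using C.typed[OF tu] eval by simp
  qed
  then show "twf comm_presentation t \<Longrightarrow> (comm_to_jacobi :: ('k, comm_gen) dgterm set \<Rightarrow> _) (tclass comm_presentation t)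
      = tclass jacobi_presentation (map_dgterm (\<lambda>_. JMu) t)" .
  show "dg_operad_hom comm_operad jacobi_operad (comm_to_jacobi :: ('k, comm_gen) dgterm set \<Rightarrow> ('k, jacobi_gen) dgterm set)"
  proof (rule C.hom_exists[OF J.dg_operad_Op v rels], assumption)
    fix \<phi> assume \<phi>: "dg_operad_hom (presented_operad ?C) (presented_operad ?J) \<phi>"
      "\<And>t. twf ?C t \<Longrightarrow> \<phi> (tclass ?C t) = teval (presented_operad ?J) ?C ?v t"
    show ?thesis
      unfolding comm_operad_def jacobi_operad_def
    proof (rule dg_operad_hom_cong[OF \<phi>(1)])
      fix n d A assume "A \<in> carrier (opcmp (presented_operad ?C) n d)"
      then obtain t where t: "twf ?C t" and A: "A = tclass ?C t" by (auto simp: terms_def elim!: C.carrierE)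
      show "comm_to_jacobi A = \<phi> A" unfolding A using on_class[OF t] \<phi>(2)[OF t] eval[OF t] by simp
    qed
  qed
qed

lemma comm_to_jacobi_mu:
  "(comm_to_jacobi :: ('k::field, comm_gen) dgterm set \<Rightarrow> ('k, jacobi_gen) dgterm set) comm_mu = jacobi_mu"
  using comm_to_jacobi_hom(2)[of "TGen CMu"] by (simp add: comm_mu_def jacobi_mu_def)

text \<open>The retraction \<open>\<mu> \<mapsto> \<mu>\<close>, \<open>i \<mapsto> 0\<close>, \<open>j \<mapsto> 0\<close>.\<close>

lemma jacobi_to_comm_exists:
  obtains \<psi> :: "('k::field, jacobi_gen) dgterm set \<Rightarrow> ('k, comm_gen) dgterm set"
  where "dg_operad_hom jacobi_operad comm_operad \<psi>" and "\<psi> jacobi_mu = comm_mu"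
    and "\<And>x. 0 < jacobi_weight x \<Longrightarrow> \<psi> (tclass jacobi_presentation (TGen x))
       = \<zero>\<^bsub>opcmp comm_operad (gen_arity (jacobi_presentation :: ('k, jacobi_gen) dg_presentation) x)
           (gen_degree (jacobi_presentation :: ('k, jacobi_gen) dg_presentation) x)\<^esub>"
proof -
  let ?C = "comm_presentation :: ('k, comm_gen) dg_presentation"
  let ?J = "jacobi_presentation :: ('k, jacobi_gen) dg_presentation"
  define v where "v x = (if x = JMu then tclass ?C (TGen CMu)
    else \<zero>\<^bsub>opcmp (presented_operad ?C) (gen_arity ?J x) (gen_degree ?J x)\<^esub>)" for x
  have v: "v x \<in> carrier (opcmp (presented_operad ?C) (gen_arity ?J x) (gen_degree ?J x))" for x
    using C.cl_closed[of "TGen CMu"] C.Op.zero_closed by (auto simp: v_def)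
  have v0: "v x = \<zero>\<^bsub>opcmp (presented_operad ?C) (gen_arity ?J x) (gen_degree ?J x)\<^esub>" if "0 < jacobi_weight x" for x
    using that by (auto simp: v_def)
  have rels: "teval (presented_operad ?C) ?J v t = teval (presented_operad ?C) ?J v u"
    if tu: "(t, u) \<in> relations ?J" for t u
    using jacobi_relation_weight[OF tu]
  proof (elim disjE conjE exE)
    assume "(t, u) \<in> comm_relations JMu"
    then show ?thesis
      by (intro comm_relations_hold[where x = CMu and y = JMu])
        (auto simp: wf_comm_presentation relations_comm v_def)
  next
    fix w assume w: "0 < w" "homogeneous jacobi_weight w t" "homogeneous jacobi_weight w u"
    have ty: "twf ?J t" "twf ?J u" "same_type ?J t u" using J.typed[OF tcong.rel[OF tu]] by auto
    show ?thesis
      using C.Op.teval_positive_weight[OF v v0 w(2) ty(1) w(1)] C.Op.teval_positive_weight[OF v v0 w(3) ty(2) w(1)] ty(3)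
      by (simp add: same_type_def)
  qed
  show thesis
  proof (rule J.hom_exists[OF C.dg_operad_Op v rels], assumption)
    fix \<psi> assume \<psi>: "dg_operad_hom (presented_operad ?J) (presented_operad ?C) \<psi>"
      "\<And>t. twf ?J t \<Longrightarrow> \<psi> (tclass ?J t) = teval (presented_operad ?C) ?J v t"
    show thesis
      by (rule that[of \<psi>])
        (use \<psi>(1) \<psi>(2)[of "TGen _"] v0 in \<open>auto simp: comm_operad_def jacobi_operad_def jacobi_mu_def comm_mu_def v_def\<close>)
  qed
qed

theorem theorem5p29:
  "dg_operad_hom comm_operad jacobi_operad
     (comm_to_jacobi :: ('k::field_char_0, comm_gen) dgterm set \<Rightarrow> ('k, jacobi_gen) dgterm set)
   \<and> (comm_to_jacobi :: ('k, comm_gen) dgterm set \<Rightarrow> ('k, jacobi_gen) dgterm set) comm_mu = jacobi_mu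
   \<and> (\<forall>n d. inj_on (comm_to_jacobi :: ('k, comm_gen) dgterm set \<Rightarrow> ('k, jacobi_gen) dgterm set)
        (carrier (opcmp comm_operad n d)))
   \<and> operad_quasi_iso comm_operad jacobi_operad
     (comm_to_jacobi :: ('k, comm_gen) dgterm set \<Rightarrow> ('k, jacobi_gen) dgterm set)"
proof -
  let ?C = "comm_presentation :: ('k, comm_gen) dg_presentation"
  let ?J = "jacobi_presentation :: ('k, jacobi_gen) dg_presentation"
  let ?\<phi> = "comm_to_jacobi :: ('k, comm_gen) dgterm set \<Rightarrow> ('k, jacobi_gen) dgterm set"
  have \<phi>_mu: "?\<phi> comm_mu = jacobi_mu" by (rule comm_to_jacobi_mu)
  interpret \<phi>: dg_operad_hom comm_operad jacobi_operad ?\<phi> by (rule comm_to_jacobi_hom)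
  obtain \<psi> :: "('k, jacobi_gen) dgterm set \<Rightarrow> ('k, comm_gen) dgterm set"
    where \<psi>: "dg_operad_hom jacobi_operad comm_operad \<psi>" and \<psi>_mu: "\<psi> jacobi_mu = comm_mu"
      and \<psi>_0: "\<And>x. 0 < jacobi_weight x \<Longrightarrow> \<psi> (tclass ?J (TGen x))
        = \<zero>\<^bsub>opcmp comm_operad (gen_arity ?J x) (gen_degree ?J x)\<^esub>"
    using jacobi_to_comm_exists by blast
  interpret \<psi>: dg_operad_hom jacobi_operad comm_operad \<psi> by (rule \<psi>)
  \<comment> \<open>Both \<open>\<psi> \<phi>\<close> and the identity fix the generator of the commutative operad.\<close>
  have retract: "\<psi> (?\<phi> A) = A" if A_in: "A \<in> carrier (opcmp comm_operad n d)" for A n d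
  proof -
    obtain t where t: "twf ?C t" and A: "A = tclass ?C t"
      using A_in by (auto simp: comm_operad_def terms_def elim!: C.carrierE)
    have hom: "dg_operad_hom (presented_operad ?C) (presented_operad ?C) (\<lambda>A. \<psi> (?\<phi> A))"
      using dg_operad_hom_comp[OF \<phi>.dg_operad_hom_axioms \<psi>] by (simp add: comm_operad_def)
    have gen: "\<psi> (?\<phi> (tclass ?C (TGen x))) = tclass ?C (TGen x)" for x
      using \<phi>_mu \<psi>_mu by (cases x) (simp add: comm_mu_def)
    show ?thesis
      unfolding A using C.hom_cl[OF hom gen t] C.teval_Op[OF t] by simp
  qed
  let ?\<rho> = "\<lambda>A. ?\<phi> (\<psi> A)"
  \<comment> \<open>The endomorphism \<open>\<phi> \<psi>\<close> is the projection to weight 0.\<close>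
  have \<rho>: "dg_operad_hom (presented_operad ?J) (presented_operad ?J) ?\<rho>"
    using dg_operad_hom_comp[OF \<psi> \<phi>.dg_operad_hom_axioms] by (simp add: jacobi_operad_def)
  have \<rho>_pos: "?\<rho> (tclass ?J (TGen x)) = \<zero>\<^bsub>opcmp (presented_operad ?J) (gen_arity ?J x) (gen_degree ?J x)\<^esub>"
    if "0 < jacobi_weight x" for x
    using \<psi>_0[OF that] \<phi>.hom_zero by (simp add: jacobi_operad_def)
  have \<rho>_0: "?\<rho> (tclass ?J (TGen x)) = tclass ?J (TGen x)" if "jacobi_weight x = 0" for x
    using that \<psi>_mu \<phi>_mu by (cases x) (simp_all add: jacobi_mu_def)
  obtain W where "weight_operator ?J jacobi_weight W"
    using weighted_presentation.weight_operator_exists[OF weighted_jacobi] by blast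
  then obtain h where "contracted_presentation ?J jacobi_weight W h"
    using jacobi_contraction by blast
  then have cohomologous: "A \<oplus>\<^bsub>opcmp jacobi_operad n d\<^esub> (- 1) \<odot>\<^bsub>opcmp jacobi_operad n d\<^esub> ?\<rho> A
      \<in> coboundaries jacobi_operad n d" if "A \<in> cocycles jacobi_operad n d" for A n d
    using contracted_presentation.cocycle_cohomologous_to_weight_0_part[OF _ _ \<rho> \<rho>_pos \<rho>_0] that
    by (simp add: jacobi_operad_def)
  have "operad_quasi_iso comm_operad jacobi_operad ?\<phi>"
  proof (rule \<phi>.operad_quasi_isoI)
    fix n d and x :: "('k, comm_gen) dgterm set"
    assume x: "x \<in> cocycles comm_operad n d" "?\<phi> x \<in> coboundaries jacobi_operad n d"
    then show "x \<in> coboundaries comm_operad n d"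
      using \<psi>.hom_coboundaries[OF x(2)] retract[of x n d] by (simp add: cocycles_def)
  next
    fix n d and y :: "('k, jacobi_gen) dgterm set"
    assume y: "y \<in> cocycles jacobi_operad n d"
    show "\<exists>x\<in>cocycles comm_operad n d. y \<oplus>\<^bsub>opcmp jacobi_operad n d\<^esub>
        (- 1) \<odot>\<^bsub>opcmp jacobi_operad n d\<^esub> ?\<phi> x \<in> coboundaries jacobi_operad n d"
      using \<psi>.hom_cocycles[OF y] cohomologous[OF y] by blast
  qed
  moreover have "inj_on ?\<phi> (carrier (opcmp comm_operad n d))" for n d
    using retract by (intro inj_on_inverseI[of _ \<psi>]) blast
  ultimately show ?thesis
    using \<phi>.dg_operad_hom_axioms \<phi>_mu by blast
qed

end
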